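(* There exists a constant $0<C_{\mathbb{H}}\le 1$ such that for all $d\in\mathbb{N}_0$ $$C_{\mathbf{h}^d}^*\ \ge\ \frac{C_{\mathbb{H}}}{\sqrt{2d+1}},$$ where $\mathbf{h}^d=(h_0,\ldots,h_d)\in L^2(\mathbb{R};\mathbb{C}^{d+1})$ is the vector of the first $d+1$ Hermite functions and $C^*_{\mathbf{h}^d}$ is the optimal (largest) Gabor frame constant of $\mathbf{h}^d$ as defined in the context.
   Context: For $m\ge1$, $L^2(\mathbb{R};\mathbb{C}^m)$ is identified with the $m$-fold direct sum of $L^2(\mathbb{R})$, with scalar product $\langle \mathbf{g},\mathbf{f}\rangle=\sum_{i}\langle g_i,f_i\rangle$. Translations and modulations are $(T_y\mathbf{f})(x)=\mathbf{f}(x-y)$ and $(M_\xi\mathbf{f})(x)=e^{2\pi i\xi x}\mathbf{f}(x)$. For $\gamma=(\gamma_1,\gamma_2)\in\mathbb{R}^2$ put $\mathbf{f}_\gamma=T_{\gamma_1}M_{\gamma_2}\mathbf{f}$, and for $\Gamma\subset\mathbb{R}^2$ the Gabor system is $\mathcal{G}(\mathbf{f},\Gamma)=(\mathbf{f}_\gamma)_{\gamma\in\Gamma}$. A family $(\eta_i)_{i\in I}$ in a Hilbert space $\mathcal{H}$ is a frame with (lower, upper) frame bounds $0<A\le B$ if $A\|\varphi\|^2\le\sum_{i\in I}|\langle\varphi,\eta_i\rangle|^2\le B\|\varphi\|^2$ for all $\varphi\in\mathcal{H}$. Frame bounds are not assumed to be optimal. The matrix norm is $\|\mathcal{M}\|=\sup\{\|\mathcal{M}z\|_2: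 z\in\mathbb{R}^2,\ \|z\|_\infty\le 1/2\}$, where $\|\cdot\|_p$ is the $\ell^p$-norm on $\mathbb{R}^2$. Hermite functions: for $n\in\mathbb{N}_0$, $h_n(x)=\frac{(-1)^n}{\sqrt{2^n n!\sqrt{\pi}}}\,e^{x^2/2}\,\frac{d^n}{dx^n}e^{-x^2}$, so $\|h_n\|_2=1$; they are pairwise orthogonal Schwartz functions. Optimal constant: for $\mathbf{f}=(f_1,\ldots,f_m)$ with $f_i\in\mathcal{S}(\mathbb{R})$ and $\langle f_i,f_j\rangle=\delta_{i,j}$, call $C\in(0,1]$ admissible for $\mathbf{f}$ if for every invertible real $2\times2$ matrix $\mathcal{M}$ with $\|\mathcal{M}\|<C$ the system $\mathcal{G}(\mathbf{f},\mathcal{M}(\mathbb{Z}^2))$ is a frame of $L^2(\mathbb{R};\mathbb{C}^m)$ with lower frame bound $\frac{1}{|\det(\mathcal{M})|}\left(1-\frac{\|\mathcal{M}\|}{C}\right)^2$ and upper frame bound $\frac{1}{|\det(\mathcal{M})|}\left(1+\frac{\|\mathcal{M}\|}{C}\right)^2$. Then $C^*_{\mathbf{f}}$ denotes the supremum of all admissible constants for $\mathbf{f}$. *)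

theory Defs
  imports "HOL-Analysis.Analysis"
begin

text \<open>
  Since the number \<open>m\<close> of components varies inside the statement, an element of
  \<open>L\<^sup>2(R; C\<^sup>m)\<close> is represented by a family \<open>f :: nat \<Rightarrow> real \<Rightarrow> complex\<close> of which only
  the components \<open>f i\<close> with \<open>i < m\<close> matter.  Functions are not identified almost
  everywhere; all notions below depend only on the a.e. classes of these components.
\<close>

type_synonym vfun = "nat \<Rightarrow> real \<Rightarrow> complex"

definition L2 :: "nat \<Rightarrow> vfun set" where
  "L2 m = {f. \<forall>i<m. f i \<in> borel_measurable lborel \<and>
                      integrable lborel (\<lambda>x. (cmod (f i x))\<^sup>2)}"

definition L2_inner :: "nat \<Rightarrow> vfun \<Rightarrow> vfun \<Rightarrow> complex" where
  "L2_inner m g f = (\<Sum>i<m. LINT x|lborel. g i x * cnj (f i x))"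

definition L2_norm :: "nat \<Rightarrow> vfun \<Rightarrow> real" where
  "L2_norm m f = sqrt (\<Sum>i<m. LINT x|lborel. (cmod (f i x))\<^sup>2)"

definition translate :: "real \<Rightarrow> vfun \<Rightarrow> vfun" where
  "translate y f = (\<lambda>i x. f i (x - y))"

definition modulate :: "real \<Rightarrow> vfun \<Rightarrow> vfun" where
  "modulate \<xi> f = (\<lambda>i x. cis (2 * pi * \<xi> * x) * f i x)"

definition tf_shift :: "vfun \<Rightarrow> real^2 \<Rightarrow> vfun" where
  "tf_shift f \<gamma> = translate (\<gamma> $ 1) (modulate (\<gamma> $ 2) f)"

text \<open>
  Explicit summability matters because \<open>infsum\<close> is \<open>0\<close> on non-summable families.
\<close>

definition frame_with_bounds ::
    "nat \<Rightarrow> 'i set \<Rightarrow> ('i \<Rightarrow> vfun) \<Rightarrow> real \<Rightarrow> real \<Rightarrow> bool" where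
  "frame_with_bounds m I \<eta> A B \<longleftrightarrow>
     0 < A \<and> A \<le> B \<and> (\<forall>i\<in>I. \<eta> i \<in> L2 m) \<and>
     (\<forall>\<phi>\<in>L2 m.
        (\<lambda>i. (cmod (L2_inner m \<phi> (\<eta> i)))\<^sup>2) summable_on I \<and>
        A * (L2_norm m \<phi>)\<^sup>2 \<le> (\<Sum>\<^sub>\<infinity>i\<in>I. (cmod (L2_inner m \<phi> (\<eta> i)))\<^sup>2) \<and>
        (\<Sum>\<^sub>\<infinity>i\<in>I. (cmod (L2_inner m \<phi> (\<eta> i)))\<^sup>2) \<le> B * (L2_norm m \<phi>)\<^sup>2)"

definition mat_norm :: "real^2^2 \<Rightarrow> real" where
  "mat_norm M = (SUP z\<in>{z :: real^2. infnorm z \<le> 1 / 2}. norm (M *v z))"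

definition lattice_of :: "real^2^2 \<Rightarrow> (real^2) set" where
  "lattice_of M = (\<lambda>z. M *v z) ` {z. \<forall>i. z $ i \<in> \<int>}"

definition admissible :: "nat \<Rightarrow> vfun \<Rightarrow> real \<Rightarrow> bool" where
  "admissible m f C \<longleftrightarrow> 0 < C \<and> C \<le> 1 \<and>
     (\<forall>M :: real^2^2. invertible M \<and> mat_norm M < C \<longrightarrow>
        frame_with_bounds m (lattice_of M) (tf_shift f)
          (1 / \<bar>det M\<bar> * (1 - mat_norm M / C)\<^sup>2)
          (1 / \<bar>det M\<bar> * (1 + mat_norm M / C)\<^sup>2))"

text \<open>
  The optimal constant is meant for \<open>f\<close> with orthonormal Schwartz components; the
  definition itself makes sense for every \<open>f\<close>.  The supremum is taken in \<open>ereal\<close>, where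
  the empty set has supremum \<open>-\<infinity>\<close>, so that a positive lower bound on it entails that
  admissible constants exist.
\<close>

definition optimal_const :: "nat \<Rightarrow> vfun \<Rightarrow> ereal" where
  "optimal_const m f = (SUP C\<in>{C. admissible m f C}. ereal C)"

definition hermite :: "nat \<Rightarrow> real \<Rightarrow> real" where
  "hermite n x = (-1) ^ n / sqrt (2 ^ n * fact n * sqrt pi) * exp (x\<^sup>2 / 2) *
     (deriv ^^ n) (\<lambda>t. exp (- t\<^sup>2)) x"

text \<open>Read with \<open>m = d + 1\<close> components, this is \<open>(h\<^sub>0, \<dots>, h\<^sub>d)\<close>.\<close>

definition hermite_vec :: vfun where
  "hermite_vec = (\<lambda>i x. complex_of_real (hermite i x))"

end

theory Submission
  imports Defs "HOL-Probability.Probability"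
begin

text \<open>
  Up to a phase, \<open>\<langle>\<phi>, f\<^sub>\<gamma>\<rangle>\<close> is the value at \<open>\<gamma>\<close> of the short-time Fourier transform \<open>V\<^sub>f\<phi>\<close>, which for
  orthonormal windows is an isometry into \<open>L\<^sup>2\<close> of the plane (Plancherel in the frequency variable,
  then Tonelli).  The frame sum is therefore a Riemann sum of \<open>\<parallel>\<phi>\<parallel>\<^sup>2 = \<integral>\<bar>V\<^sub>f\<phi>\<bar>\<^sup>2\<close> over the cells of the lattice,
  and both frame bounds follow once the oscillation of \<open>\<bar>V\<^sub>f\<phi>\<bar>\<close> on the cells has \<open>L\<^sup>2\<close> norm at most
  \<open>\<parallel>M\<parallel> / C \<cdot> \<parallel>\<phi>\<parallel>\<close>.  Along a direction \<open>(u, v)\<close> the derivative of \<open>V\<^sub>f\<phi>\<close>, again up to a phase, is \<open>V\<^sub>A\<^sub>f\<phi>\<close> with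
  \<open>A f(x) = 2\<pi>ivx f(x) - u f'(x)\<close>, so the oscillation is bounded by the energies of the transforms with windows
  \<open>A f\<close> and \<open>A' A f\<close>, where \<open>A, A'\<close> belong to the two columns of the matrix.  On Hermite functions \<open>A\<close> is a
  combination of the ladder operators, which map \<open>h\<^sub>n\<close> to multiples of size \<open>O(\<surd>n)\<close> of \<open>h\<^sub>n\<^sub>-\<^sub>1\<close> and \<open>h\<^sub>n\<^sub>+\<^sub>1\<close>;
  by the isometry again, the energies are \<open>O(\<parallel>M\<parallel>\<^sup>2(2d+1))\<close> and \<open>O(\<parallel>M\<parallel>\<^sup>4(2d+1)\<^sup>2)\<close> times \<open>\<parallel>\<phi>\<parallel>\<^sup>2\<close>.
\<close>

section \<open>Continuity of translations and Plancherel's theorem\<close>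

text \<open>Square-integrable first derivatives do not control point values in the plane; this is
  the obstacle that forces the mixed second-order window A' A f. Its energy is of second order in
  \<parallel>M\<parallel>^2 (2d + 1) and is absorbed because this product is at most 1 in the range
  considered. The rate sqrt (2d + 1), with no further factor for the number of components, depends
  on using the isometry for the whole vector at once: each ladder operator maps (h_0, ..., h_d) to
  multiples of distinct Hermite functions, so only the largest coefficient counts. The operator A
  itself does not preserve orthogonality, which is why its two parts are separated. The bounds (1 -
  \<epsilon>)^2 and (1 + \<epsilon>)^2 come out without loss because a weighted Young inequality,
  summed over the cells with the best weight, is as sharp as the triangle inequality in L^2. The
  value 1/1000 is a crude numerical choice: it leaves room for an oscillation energy of 10^6
  \<parallel>M\<parallel>^2 (2d + 1) \<parallel>\<phi>\<parallel>^2, of which about half is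
  used.\<close>

lemma nn_integral_lborel_shift:
  assumes [measurable]: "f \<in> borel_measurable borel"
  shows "(\<integral>\<^sup>+x. f (x + r :: real) \<partial>lborel) = (\<integral>\<^sup>+x. f x \<partial>lborel)"
  using nn_integral_real_affine[of f 1 r] by (simp add: add.commute)

text \<open>Phrased with sequences to fit dominated convergence, and with values in
  \<open>ennreal\<close> so that it makes sense before integrability is known.\<close>

definition L1_shift_continuous :: "(real \<Rightarrow> complex) \<Rightarrow> bool" where
  "L1_shift_continuous f \<longleftrightarrow> (\<forall>r. r \<longlonglongrightarrow> 0 \<longrightarrow>
     (\<lambda>n. \<integral>\<^sup>+x. ennreal (cmod (f (x + r n) - f x)) \<partial>lborel) \<longlonglongrightarrow> 0)"

lemma tendsto_0_ennrealI:
  assumes "\<And>e::real. e > 0 \<Longrightarrow> eventually (\<lambda>n. f n < ennreal e) F"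
  shows "(f \<longlongrightarrow> (0::ennreal)) F"
proof (rule order_tendstoI)
  fix a :: ennreal assume "0 < a"
  then obtain e where e: "0 < e" "e < a" using dense by blast
  then have "e = ennreal (enn2real e)" "enn2real e > 0"
    using e(2) order_less_le_trans[OF e(2), of top] by (auto simp: enn2real_positive_iff)
  with assms[of "enn2real e"] have "eventually (\<lambda>n. f n < e) F" by simp
  then show "eventually (\<lambda>n. f n < a) F" by eventually_elim (use e in order)
qed simp

text \<open>The usual three-term split through g. Translation invariance makes the error f - g at
  the shifted point as small as at the point itself, so the choice of g does not depend on the
  shift.\<close>

lemma L1_shift_continuous_approx:
  assumes [measurable]: "f \<in> borel_measurable borel"
    and "\<And>e::real. e > 0 \<Longrightarrow> \<exists>g\<in>borel_measurable borel. L1_shift_continuous g \<and>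
           (\<integral>\<^sup>+x. ennreal (cmod (f x - g x)) \<partial>lborel) < ennreal e"
  shows "L1_shift_continuous f"
  unfolding L1_shift_continuous_def
proof (intro allI impI tendsto_0_ennrealI)
  fix r :: "nat \<Rightarrow> real" and e :: real assume r: "r \<longlonglongrightarrow> 0" and e: "e > 0"
  from assms(2)[of "e/3"] e obtain g where [measurable]: "g \<in> borel_measurable borel"
    and g: "L1_shift_continuous g" "(\<integral>\<^sup>+x. ennreal (cmod (f x - g x)) \<partial>lborel) < ennreal (e/3)" by auto
  have "(\<lambda>n. \<integral>\<^sup>+x. ennreal (cmod (g (x + r n) - g x)) \<partial>lborel) \<longlonglongrightarrow> 0"
    using g r by (auto simp: L1_shift_continuous_def)
  then have "eventually (\<lambda>n. (\<integral>\<^sup>+x. ennreal (cmod (g (x + r n) - g x)) \<partial>lborel) < ennreal (e/3)) sequentially"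
    using e by (auto simp: order_tendsto_iff)
  then show "eventually (\<lambda>n. (\<integral>\<^sup>+x. ennreal (cmod (f (x + r n) - f x)) \<partial>lborel) < ennreal e) sequentially"
  proof eventually_elim
    case (elim n)
    have "(\<integral>\<^sup>+x. ennreal (cmod (f (x + r n) - f x)) \<partial>lborel)
      \<le> (\<integral>\<^sup>+x. (ennreal (cmod (f (x + r n) - g (x + r n))) + ennreal (cmod (g (x + r n) - g x))) +
                ennreal (cmod (f x - g x)) \<partial>lborel)"
    proof (intro nn_integral_mono)
      fix x
      have "cmod (f (x + r n) - f x) \<le> cmod (f (x + r n) - g (x + r n)) + cmod (g (x + r n) - g x) + cmod (f x - g x)"
        using norm_triangle_ineq[of "f (x + r n) - g (x + r n)" "g (x + r n) - g x"]
          norm_triangle_ineq[of "f (x + r n) - g (x + r n) + (g (x + r n) - g x)" "g x - f x"]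
          norm_minus_commute[of "f x" "g x"]
        by (simp add: algebra_simps)
      then show "ennreal (cmod (f (x + r n) - f x)) \<le> (ennreal (cmod (f (x + r n) - g (x + r n))) + ennreal (cmod (g (x + r n) - g x))) +
                ennreal (cmod (f x - g x))"
        by (simp flip: ennreal_plus)
    qed
    also have "\<dots> = (\<integral>\<^sup>+x. ennreal (cmod (f x - g x)) \<partial>lborel)
        + (\<integral>\<^sup>+x. ennreal (cmod (g (x + r n) - g x)) \<partial>lborel) + (\<integral>\<^sup>+x. ennreal (cmod (f x - g x)) \<partial>lborel)"
      by (subst nn_integral_add, measurable)+
         (use nn_integral_lborel_shift[of "\<lambda>x. ennreal (cmod (f x - g x))" "r n"] in simp)
    also have "\<dots> < ennreal (e/3) + ennreal (e/3) + ennreal (e/3)"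
      by (intro add_strict_mono g elim)
    also have "\<dots> = ennreal e" using e by (simp flip: ennreal_plus)
    finally show ?case .
  qed
qed

lemma L1_shift_continuous_add:
  assumes [measurable]: "f \<in> borel_measurable borel" "g \<in> borel_measurable borel"
  assumes "L1_shift_continuous f" "L1_shift_continuous g"
  shows "L1_shift_continuous (\<lambda>x. f x + g x)"
  unfolding L1_shift_continuous_def
proof (intro allI impI)
  fix r :: "nat \<Rightarrow> real" assume r: "r \<longlonglongrightarrow> 0"
  show "(\<lambda>n. \<integral>\<^sup>+x. ennreal (cmod (f (x + r n) + g (x + r n) - (f x + g x))) \<partial>lborel) \<longlonglongrightarrow> 0"
  proof (rule tendsto_sandwich[OF _ _ tendsto_const])
    show "(\<lambda>n. (\<integral>\<^sup>+x. ennreal (cmod (f (x + r n) - f x)) \<partial>lborel) + (\<integral>\<^sup>+x. ennreal (cmod (g (x + r n) - g x)) \<partial>lborel)) \<longlonglongrightarrow> 0"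
      using tendsto_add[OF assms(3)[unfolded L1_shift_continuous_def, rule_format, OF r]
        assms(4)[unfolded L1_shift_continuous_def, rule_format, OF r]] by simp
    show "\<forall>\<^sub>F n in sequentially. (\<integral>\<^sup>+x. ennreal (cmod (f (x + r n) + g (x + r n) - (f x + g x))) \<partial>lborel)
       \<le> (\<integral>\<^sup>+x. ennreal (cmod (f (x + r n) - f x)) \<partial>lborel) + (\<integral>\<^sup>+x. ennreal (cmod (g (x + r n) - g x)) \<partial>lborel)"
    proof (intro always_eventually allI)
      fix n
      have "(\<integral>\<^sup>+x. ennreal (cmod (f (x + r n) + g (x + r n) - (f x + g x))) \<partial>lborel)
        \<le> (\<integral>\<^sup>+x. ennreal (cmod (f (x + r n) - f x)) + ennreal (cmod (g (x + r n) - g x)) \<partial>lborel)"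
        using norm_triangle_ineq[of "f (_ + r n) - f _" "g (_ + r n) - g _"]
        by (intro nn_integral_mono) (simp add: algebra_simps flip: ennreal_plus)
      also have "\<dots> = (\<integral>\<^sup>+x. ennreal (cmod (f (x + r n) - f x)) \<partial>lborel) + (\<integral>\<^sup>+x. ennreal (cmod (g (x + r n) - g x)) \<partial>lborel)"
        by (subst nn_integral_add) measurable
      finally show "(\<integral>\<^sup>+x. ennreal (cmod (f (x + r n) + g (x + r n) - (f x + g x))) \<partial>lborel) \<le> \<dots>" .
    qed
  qed auto
qed

text \<open>Up to the factor |c|, the L^1 distance between U and its translate is twice the measure
  of U minus twice the measure of the overlap. Openness puts x + r n into U eventually for each x in
  U, so the overlap tends to the full measure by dominated convergence.\<close>

lemma L1_shift_continuous_indicator_open: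
  assumes U: "open (U :: real set)" "emeasure lborel U < \<infinity>"
  shows "L1_shift_continuous (\<lambda>x. indicator U x *\<^sub>R c)"
  unfolding L1_shift_continuous_def
proof (intro allI impI)
  fix r :: "nat \<Rightarrow> real" assume r: "r \<longlonglongrightarrow> 0"
  have [measurable]: "U \<in> sets borel" using U by auto
  define I where "I = (\<lambda>n. \<integral>\<^sup>+x. indicator U x * indicator U (x + r n) \<partial>lborel)"
  define J where "J = (\<lambda>n. \<integral>\<^sup>+x. ennreal (cmod (indicator U (x + r n) *\<^sub>R c - indicator U x *\<^sub>R c)) \<partial>lborel)"
  let ?m = "emeasure lborel U"
  have "I \<longlonglongrightarrow> (\<integral>\<^sup>+x. indicator U x \<partial>lborel)" unfolding I_def
  proof (rule nn_integral_dominated_convergence[where w="indicator U"])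
    show "AE x in lborel. (\<lambda>n. indicator U x * indicator U (x + r n)) \<longlonglongrightarrow> (indicator U x :: ennreal)"
    proof (intro AE_I2)
      fix x
      show "(\<lambda>n. indicator U x * indicator U (x + r n)) \<longlonglongrightarrow> (indicator U x :: ennreal)"
      proof (cases "x \<in> U")
        case True
        have "(\<lambda>n. x + r n) \<longlonglongrightarrow> x" using tendsto_add[OF tendsto_const r, of x] by simp
        then have "eventually (\<lambda>n. x + r n \<in> U) sequentially" using U(1) True by (rule topological_tendstoD)
        then show ?thesis by (intro tendsto_eventually) (auto elim: eventually_mono simp: True)
      qed simp
    qed
    show "AE x in lborel. indicator U x * indicator U (x + r n) \<le> (indicator U x :: ennreal)" for n
      by (auto simp: indicator_def)
  qed (use U in simp_all)
  then have I: "I \<longlonglongrightarrow> ?m" by simp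
  \<comment> \<open>Written additively, since subtraction in \<open>ennreal\<close> undoes addition
    only for finite terms; finiteness is checked afterwards.\<close>
  have IJ: "J n + 2 * ennreal (cmod c) * I n = 2 * ennreal (cmod c) * ?m" for n
  proof -
    have "J n + 2 * ennreal (cmod c) * I n = (\<integral>\<^sup>+x. ennreal (cmod (indicator U (x + r n) *\<^sub>R c - indicator U x *\<^sub>R c))
        + 2 * ennreal (cmod c) * (indicator U x * indicator U (x + r n)) \<partial>lborel)"
      unfolding I_def J_def by (simp add: nn_integral_add nn_integral_cmult)
    also have "\<dots> = (\<integral>\<^sup>+x. ennreal (cmod c) * (indicator U x + indicator U (x + r n)) \<partial>lborel)"
      by (intro nn_integral_cong) (auto simp: indicator_def algebra_simps mult_2)
    also have "\<dots> = ennreal (cmod c) * (?m + ?m)"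
      using nn_integral_lborel_shift[of "indicator U :: real \<Rightarrow> ennreal" "r n"]
      by (simp add: nn_integral_cmult nn_integral_add)
    finally show ?thesis by (simp add: mult_2 algebra_simps)
  qed
  have fin: "2 * ennreal (cmod c) * ?m < \<infinity>" using U by (auto simp: ennreal_mult_less_top)
  have "J n = 2 * ennreal (cmod c) * ?m - 2 * ennreal (cmod c) * I n" for n
  proof -
    have "2 * ennreal (cmod c) * I n < \<infinity>"
      using IJ[of n] fin by (metis add.commute le_iff_add order_le_less_trans)
    then show ?thesis unfolding IJ[of n, symmetric] by simp
  qed
  moreover have "(\<lambda>n. 2 * ennreal (cmod c) * ?m - 2 * ennreal (cmod c) * I n) \<longlonglongrightarrow> 2 * ennreal (cmod c) * ?m - 2 * ennreal (cmod c) * ?m"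
  proof (rule tendsto_diff_ennreal_general[OF tendsto_const])
    show "(\<lambda>n. 2 * ennreal (cmod c) * I n) \<longlonglongrightarrow> 2 * ennreal (cmod c) * ?m"
      using I by (intro ennreal_tendsto_cmult) (auto simp: ennreal_mult_less_top)
    show "\<not> (2 * ennreal (cmod c) * ?m = \<infinity> \<and> 2 * ennreal (cmod c) * ?m = \<infinity>)"
      using fin by (metis less_irrefl)
  qed
  ultimately have "(\<lambda>n. J n) \<longlonglongrightarrow> 2 * ennreal (cmod c) * ?m - 2 * ennreal (cmod c) * ?m"
    by presburger
  then show "(\<lambda>n. \<integral>\<^sup>+x. ennreal (cmod (indicator U (x + r n) *\<^sub>R c - indicator U x *\<^sub>R c)) \<partial>lborel) \<longlonglongrightarrow> 0"
    using fin unfolding J_def by (simp add: less_top)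
qed

text \<open>Outer regularity replaces A by an open superset of nearly the same measure.\<close>

lemma L1_shift_continuous_indicator:
  assumes A[measurable]: "A \<in> sets borel" and fin: "emeasure lborel A < \<infinity>"
  shows "L1_shift_continuous (\<lambda>x. indicator A x *\<^sub>R c)"
proof (rule L1_shift_continuous_approx)
  fix e :: real assume e: "e > 0"
  \<comment> \<open>The added 1 keeps the quotient positive and well defined when c = 0.\<close>
  define d where "d = e / (cmod c + 1)"
  have d: "d > 0" "cmod c * d < e" using e
    by (auto simp: d_def field_simps add_pos_nonneg add_nonneg_pos)
  obtain U where U: "open U" "A \<subseteq> U" "emeasure lborel (U - A) < ennreal d"
    using outer_regular_lborel[OF A d(1)] by auto
  have [measurable]: "U \<in> sets borel" using U by auto
  have "emeasure lborel U \<le> emeasure lborel A + emeasure lborel (U - A)"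
    using U by (subst plus_emeasure) (auto simp: Un_absorb1 Un_commute)
  also have "\<dots> < \<infinity>" using U fin by (auto simp: less_top[symmetric] ennreal_add_less_top intro: order_less_trans)
  finally have "emeasure lborel U < \<infinity>" .
  then have "L1_shift_continuous (\<lambda>x. indicator U x *\<^sub>R c)" by (intro L1_shift_continuous_indicator_open U)
  moreover have "(\<integral>\<^sup>+x. ennreal (cmod (indicator A x *\<^sub>R c - indicator U x *\<^sub>R c)) \<partial>lborel) < ennreal e"
  proof -
    have "(\<integral>\<^sup>+x. ennreal (cmod (indicator A x *\<^sub>R c - indicator U x *\<^sub>R c)) \<partial>lborel) = (\<integral>\<^sup>+x. ennreal (cmod c) * indicator (U - A) x \<partial>lborel)"
      using U(2) by (intro nn_integral_cong) (auto simp: indicator_def)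
    also have "\<dots> = ennreal (cmod c) * emeasure lborel (U - A)" by (simp add: nn_integral_cmult)
    also have "\<dots> \<le> ennreal (cmod c) * ennreal d" using U by (intro mult_left_mono) auto
    also have "\<dots> < ennreal e" using d e by (simp flip: ennreal_mult add: ennreal_lessI)
    finally show ?thesis .
  qed
  ultimately show "\<exists>g\<in>borel_measurable borel. L1_shift_continuous g \<and>
           (\<integral>\<^sup>+x. ennreal (cmod (indicator A x *\<^sub>R c - g x)) \<partial>lborel) < ennreal e"
    by (intro bexI[of _ "\<lambda>x. indicator U x *\<^sub>R c"]) auto
qed measurable

lemma integrable_L1_shift_continuous:
  assumes "integrable lborel f"
  shows "L1_shift_continuous f"
  using assms
proof (induction rule: integrable_induct)
  case (base A c)
  then show ?case using L1_shift_continuous_indicator[of A c] by auto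
next
  case (add f g)
  then show ?case by (intro L1_shift_continuous_add) (auto dest: borel_measurable_integrable)
next
  case (lim f s)
  have [measurable]: "f \<in> borel_measurable borel" "\<And>i. s i \<in> borel_measurable borel"
    using lim by (auto dest: borel_measurable_integrable)
  have "(\<lambda>i. \<integral>\<^sup>+x. norm (s i x - f x) \<partial>lborel) \<longlonglongrightarrow> (\<integral>\<^sup>+x. 0 \<partial>(lborel :: real measure))"
  \<comment> \<open>The approximants supplied by \<open>integrable_induct\<close> have norm at most
    twice that of f, so their distance to f is at most three times the norm of f.\<close>
  proof (rule nn_integral_dominated_convergence[of _ _ _ "\<lambda>x. ennreal (3 * norm (f x))"])
    show "AE x in lborel. ennreal (cmod (s i x - f x)) \<le> ennreal (3 * cmod (f x))" for i
      using lim(3) norm_triangle_ineq4[of "s i _" "f _"] by (intro AE_I2 ennreal_leI) (smt (verit) UNIV_I space_lborel)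
    show "(\<integral>\<^sup>+ x. ennreal (3 * cmod (f x)) \<partial>lborel) < \<infinity>"
      using lim(4) by (simp add: ennreal_mult integrable_iff_bounded nn_integral_cmult ennreal_mult_less_top)
    show "AE x in lborel. (\<lambda>i. ennreal (cmod (s i x - f x))) \<longlonglongrightarrow> 0"
      using lim(2) by (intro AE_I2) (auto simp flip: ennreal_0 simp: tendsto_norm_zero_iff LIM_zero_iff)
  qed auto
  then have L: "(\<lambda>i. \<integral>\<^sup>+x. norm (s i x - f x) \<partial>lborel) \<longlonglongrightarrow> 0" by simp
  show ?case
  proof (rule L1_shift_continuous_approx)
    fix e :: real assume "e > 0"
    then have "eventually (\<lambda>i. (\<integral>\<^sup>+x. norm (s i x - f x) \<partial>lborel) < ennreal e) sequentially"
      using L by (auto simp: order_tendsto_iff)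
    then obtain i where "(\<integral>\<^sup>+x. norm (s i x - f x) \<partial>lborel) < ennreal e"
      by (auto simp: eventually_sequentially)
    then show "\<exists>g\<in>borel_measurable borel. L1_shift_continuous g \<and>
           (\<integral>\<^sup>+x. ennreal (cmod (f x - g x)) \<partial>lborel) < ennreal e"
      using lim by (intro bexI[of _ "s i"]) (auto simp: norm_minus_commute)
  qed measurable
qed

section \<open>Square-integrable functions, Cauchy-Schwarz and continuity of translations in
  L^2\<close>

definition sq_int :: "(real \<Rightarrow> complex) \<Rightarrow> bool" where
  "sq_int f \<longleftrightarrow> f \<in> borel_measurable borel \<and> integrable lborel (\<lambda>x. (cmod (f x))\<^sup>2)"

lemma sq_int_measurable [measurable_dest]: "sq_int f \<Longrightarrow> f \<in> borel_measurable borel"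
  by (simp add: sq_int_def)

lemma sq_int_nn_integral:
  assumes "sq_int f"
  shows "(\<integral>\<^sup>+x. ennreal ((cmod (f x))\<^sup>2) \<partial>lborel) = ennreal (LINT x|lborel. (cmod (f x))\<^sup>2)"
  using assms by (intro nn_integral_eq_integral) (auto simp: sq_int_def)

lemma sq_intI:
  assumes "f \<in> borel_measurable borel" "(\<integral>\<^sup>+x. ennreal ((cmod (f x))\<^sup>2) \<partial>lborel) < \<infinity>"
  shows "sq_int f"
  using assms unfolding sq_int_def by (auto intro!: integrableI_bounded)

lemma sq_int_finite:
  assumes "sq_int f"
  shows "(\<integral>\<^sup>+x. ennreal ((cmod (f x))\<^sup>2) \<partial>lborel) < \<infinity>"
  unfolding sq_int_nn_integral[OF assms] by simp

lemma sq_int_shift: "sq_int f \<Longrightarrow> sq_int (\<lambda>x. f (x + c))"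
  using nn_integral_lborel_shift[of "\<lambda>x. ennreal ((cmod (f x))\<^sup>2)" c] sq_int_finite[of f]
  by (intro sq_intI) (auto simp: sq_int_def)

lemma borel_measurable_cnj [measurable]: "cnj \<in> borel_measurable borel"
  by (intro borel_measurable_continuous_onI continuous_intros)

lemma sq_int_cnj: "sq_int f \<Longrightarrow> sq_int (\<lambda>x. cnj (f x))"
  unfolding sq_int_def by auto

lemma sq_int_mult_bounded:
  assumes "sq_int f" and [measurable]: "g \<in> borel_measurable borel" and b: "\<And>x. cmod (g x) \<le> B"
  shows "sq_int (\<lambda>x. f x * g x)"
proof -
  have [measurable]: "f \<in> borel_measurable borel" using assms(1) by measurable
  have "integrable lborel (\<lambda>x. B\<^sup>2 * (cmod (f x))\<^sup>2)" using assms by (simp add: sq_int_def)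
  then have "integrable lborel (\<lambda>x. (cmod (f x * g x))\<^sup>2)"
  proof (rule Bochner_Integration.integrable_bound)
    show "AE x in lborel. norm ((cmod (f x * g x))\<^sup>2) \<le> norm (B\<^sup>2 * (cmod (f x))\<^sup>2)"
    proof (intro AE_I2)
      fix x
      have "(cmod (g x))\<^sup>2 * (cmod (f x))\<^sup>2 \<le> B\<^sup>2 * (cmod (f x))\<^sup>2"
        using b by (intro mult_right_mono power_mono) auto
      then show "norm ((cmod (f x * g x))\<^sup>2) \<le> norm (B\<^sup>2 * (cmod (f x))\<^sup>2)"
        by (simp add: norm_mult power_mult_distrib mult.commute)
    qed
  qed measurable
  then show ?thesis by (simp add: sq_int_def)
qed

lemma sq_int_scale: "sq_int f \<Longrightarrow> sq_int (\<lambda>x. c * f x)"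
  by (auto simp: sq_int_def norm_mult power_mult_distrib)

lemma sq_int_integrable_mult:
  assumes "sq_int f" "sq_int g"
  shows "integrable lborel (\<lambda>x. f x * g x)"
proof -
  have [measurable]: "f \<in> borel_measurable borel" "g \<in> borel_measurable borel" using assms by measurable
  have "integrable lborel (\<lambda>x. (cmod (f x))\<^sup>2 + (cmod (g x))\<^sup>2)" using assms by (auto simp: sq_int_def)
  then show ?thesis
  proof (rule Bochner_Integration.integrable_bound)
    show "AE x in lborel. norm (f x * g x) \<le> norm ((cmod (f x))\<^sup>2 + (cmod (g x))\<^sup>2)"
    proof (intro AE_I2)
      fix x
      have "2 * (cmod (f x) * cmod (g x)) \<le> (cmod (f x))\<^sup>2 + (cmod (g x))\<^sup>2"
        using sum_squares_bound[of "cmod (f x)" "cmod (g x)"] by simp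
      moreover have "cmod (f x) * cmod (g x) \<ge> 0" by simp
      ultimately have "cmod (f x) * cmod (g x) \<le> (cmod (f x))\<^sup>2 + (cmod (g x))\<^sup>2" by linarith
      then show "norm (f x * g x) \<le> norm ((cmod (f x))\<^sup>2 + (cmod (g x))\<^sup>2)" by (simp add: norm_mult)
    qed
  qed measurable
qed

lemma nn_Cauchy_Schwarz:
  assumes [measurable]: "f \<in> borel_measurable M" "g \<in> borel_measurable M"
  shows "(\<integral>\<^sup>+x. ennreal (norm (f x :: complex) * norm (g x :: complex)) \<partial>M)\<^sup>2
    \<le> (\<integral>\<^sup>+x. ennreal ((norm (f x))\<^sup>2) \<partial>M) * (\<integral>\<^sup>+x. ennreal ((norm (g x))\<^sup>2) \<partial>M)"
  using Cauchy_Schwarz_nn_integral[of "\<lambda>x. ennreal (norm (f x))" M "\<lambda>x. ennreal (norm (g x))"]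
  by (simp add: ennreal_mult ennreal_power)

lemma Cauchy_Schwarz_integral:
  assumes [measurable]: "f \<in> borel_measurable M" "g \<in> borel_measurable M"
  shows "ennreal ((cmod (LINT x|M. f x * g x))\<^sup>2)
    \<le> (\<integral>\<^sup>+x. ennreal ((cmod (f x))\<^sup>2) \<partial>M) * (\<integral>\<^sup>+x. ennreal ((cmod (g x))\<^sup>2) \<partial>M)"
proof -
  have "ennreal (cmod (LINT x|M. f x * g x)) \<le> (\<integral>\<^sup>+x. ennreal (norm (f x) * norm (g x)) \<partial>M)"
  proof (cases "integrable M (\<lambda>x. f x * g x)")
    case True then show ?thesis using integral_norm_bound_ennreal[OF True] by (simp add: norm_mult)
  \<comment> \<open>A non-integrable product has Bochner integral 0, so the bound is
    trivial.\<close>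
  qed (simp add: not_integrable_integral_eq)
  then have "(ennreal (cmod (LINT x|M. f x * g x)))\<^sup>2 \<le> (\<integral>\<^sup>+x. ennreal (norm (f x) * norm (g x)) \<partial>M)\<^sup>2"
    by (intro power_mono) auto
  also note nn_Cauchy_Schwarz[OF assms]
  finally show ?thesis by (simp add: ennreal_power)
qed

lemma Fubini_swap:
  fixes f :: "'a \<Rightarrow> 'b \<Rightarrow> complex"
  assumes "sigma_finite_measure M1" "sigma_finite_measure M2"
    and m[measurable]: "case_prod f \<in> borel_measurable (M1 \<Otimes>\<^sub>M M2)"
    and fin: "(\<integral>\<^sup>+x. \<integral>\<^sup>+y. ennreal (cmod (f x y)) \<partial>M2 \<partial>M1) < \<infinity>"
  shows "(LINT x|M1. LINT y|M2. f x y) = (LINT y|M2. LINT x|M1. f x y)"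
proof -
  interpret A: sigma_finite_measure M1 by fact
  interpret B: sigma_finite_measure M2 by fact
  interpret pair_sigma_finite M1 M2 ..
  have "integrable (M1 \<Otimes>\<^sub>M M2) (case_prod f)"
  proof (rule integrableI_bounded[OF m])
    have "(\<integral>\<^sup>+x. ennreal (norm (case_prod f x)) \<partial>(M1 \<Otimes>\<^sub>M M2)) = (\<integral>\<^sup>+x. \<integral>\<^sup>+y. ennreal (cmod (f x y)) \<partial>M2 \<partial>M1)"
      by (subst B.nn_integral_fst[symmetric]) auto
    then show "(\<integral>\<^sup>+x. ennreal (norm (case_prod f x)) \<partial>(M1 \<Otimes>\<^sub>M M2)) < \<infinity>" using fin by simp
  qed
  from Fubini_integral[OF this] show ?thesis by simp
qed

text \<open>Truncation at height K splits F into a part small in L^2 and a bounded part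
  \<open>G K\<close>. For the bounded part the squared increment is at most a constant times the
  increment, so L^1 continuity applies. The tolerances e/9 and e/(18 (K + 1)) absorb the weights 3,
  3 and 6 (K + 1).\<close>

lemma L2_shift_continuous:
  assumes F: "sq_int F" "integrable lborel F" and r: "r \<longlonglongrightarrow> 0"
  shows "(\<lambda>n. \<integral>\<^sup>+x. ennreal ((cmod (F (x + r n) - F x))\<^sup>2) \<partial>lborel) \<longlonglongrightarrow> 0"
proof (rule tendsto_0_ennrealI)
  fix e :: real assume e: "e > 0"
  have [measurable]: "F \<in> borel_measurable borel" using F by measurable
  define G where "G = (\<lambda>K::nat. \<lambda>x. if cmod (F x) \<le> K then F x else 0)"
  have [measurable]: "G K \<in> borel_measurable borel" for K unfolding G_def by measurable
  have "(\<lambda>K. \<integral>\<^sup>+x. ennreal ((cmod (F x - G K x))\<^sup>2) \<partial>lborel) \<longlonglongrightarrow> (\<integral>\<^sup>+x. 0 \<partial>(lborel :: real measure))"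
  proof (rule nn_integral_dominated_convergence[of _ _ _ "\<lambda>x. ennreal ((cmod (F x))\<^sup>2)"])
    show "AE x in lborel. (\<lambda>K. ennreal ((cmod (F x - G K x))\<^sup>2)) \<longlonglongrightarrow> 0"
    proof (intro AE_I2 tendsto_eventually)
      fix x
      obtain N where "cmod (F x) \<le> real N" using real_arch_simple by blast
      then show "\<forall>\<^sub>F K in sequentially. ennreal ((cmod (F x - G K x))\<^sup>2) = 0"
        unfolding eventually_sequentially by (intro exI[of _ N]) (auto simp: G_def)
    qed
  qed (use sq_int_finite[OF F(1)] in \<open>auto simp: G_def\<close>)
  then have "(\<lambda>K. \<integral>\<^sup>+x. ennreal ((cmod (F x - G K x))\<^sup>2) \<partial>lborel) \<longlonglongrightarrow> 0" by simp
  then have "eventually (\<lambda>K. (\<integral>\<^sup>+x. ennreal ((cmod (F x - G K x))\<^sup>2) \<partial>lborel) < ennreal (e/9)) sequentially"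
    using e by (auto simp: order_tendsto_iff)
  then obtain K where K: "(\<integral>\<^sup>+x. ennreal ((cmod (F x - G K x))\<^sup>2) \<partial>lborel) < ennreal (e/9)"
    by (auto simp: eventually_sequentially)
  have "integrable lborel (G K)"
    by (rule Bochner_Integration.integrable_bound[OF F(2)]) (auto simp: G_def)
  then have "(\<lambda>n. \<integral>\<^sup>+x. ennreal (cmod (G K (x + r n) - G K x)) \<partial>lborel) \<longlonglongrightarrow> 0"
    using integrable_L1_shift_continuous r by (auto simp: L1_shift_continuous_def)
  moreover have "0 < ennreal (e / (18 * (real K + 1)))" using e by simp
  ultimately have "eventually (\<lambda>n. (\<integral>\<^sup>+x. ennreal (cmod (G K (x + r n) - G K x)) \<partial>lborel) < ennreal (e / (18 * (real K + 1)))) sequentially"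
    unfolding order_tendsto_iff by blast
  then show "\<forall>\<^sub>F n in sequentially. (\<integral>\<^sup>+x. ennreal ((cmod (F (x + r n) - F x))\<^sup>2) \<partial>lborel) < ennreal e"
  proof eventually_elim
    case (elim n)
    have "(\<integral>\<^sup>+x. ennreal ((cmod (F (x + r n) - F x))\<^sup>2) \<partial>lborel)
      \<le> (\<integral>\<^sup>+x. ennreal 3 * ennreal ((cmod (F (x + r n) - G K (x + r n)))\<^sup>2) + ennreal 3 * ennreal ((cmod (F x - G K x))\<^sup>2)
           + ennreal (6 * (real K + 1)) * ennreal (cmod (G K (x + r n) - G K x)) \<partial>lborel)"
    proof (intro nn_integral_mono)
      fix x
      let ?a = "cmod (F (x + r n) - G K (x + r n))" and ?b = "cmod (F x - G K x)" and ?c = "cmod (G K (x + r n) - G K x)"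
      have "cmod (F (x + r n) - F x) \<le> ?a + ?b + ?c"
        using norm_triangle_ineq[of "F (x + r n) - G K (x + r n)" "G K (x + r n) - G K x"]
          norm_triangle_ineq[of "F (x + r n) - G K (x + r n) + (G K (x + r n) - G K x)" "G K x - F x"]
          norm_minus_commute[of "F x" "G K x"]
        by (simp add: algebra_simps)
      then have "(cmod (F (x + r n) - F x))\<^sup>2 \<le> (?a + ?b + ?c)\<^sup>2" by (intro power_mono) auto
      also have "\<dots> \<le> 3 * ?a\<^sup>2 + 3 * ?b\<^sup>2 + 3 * ?c\<^sup>2"
        using sum_squares_bound[of ?a ?b] sum_squares_bound[of ?a ?c] sum_squares_bound[of ?b ?c]
        by (simp add: power2_eq_square algebra_simps)
      also have "?c\<^sup>2 \<le> (2 * (real K + 1)) * ?c"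
      proof -
        have "cmod (G K y) \<le> K" for y by (simp add: G_def)
        from this[of x] this[of "x + r n"] have "?c \<le> 2 * (real K + 1)"
          using norm_triangle_ineq4[of "G K (x + r n)" "G K x"] by (smt (verit))
        then show ?thesis by (simp add: power2_eq_square mult_right_mono)
      qed
      finally have "(cmod (F (x + r n) - F x))\<^sup>2 \<le> 3 * ?a\<^sup>2 + 3 * ?b\<^sup>2 + 6 * (real K + 1) * ?c" by (simp add: algebra_simps)
      then have "ennreal ((cmod (F (x + r n) - F x))\<^sup>2) \<le> ennreal (3 * ?a\<^sup>2 + 3 * ?b\<^sup>2 + 6 * (real K + 1) * ?c)"
        by (rule ennreal_leI)
      also have "\<dots> = ennreal 3 * ennreal (?a\<^sup>2) + ennreal 3 * ennreal (?b\<^sup>2) + ennreal (6 * (real K + 1)) * ennreal ?c"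
        by (simp only: ennreal_plus ennreal_mult mult_nonneg_nonneg zero_le_power2 norm_ge_zero of_nat_0_le_iff
              add_nonneg_nonneg zero_le_numeral zero_le_one)
      finally show "ennreal ((cmod (F (x + r n) - F x))\<^sup>2) \<le> \<dots>" .
    qed
    also have "\<dots> = ennreal 3 * (\<integral>\<^sup>+x. ennreal ((cmod (F x - G K x))\<^sup>2) \<partial>lborel)
        + ennreal 3 * (\<integral>\<^sup>+x. ennreal ((cmod (F x - G K x))\<^sup>2) \<partial>lborel)
        + ennreal (6 * (real K + 1)) * (\<integral>\<^sup>+x. ennreal (cmod (G K (x + r n) - G K x)) \<partial>lborel)"
      using nn_integral_lborel_shift[of "\<lambda>x. ennreal ((cmod (F x - G K x))\<^sup>2)" "r n"]
      by (simp add: nn_integral_add nn_integral_cmult)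
    also have "\<dots> < ennreal 3 * ennreal (e/9) + ennreal 3 * ennreal (e/9) + ennreal (6 * (real K + 1)) * ennreal (e / (18 * (real K + 1)))"
      using K elim by (intro add_strict_mono ennreal_mult_strict_left_mono) (auto simp del: ennreal_plus simp add: add_nonneg_pos)
    also have "\<dots> = ennreal (3 * (e/9) + 3 * (e/9) + 6 * (real K + 1) * (e / (18 * (real K + 1))))"
      using e by (simp only: ennreal_plus ennreal_mult mult_nonneg_nonneg divide_nonneg_nonneg less_imp_le of_nat_0_le_iff
              add_nonneg_nonneg zero_le_numeral zero_le_one)
    also have "3 * (e/9) + 3 * (e/9) + 6 * (real K + 1) * (e / (18 * (real K + 1))) = e"
      by (simp add: field_simps)
    finally show ?case .
  qed
qed

text \<open>Cauchy-Schwarz bounds the change of the autocorrelation by the norm of F times the L^2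
  distance between F and its translate.\<close>

lemma autocorrelation_tendsto:
  assumes F: "sq_int F" "integrable lborel F" and r: "r \<longlonglongrightarrow> 0"
  shows "(\<lambda>n. LINT t|lborel. F (t + r n) * cnj (F t)) \<longlonglongrightarrow> (LINT t|lborel. F t * cnj (F t))"
proof -
  have [measurable]: "F \<in> borel_measurable borel" using F by measurable
  let ?R = "\<lambda>r. LINT t|lborel. F (t + r) * cnj (F t)"
  define B where "B = (\<integral>\<^sup>+x. ennreal ((cmod (F x))\<^sup>2) \<partial>lborel)"
  have B: "B < \<infinity>" unfolding B_def by (rule sq_int_finite) fact
  have "(\<lambda>n. ennreal ((cmod (?R (r n) - ?R 0))\<^sup>2)) \<longlonglongrightarrow> 0"
  proof (rule tendsto_sandwich[OF _ _ tendsto_const])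
    show "(\<lambda>n. B * (\<integral>\<^sup>+x. ennreal ((cmod (F (x + r n) - F x))\<^sup>2) \<partial>lborel)) \<longlonglongrightarrow> 0"
      using ennreal_tendsto_cmult[OF _ L2_shift_continuous[OF F r], of B] B by simp
    show "\<forall>\<^sub>F n in sequentially. ennreal ((cmod (?R (r n) - ?R 0))\<^sup>2) \<le> B * (\<integral>\<^sup>+x. ennreal ((cmod (F (x + r n) - F x))\<^sup>2) \<partial>lborel)"
    proof (intro always_eventually allI)
      fix n
      have "?R (r n) - ?R 0 = (LINT t|lborel. F (t + r n) * cnj (F t) - F (t + 0) * cnj (F t))"
        by (intro Bochner_Integration.integral_diff[symmetric]
              sq_int_integrable_mult[OF sq_int_shift[OF F(1)] sq_int_cnj[OF F(1)]])
      also have "\<dots> = (LINT t|lborel. cnj (F t) * (F (t + r n) - F t))"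
        by (simp add: algebra_simps)
      finally have "?R (r n) - ?R 0 = (LINT t|lborel. cnj (F t) * (F (t + r n) - F t))" .
      then show "ennreal ((cmod (?R (r n) - ?R 0))\<^sup>2) \<le> B * (\<integral>\<^sup>+x. ennreal ((cmod (F (x + r n) - F x))\<^sup>2) \<partial>lborel)"
        using Cauchy_Schwarz_integral[of "\<lambda>t. cnj (F t)" lborel "\<lambda>t. F (t + r n) - F t"]
        by (simp add: B_def)
    qed
  qed auto
  then have "(\<lambda>n. (cmod (?R (r n) - ?R 0))\<^sup>2) \<longlonglongrightarrow> 0"
    by (simp add: tendsto_ennreal_iff flip: ennreal_0)
  then have "(\<lambda>n. sqrt ((cmod (?R (r n) - ?R 0))\<^sup>2)) \<longlonglongrightarrow> sqrt 0" by (rule tendsto_real_sqrt)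
  then show ?thesis by (simp add: tendsto_norm_zero_iff LIM_zero_iff)
qed

section \<open>The Fourier transform on the intersection of L^1 and L^2\<close>

definition fourier :: "(real \<Rightarrow> complex) \<Rightarrow> real \<Rightarrow> complex" where
  "fourier F \<xi> = (LINT s|lborel. F s * cis (- 2 * pi * \<xi> * s))"

lemma borel_measurable_cis [measurable]: "cis \<in> borel_measurable borel"
  by (intro borel_measurable_continuous_onI continuous_intros)

lemma fourier_measurable [measurable]:
  assumes [measurable]: "F \<in> borel_measurable borel"
  shows "fourier F \<in> borel_measurable borel"
  unfolding fourier_def[abs_def] by measurable

lemma integral_std_normal_cis:
  "(LINT \<eta>|std_normal_distribution. cis (t * \<eta>)) = complex_of_real (exp (- t\<^sup>2 / 2))"
  using fun_cong[OF char_std_normal_distribution, of t] by (simp add: char_def cis_conv_exp mult.commute)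

lemma std_normal_sigma_finite: "sigma_finite_measure std_normal_distribution"
  using prob_space_normal_density[of 1 0] by (simp add: prob_space_imp_sigma_finite)

lemma nn_integral_std_normal_const: "(\<integral>\<^sup>+x. c \<partial>std_normal_distribution) = c"
proof -
  interpret prob_space std_normal_distribution using prob_space_normal_density[of 1 0] by simp
  show ?thesis using emeasure_space_1 by simp
qed

lemma ennreal_mult_mult: "0 \<le> a \<Longrightarrow> 0 \<le> b \<Longrightarrow> ennreal a * (ennreal b * ennreal x) = ennreal (a * (b * x))"
  by (simp add: ennreal_mult')

lemma complex_Re_of_real_mult: "Re (complex_of_real a * z) = a * Re z"
  by simp

text \<open>
  Parseval with a Gaussian weight: the Gaussian makes the double integral absolutely convergent, and its
  Fourier transform turns the right-hand side into a Gaussian average of the autocorrelation of \<open>F\<close>.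
\<close>

lemma gaussian_regularised_energy:
  assumes F: "sq_int F" "integrable lborel F" and c: "c > 0"
  shows "(LINT \<eta>|std_normal_distribution. fourier F (c * \<eta> / (2 * pi)) * cnj (fourier F (c * \<eta> / (2 * pi))))
     = complex_of_real (sqrt (2 * pi) / c) * (LINT u|std_normal_distribution. LINT t|lborel. F (t + u / c) * cnj (F t))"
proof -
  let ?N = "std_normal_distribution"
  interpret N: prob_space ?N using prob_space_normal_density[of 1 0] by simp
  have [measurable]: "F \<in> borel_measurable borel" using F by measurable
  define L where "L = (\<integral>\<^sup>+s. ennreal (cmod (F s)) \<partial>lborel)"
  have L: "L < \<infinity>" using F(2) unfolding L_def by (simp add: integrable_iff_bounded)
  have "(LINT \<eta>|?N. fourier F (c * \<eta> / (2 * pi)) * cnj (fourier F (c * \<eta> / (2 * pi))))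
    = (LINT \<eta>|?N. LINT t|lborel. LINT s|lborel. F s * cnj (F t) * cis (- c * (s - t) * \<eta>))"
  proof (intro Bochner_Integration.integral_cong refl)
    fix \<eta>
    have "cnj (LINT s|lborel. F s * cis (- (c * \<eta> * s))) = (LINT t|lborel. cnj (F t) * cis (c * \<eta> * t))"
      by (subst Bochner_Integration.integral_cnj[symmetric]) (simp add: cis_cnj)
    then have "fourier F (c * \<eta> / (2 * pi)) * cnj (fourier F (c * \<eta> / (2 * pi)))
      = (LINT s|lborel. F s * cis (- c * \<eta> * s)) * (LINT t|lborel. cnj (F t) * cis (c * \<eta> * t))"
      by (simp add: fourier_def)
    also have "\<dots> = (LINT t|lborel. LINT s|lborel. (F s * cis (- c * \<eta> * s)) * (cnj (F t) * cis (c * \<eta> * t)))"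
      by (simp only: integral_mult_left_zero integral_mult_right_zero)
    also have "\<dots> = (LINT t|lborel. LINT s|lborel. F s * cnj (F t) * cis (- c * (s - t) * \<eta>))"
    proof (intro Bochner_Integration.integral_cong refl)
      fix t s
      have "cis (- c * \<eta> * s) * cis (c * \<eta> * t) = cis (- c * (s - t) * \<eta>)"
        by (simp add: cis_mult algebra_simps)
      then show "F s * cis (- c * \<eta> * s) * (cnj (F t) * cis (c * \<eta> * t)) = F s * cnj (F t) * cis (- c * (s - t) * \<eta>)"
        by (metis (no_types, opaque_lifting) mult.assoc mult.left_commute)
    qed
    finally show "fourier F (c * \<eta> / (2 * pi)) * cnj (fourier F (c * \<eta> / (2 * pi))) = \<dots>" .
  qed
  \<comment> \<open>The Gaussian variable is moved innermost, past t and then past s. Both exchanges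
    rest on F being absolutely integrable and on the weight having total mass 1.\<close>
  also have "\<dots> = (LINT t|lborel. LINT \<eta>|?N. LINT s|lborel. F s * cnj (F t) * cis (- c * (s - t) * \<eta>))"
  proof (rule Fubini_swap[OF std_normal_sigma_finite sigma_finite_lborel])
    have "(\<integral>\<^sup>+\<eta>. \<integral>\<^sup>+t. ennreal (cmod (LINT s|lborel. F s * cnj (F t) * cis (- c * (s - t) * \<eta>))) \<partial>lborel \<partial>?N)
      \<le> (\<integral>\<^sup>+\<eta>. \<integral>\<^sup>+t. L * ennreal (cmod (F t)) \<partial>lborel \<partial>?N)"
    proof (intro nn_integral_mono)
      fix \<eta> t
      have "integrable lborel (\<lambda>s. F s * cnj (F t) * cis (- c * (s - t) * \<eta>))"
        by (rule Bochner_Integration.integrable_bound[of _ "\<lambda>s. F s * cnj (F t)"])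
           (use F in \<open>auto simp: norm_mult\<close>)
      from integral_norm_bound_ennreal[OF this]
      show "ennreal (cmod (LINT s|lborel. F s * cnj (F t) * cis (- c * (s - t) * \<eta>))) \<le> L * ennreal (cmod (F t))"
        by (simp add: norm_mult ennreal_mult nn_integral_multc L_def)
    qed
    also have "\<dots> = L * L" unfolding nn_integral_std_normal_const
      by (simp add: nn_integral_cmult L_def)
    also have "\<dots> < \<infinity>" using L by (simp add: ennreal_mult_less_top)
    finally show "(\<integral>\<^sup>+\<eta>. \<integral>\<^sup>+t. ennreal (cmod (LINT s|lborel. F s * cnj (F t) * cis (- c * (s - t) * \<eta>))) \<partial>lborel \<partial>?N) < \<infinity>" .
  qed measurable
  also have "\<dots> = (LINT t|lborel. LINT s|lborel. LINT \<eta>|?N. F s * cnj (F t) * cis (- c * (s - t) * \<eta>))"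
  proof (rule Bochner_Integration.integral_cong[OF refl], rule Fubini_swap[OF std_normal_sigma_finite sigma_finite_lborel])
    fix t
    have "(\<integral>\<^sup>+\<eta>. \<integral>\<^sup>+s. ennreal (cmod (F s * cnj (F t) * cis (- c * (s - t) * \<eta>))) \<partial>lborel \<partial>?N) = L * ennreal (cmod (F t))"
      by (simp add: norm_mult ennreal_mult nn_integral_multc N.emeasure_space_1[simplified] flip: L_def)
    then show "(\<integral>\<^sup>+\<eta>. \<integral>\<^sup>+s. ennreal (cmod (F s * cnj (F t) * cis (- c * (s - t) * \<eta>))) \<partial>lborel \<partial>?N) < \<infinity>"
      using L by (simp add: ennreal_mult_less_top)
  qed measurable
  also have "\<dots> = (LINT t|lborel. LINT s|lborel. F s * cnj (F t) * exp (- (c * (s - t))\<^sup>2 / 2))"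
  proof (intro Bochner_Integration.integral_cong refl)
    fix t s
    have "(LINT \<eta>|?N. F s * cnj (F t) * cis (- c * (s - t) * \<eta>)) = F s * cnj (F t) * (LINT \<eta>|?N. cis (- c * (s - t) * \<eta>))"
      by (rule integral_mult_right_zero)
    also have "\<dots> = F s * cnj (F t) * exp (- (- c * (s - t))\<^sup>2 / 2)"
      unfolding integral_std_normal_cis ..
    also have "(- c * (s - t))\<^sup>2 = (c * (s - t))\<^sup>2" by (simp only: mult_minus_left power2_minus)
    finally show "(LINT \<eta>|?N. F s * cnj (F t) * cis (- c * (s - t) * \<eta>)) = F s * cnj (F t) * exp (- (c * (s - t))\<^sup>2 / 2)" .
  qed
  \<comment> \<open>Substitution s = t + u / c, which makes the Gaussian independent of t.\<close>
  also have "\<dots> = (LINT t|lborel. (1 / c) *\<^sub>R (LINT u|lborel. F (t + u / c) * cnj (F t) * exp (- u\<^sup>2 / 2)))"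
  proof (intro Bochner_Integration.integral_cong refl)
    fix t
    show "(LINT s|lborel. F s * cnj (F t) * exp (- (c * (s - t))\<^sup>2 / 2))
       = (1 / c) *\<^sub>R (LINT u|lborel. F (t + u / c) * cnj (F t) * exp (- u\<^sup>2 / 2))"
      using lborel_integral_real_affine[of "1 / c" "\<lambda>s. F s * cnj (F t) * exp (- (c * (s - t))\<^sup>2 / 2)" t] c
      by simp
  qed
  also have "\<dots> = (1 / c) *\<^sub>R (LINT t|lborel. LINT u|lborel. F (t + u / c) * cnj (F t) * exp (- u\<^sup>2 / 2))"
    by (rule integral_scaleR_right)
  also have "(LINT t|lborel. LINT u|lborel. F (t + u / c) * cnj (F t) * exp (- u\<^sup>2 / 2))
    = (LINT u|lborel. LINT t|lborel. F (t + u / c) * cnj (F t) * exp (- u\<^sup>2 / 2))"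
  proof (rule Fubini_swap[OF sigma_finite_lborel sigma_finite_lborel, symmetric])
    define B where "B = (\<integral>\<^sup>+x. ennreal ((cmod (F x))\<^sup>2) \<partial>lborel)"
    have B: "B < \<infinity>" unfolding B_def by (rule sq_int_finite) fact
    have "(\<integral>\<^sup>+u. \<integral>\<^sup>+t. ennreal (cmod (F (t + u / c) * cnj (F t) * exp (- u\<^sup>2 / 2))) \<partial>lborel \<partial>lborel)
      \<le> (\<integral>\<^sup>+u. (2 * B) * ennreal (sqrt (2 * pi) * std_normal_density u) \<partial>lborel)"
    proof (intro nn_integral_mono)
      fix u :: real
      have "(\<integral>\<^sup>+t. ennreal (cmod (F (t + u / c) * cnj (F t) * exp (- u\<^sup>2 / 2))) \<partial>lborel)
        \<le> (\<integral>\<^sup>+t. (ennreal ((cmod (F (t + u/c)))\<^sup>2) + ennreal ((cmod (F t))\<^sup>2)) * ennreal (exp (- u\<^sup>2 / 2)) \<partial>lborel)"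
      proof (intro nn_integral_mono)
        fix t
        have "2 * (cmod (F (t + u/c)) * cmod (F t)) \<le> (cmod (F (t + u/c)))\<^sup>2 + (cmod (F t))\<^sup>2"
          using sum_squares_bound[of "cmod (F (t + u/c))" "cmod (F t)"] by simp
        moreover have "cmod (F (t + u/c)) * cmod (F t) \<ge> 0" by simp
        ultimately have "cmod (F (t + u/c)) * cmod (F t) \<le> (cmod (F (t + u/c)))\<^sup>2 + (cmod (F t))\<^sup>2" by linarith
        then have "cmod (F (t + u / c) * cnj (F t) * exp (- u\<^sup>2 / 2)) \<le> ((cmod (F (t + u/c)))\<^sup>2 + (cmod (F t))\<^sup>2) * exp (- u\<^sup>2 / 2)"
          by (simp add: norm_mult mult_right_mono)
        then have "ennreal (cmod (F (t + u / c) * cnj (F t) * exp (- u\<^sup>2 / 2))) \<le> ennreal (((cmod (F (t + u/c)))\<^sup>2 + (cmod (F t))\<^sup>2) * exp (- u\<^sup>2 / 2))"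
          by (rule ennreal_leI)
        also have "\<dots> = (ennreal ((cmod (F (t + u/c)))\<^sup>2) + ennreal ((cmod (F t))\<^sup>2)) * ennreal (exp (- u\<^sup>2 / 2))"
          by (simp only: ennreal_mult ennreal_plus zero_le_power2 add_nonneg_nonneg exp_ge_zero)
        finally show "ennreal (cmod (F (t + u / c) * cnj (F t) * exp (- u\<^sup>2 / 2)))
          \<le> (ennreal ((cmod (F (t + u/c)))\<^sup>2) + ennreal ((cmod (F t))\<^sup>2)) * ennreal (exp (- u\<^sup>2 / 2))" .
      qed
      also have "\<dots> = (B + B) * ennreal (exp (- u\<^sup>2 / 2))"
        using nn_integral_lborel_shift[of "\<lambda>t. ennreal ((cmod (F t))\<^sup>2)" "u / c"]
        by (simp add: nn_integral_multc nn_integral_add B_def)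
      also have G: "exp (- u\<^sup>2 / 2) = sqrt (2 * pi) * std_normal_density u"
        by (simp add: std_normal_density_def)
      finally show "(\<integral>\<^sup>+t. ennreal (cmod (F (t + u / c) * cnj (F t) * exp (- u\<^sup>2 / 2))) \<partial>lborel)
        \<le> (2 * B) * ennreal (sqrt (2 * pi) * std_normal_density u)"
        unfolding G mult_2 .
    qed
    also have "\<dots> = 2 * B * ennreal (sqrt (2 * pi))"
      using N.emeasure_space_1
      by (simp add: nn_integral_cmult ennreal_mult emeasure_density)
    also have "\<dots> < \<infinity>" using B by (simp add: ennreal_mult_less_top)
    finally show "(\<integral>\<^sup>+u. \<integral>\<^sup>+t. ennreal (cmod (F (t + u / c) * cnj (F t) * exp (- u\<^sup>2 / 2))) \<partial>lborel \<partial>lborel) < \<infinity>" .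
  qed measurable
  also have "\<dots> = (LINT u|lborel. std_normal_density u *\<^sub>R (sqrt (2 * pi) * (LINT t|lborel. F (t + u / c) * cnj (F t))))"
    by (simp add: std_normal_density_def scaleR_conv_of_real mult.commute)
  also have "\<dots> = (LINT u|?N. sqrt (2 * pi) * (LINT t|lborel. F (t + u / c) * cnj (F t)))"
    by (subst integral_density) (auto simp: normal_density_nonneg)
  also have "\<dots> = sqrt (2 * pi) * (LINT u|?N. LINT t|lborel. F (t + u / c) * cnj (F t))"
    by (rule integral_mult_right_zero)
  finally show ?thesis using c by (simp add: scaleR_conv_of_real)
qed

text \<open>As the regularising Gaussian widens, the left side of
  \<open>gaussian_regularised_energy\<close>, suitably rescaled, increases to the energy of the
  transform, whether or not that is known to be finite. Meanwhile the averaged autocorrelation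
  concentrates at 0 and tends to R 0, the energy of F.\<close>

theorem plancherel:
  assumes F: "sq_int F" "integrable lborel F"
  shows "(\<integral>\<^sup>+\<xi>. ennreal ((cmod (fourier F \<xi>))\<^sup>2) \<partial>lborel) = (\<integral>\<^sup>+s. ennreal ((cmod (F s))\<^sup>2) \<partial>lborel)"
proof -
  let ?N = "std_normal_distribution"
  interpret N: prob_space ?N using prob_space_normal_density[of 1 0] by simp
  have [measurable]: "F \<in> borel_measurable borel" using F by measurable
  define R where "R = (\<lambda>r. LINT t|lborel. F (t + r) * cnj (F t))"
  have [measurable]: "R \<in> borel_measurable borel" unfolding R_def by measurable
  define B where "B = (LINT x|lborel. (cmod (F x))\<^sup>2)"
  have B0: "B \<ge> 0" unfolding B_def by simp
  have R0: "R 0 = complex_of_real B"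
    unfolding R_def B_def by (simp add: complex_norm_square[symmetric] flip: integral_complex_of_real)
  have Rb: "cmod (R r) \<le> B" for r
  proof -
    have "ennreal ((cmod (R r))\<^sup>2) \<le> (\<integral>\<^sup>+x. ennreal ((cmod (F (x + r)))\<^sup>2) \<partial>lborel) * (\<integral>\<^sup>+x. ennreal ((cmod (cnj (F x)))\<^sup>2) \<partial>lborel)"
      unfolding R_def by (rule Cauchy_Schwarz_integral) auto
    also have "\<dots> = ennreal (B\<^sup>2)"
      using nn_integral_lborel_shift[of "\<lambda>x. ennreal ((cmod (F x))\<^sup>2)" r] sq_int_nn_integral[OF F(1)] B0
      by (simp add: B_def power2_eq_square ennreal_mult)
    finally have "(cmod (R r))\<^sup>2 \<le> B\<^sup>2" using B0 by (simp add: ennreal_le_iff)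
    then show ?thesis using B0 by (rule power2_le_imp_le)
  qed
  define g where "g = (\<lambda>(k::nat) \<xi>. ennreal ((cmod (fourier F \<xi>))\<^sup>2 * exp (- (\<xi> / (real k + 1))\<^sup>2 / 2)))"
  have g: "(\<integral>\<^sup>+\<xi>. g k \<xi> \<partial>lborel) = ennreal (Re (LINT u|?N. R (u / (2 * pi * (real k + 1)))))" for k
  proof -
    \<comment> \<open>The shift by 1 keeps the width positive at k = 0. With c = 2 pi \<kappa> the
      transform in the regularised identity is evaluated at \<kappa> \<eta>.\<close>
    define \<kappa> where "\<kappa> = real k + 1"
    have k: "\<kappa> > 0" by (simp add: \<kappa>_def)
    have "fourier F \<xi> * cnj (fourier F \<xi>) = complex_of_real ((cmod (fourier F \<xi>))\<^sup>2)" for \<xi>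
      by (simp only: complex_norm_square)
    then have "complex_of_real (LINT \<eta>|?N. (cmod (fourier F (\<kappa> * \<eta>)))\<^sup>2) = complex_of_real (sqrt (2 * pi) / (2 * pi * \<kappa>)) * (LINT u|?N. R (u / (2 * pi * \<kappa>)))"
      using gaussian_regularised_energy[OF F, of "2 * pi * \<kappa>"] k by (simp add: R_def del: of_real_power)
    then have E: "(LINT \<eta>|?N. (cmod (fourier F (\<kappa> * \<eta>)))\<^sup>2) = sqrt (2 * pi) / (2 * pi * \<kappa>) * Re (LINT u|?N. R (u / (2 * pi * \<kappa>)))"
      using arg_cong[of _ _ Re] by (metis Re_complex_of_real complex_Re_of_real_mult)
    have "integrable ?N (\<lambda>\<eta>. (cmod (fourier F (\<kappa> * \<eta>)))\<^sup>2)"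
    proof (rule N.integrable_const_bound[of _ "(LINT s|lborel. cmod (F s))\<^sup>2"])
      show "AE x in ?N. norm ((cmod (fourier F (\<kappa> * x)))\<^sup>2) \<le> (LINT s|lborel. cmod (F s))\<^sup>2"
      proof (intro AE_I2)
        fix x
        have "cmod (fourier F (\<kappa> * x)) \<le> (LINT s|lborel. cmod (F s * cis (- 2 * pi * (\<kappa> * x) * s)))"
          unfolding fourier_def by (rule integral_norm_bound)
        then show "norm ((cmod (fourier F (\<kappa> * x)))\<^sup>2) \<le> (LINT s|lborel. cmod (F s))\<^sup>2"
          by (simp add: norm_mult power_mono)
      qed
    qed measurable
    then have "(\<integral>\<^sup>+\<eta>. ennreal ((cmod (fourier F (\<kappa> * \<eta>)))\<^sup>2) \<partial>?N) = ennreal (sqrt (2 * pi) / (2 * pi * \<kappa>) * Re (LINT u|?N. R (u / (2 * pi * \<kappa>))))"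
      by (subst nn_integral_eq_integral) (auto simp: E)
    moreover have "(\<integral>\<^sup>+\<eta>. ennreal ((cmod (fourier F (\<kappa> * \<eta>)))\<^sup>2) \<partial>?N) = (\<integral>\<^sup>+\<eta>. ennreal (std_normal_density \<eta>) * ennreal ((cmod (fourier F (\<kappa> * \<eta>)))\<^sup>2) \<partial>lborel)"
      by (subst nn_integral_density) auto
    moreover have "(\<integral>\<^sup>+\<xi>. g k \<xi> \<partial>lborel) = ennreal \<kappa> * (\<integral>\<^sup>+\<eta>. g k (\<kappa> * \<eta>) \<partial>lborel)"
      using nn_integral_real_affine[of "g k" \<kappa> 0] k unfolding g_def by simp
    moreover have "g k (\<kappa> * \<eta>) = ennreal (sqrt (2 * pi)) * (ennreal (std_normal_density \<eta>) * ennreal ((cmod (fourier F (\<kappa> * \<eta>)))\<^sup>2))" for \<eta>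
    proof -
      have "(\<kappa> * \<eta> / (real k + 1)) = \<eta>" using k by (simp add: \<kappa>_def)
      then have "g k (\<kappa> * \<eta>) = ennreal ((cmod (fourier F (\<kappa> * \<eta>)))\<^sup>2 * exp (- \<eta>\<^sup>2 / 2))" by (simp add: g_def)
      also have "\<dots> = ennreal (sqrt (2 * pi) * (std_normal_density \<eta> * (cmod (fourier F (\<kappa> * \<eta>)))\<^sup>2))"
        by (simp add: std_normal_density_def)
      finally show ?thesis by (simp add: ennreal_mult)
    qed
    ultimately have "(\<integral>\<^sup>+\<xi>. g k \<xi> \<partial>lborel) = ennreal \<kappa> * (ennreal (sqrt (2 * pi)) * ennreal (sqrt (2 * pi) / (2 * pi * \<kappa>) * Re (LINT u|?N. R (u / (2 * pi * \<kappa>)))))"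
      by (simp add: nn_integral_cmult)
    also have "\<dots> = ennreal (\<kappa> * (sqrt (2 * pi) * (sqrt (2 * pi) / (2 * pi * \<kappa>) * Re (LINT u|?N. R (u / (2 * pi * \<kappa>))))))"
      using k by (intro ennreal_mult_mult) auto
    also have "\<kappa> * (sqrt (2 * pi) * (sqrt (2 * pi) / (2 * pi * \<kappa>) * Re (LINT u|?N. R (u / (2 * pi * \<kappa>))))) =
       Re (LINT u|?N. R (u / (2 * pi * \<kappa>)))"
    proof -
      have "\<kappa> * (sqrt (2 * pi) * (sqrt (2 * pi) / (2 * pi * \<kappa>) * x)) = x" for x
      proof -
        define q where "q = sqrt (2 * pi)"
        have "q * q = 2 * pi" by (simp add: q_def)
        then have "\<kappa> * (q * (q / (q * q * \<kappa>) * x)) = x" using k by (auto simp: field_simps)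
        then show ?thesis using \<open>q * q = 2 * pi\<close> by (simp only: q_def)
      qed
      then show ?thesis .
    qed
    finally show ?thesis by (simp add: \<kappa>_def)
  qed
  have lim1: "(\<lambda>k. \<integral>\<^sup>+\<xi>. g k \<xi> \<partial>lborel) \<longlonglongrightarrow> (\<integral>\<^sup>+\<xi>. ennreal ((cmod (fourier F \<xi>))\<^sup>2) \<partial>lborel)"
  proof (rule nn_integral_LIMSEQ)
    show "incseq g"
      unfolding incseq_def le_fun_def
    proof (intro allI impI)
      fix m n :: nat and \<xi> :: real assume "m \<le> n"
      then have "(real m + 1)\<^sup>2 \<le> (real n + 1)\<^sup>2" by (intro power_mono) auto
      then have "\<xi>\<^sup>2 / (real n + 1)\<^sup>2 \<le> \<xi>\<^sup>2 / (real m + 1)\<^sup>2" by (intro divide_left_mono) auto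
      then show "g m \<xi> \<le> g n \<xi>" unfolding g_def by (intro ennreal_leI mult_left_mono) (auto simp: power_divide)
    qed
    show "(\<lambda>k. g k \<xi>) \<longlonglongrightarrow> ennreal ((cmod (fourier F \<xi>))\<^sup>2)" for \<xi>
    proof -
      have "(\<lambda>k. (\<xi> / (real k + 1))) \<longlonglongrightarrow> 0" by real_asymp
      then have "(\<lambda>k. (cmod (fourier F \<xi>))\<^sup>2 * exp (- (\<xi> / (real k + 1))\<^sup>2 / 2)) \<longlonglongrightarrow> (cmod (fourier F \<xi>))\<^sup>2 * exp (- 0\<^sup>2 / 2)"
        by (intro tendsto_intros) auto
      then show ?thesis unfolding g_def by simp
    qed
  qed (simp add: g_def)
  have "(\<lambda>k. LINT u|?N. R (u / (2 * pi * (real k + 1)))) \<longlonglongrightarrow> (LINT u|?N. R 0)"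
  proof (rule integral_dominated_convergence[where w="\<lambda>_. B"])
    show "AE u in ?N. (\<lambda>k. R (u / (2 * pi * (real k + 1)))) \<longlonglongrightarrow> R 0"
    proof (intro AE_I2)
      fix u :: real
      have "(\<lambda>k. u / (2 * pi * (real k + 1))) \<longlonglongrightarrow> 0" by real_asymp
      from autocorrelation_tendsto[OF F this] show "(\<lambda>k. R (u / (2 * pi * (real k + 1)))) \<longlonglongrightarrow> R 0"
        by (simp add: R_def)
    qed
  qed (use Rb in auto)
  then have "(\<lambda>k. ennreal (Re (LINT u|?N. R (u / (2 * pi * (real k + 1)))))) \<longlonglongrightarrow> ennreal (Re (R 0))"
    using N.prob_space by (intro tendsto_ennrealI tendsto_Re) simp
  then have "(\<lambda>k. \<integral>\<^sup>+\<xi>. g k \<xi> \<partial>lborel) \<longlonglongrightarrow> ennreal B" unfolding g R0 by simp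
  from LIMSEQ_unique[OF lim1 this] show ?thesis using sq_int_nn_integral[OF F(1)] by (simp add: B_def)
qed

section \<open>The short-time Fourier transform\<close>

text \<open>The windows are indexed by an arbitrary set because indices with coefficient zero are
  later discarded. The pairing \<open>L2_inner\<close> with a time-frequency shift differs from this
  only by a unimodular factor common to all components.\<close>

definition stft :: "nat set \<Rightarrow> vfun \<Rightarrow> vfun \<Rightarrow> real \<Rightarrow> real \<Rightarrow> complex" where
  "stft I \<phi> g x \<xi> = (\<Sum>i\<in>I. LINT s|lborel. \<phi> i s * cnj (g i (s - x)) * cis (- 2 * pi * \<xi> * s))"

lemma stft_measurable [measurable]:
  assumes "\<And>i. i \<in> I \<Longrightarrow> \<phi> i \<in> borel_measurable borel" "\<And>i. i \<in> I \<Longrightarrow> g i \<in> borel_measurable borel"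
  shows "(\<lambda>(x, \<xi>). stft I \<phi> g x \<xi>) \<in> borel_measurable (borel \<Otimes>\<^sub>M borel)"
  unfolding stft_def case_prod_beta
proof (intro borel_measurable_sum)
  fix i assume "i \<in> I"
  note [measurable] = assms[OF this]
  show "(\<lambda>p. LINT s|lborel. \<phi> i s * cnj (g i (s - fst p)) * cis (- 2 * pi * snd p * s)) \<in> borel_measurable (borel \<Otimes>\<^sub>M borel)"
    by measurable
qed

lemma sq_int_zero: "sq_int (\<lambda>x. 0)"
  by (simp add: sq_int_def)

lemma sq_int_add:
  assumes "sq_int f" "sq_int g"
  shows "sq_int (\<lambda>x. f x + g x)"
proof -
  have [measurable]: "f \<in> borel_measurable borel" "g \<in> borel_measurable borel" using assms by measurable
  have "integrable lborel (\<lambda>x. 2 * (cmod (f x))\<^sup>2 + 2 * (cmod (g x))\<^sup>2)" using assms by (auto simp: sq_int_def)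
  then have "integrable lborel (\<lambda>x. (cmod (f x + g x))\<^sup>2)"
  proof (rule Bochner_Integration.integrable_bound)
    show "AE x in lborel. norm ((cmod (f x + g x))\<^sup>2) \<le> norm (2 * (cmod (f x))\<^sup>2 + 2 * (cmod (g x))\<^sup>2)"
    proof (intro AE_I2)
      fix x
      have "(cmod (f x + g x))\<^sup>2 \<le> (cmod (f x) + cmod (g x))\<^sup>2"
        by (intro power_mono norm_triangle_ineq) auto
      also have "\<dots> \<le> 2 * (cmod (f x))\<^sup>2 + 2 * (cmod (g x))\<^sup>2"
        using sum_squares_bound[of "cmod (f x)" "cmod (g x)"] by (simp add: power2_sum)
      finally show "norm ((cmod (f x + g x))\<^sup>2) \<le> norm (2 * (cmod (f x))\<^sup>2 + 2 * (cmod (g x))\<^sup>2)" by simp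
    qed
  qed measurable
  then show ?thesis by (simp add: sq_int_def)
qed

lemma sq_int_sum: "(\<And>i. i \<in> I \<Longrightarrow> sq_int (f i)) \<Longrightarrow> sq_int (\<lambda>x. \<Sum>i\<in>I. f i x)"
  by (induction I rule: infinite_finite_induct) (auto intro: sq_int_zero sq_int_add)

definition orthonormal :: "nat set \<Rightarrow> vfun \<Rightarrow> bool" where
  "orthonormal I g \<longleftrightarrow> (\<forall>i\<in>I. \<forall>j\<in>I. (LINT x|lborel. cnj (g i x) * g j x) = of_bool (i = j))"

text \<open>The Pythagorean identity for a finite orthonormal family. It is used at a fixed s with
  the values of the signal as coefficients, and makes the windows disappear from the energy.\<close>

lemma nn_integral_orthonormal_sum:
  assumes I: "finite I" and g: "\<And>i. i \<in> I \<Longrightarrow> sq_int (g i)" and o: "orthonormal I g"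
  shows "(\<integral>\<^sup>+x. ennreal ((cmod (\<Sum>i\<in>I. a i * cnj (g i x)))\<^sup>2) \<partial>lborel) = (\<Sum>i\<in>I. ennreal ((cmod (a i))\<^sup>2))"
proof -
  define W where "W = (\<lambda>x. \<Sum>i\<in>I. a i * cnj (g i x))"
  have W: "sq_int W" unfolding W_def by (intro sq_int_sum sq_int_scale sq_int_cnj g)
  have int: "integrable lborel (\<lambda>x. cnj (g i x) * g j x)" if "i \<in> I" "j \<in> I" for i j
    using that by (intro sq_int_integrable_mult sq_int_cnj g)
  have "complex_of_real (LINT x|lborel. (cmod (W x))\<^sup>2) = (LINT x|lborel. W x * cnj (W x))"
    by (simp only: integral_complex_of_real[symmetric] complex_norm_square)
  also have "\<dots> = (LINT x|lborel. (\<Sum>i\<in>I. \<Sum>j\<in>I. (a i * cnj (a j)) * (cnj (g i x) * g j x)))"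
    by (simp add: W_def sum_product ac_simps)
  also have "\<dots> = (\<Sum>i\<in>I. \<Sum>j\<in>I. (a i * cnj (a j)) * (LINT x|lborel. cnj (g i x) * g j x))"
    using int by (simp add: Bochner_Integration.integral_sum)
  also have "\<dots> = (\<Sum>i\<in>I. \<Sum>j\<in>I. if i = j then a i * cnj (a j) else 0)"
    using o unfolding orthonormal_def by (intro sum.cong refl) auto
  also have "\<dots> = (\<Sum>i\<in>I. a i * cnj (a i))" using I by simp
  also have "\<dots> = complex_of_real (\<Sum>i\<in>I. (cmod (a i))\<^sup>2)"
    by (simp only: of_real_sum complex_norm_square)
  finally have "(LINT x|lborel. (cmod (W x))\<^sup>2) = (\<Sum>i\<in>I. (cmod (a i))\<^sup>2)" by (simp only: of_real_eq_iff)
  then show ?thesis using sq_int_nn_integral[OF W] by (simp add: W_def)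
qed

text \<open>Bounded windows put the product W x of signal and translated windows into L^2, and
  square-integrability of both factors puts it into L^1, so \<open>plancherel\<close> applies for
  every x. After the exchange of integrals, the reflection x \<mapsto> s - x turns the translated
  windows into the fixed orthonormal family.\<close>

theorem stft_isometry:
  assumes I: "finite I" and \<phi>: "\<And>i. i \<in> I \<Longrightarrow> sq_int (\<phi> i)" and g: "\<And>i. i \<in> I \<Longrightarrow> sq_int (g i)"
    and b: "\<And>i. i \<in> I \<Longrightarrow> bounded (range (g i))" and o: "orthonormal I g"
  shows "(\<integral>\<^sup>+x. \<integral>\<^sup>+\<xi>. ennreal ((cmod (stft I \<phi> g x \<xi>))\<^sup>2) \<partial>lborel \<partial>lborel) =
    (\<Sum>i\<in>I. \<integral>\<^sup>+s. ennreal ((cmod (\<phi> i s))\<^sup>2) \<partial>lborel)"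
proof -
  define W where "W = (\<lambda>x s. \<Sum>i\<in>I. \<phi> i s * cnj (g i (s - x)))"
  have gm: "g i \<in> borel_measurable borel" if "i \<in> I" for i using g[OF that] by measurable
  have \<phi>m: "\<phi> i \<in> borel_measurable borel" if "i \<in> I" for i using \<phi>[OF that] by measurable
  have Wm[measurable]: "(\<lambda>(x, s). W x s) \<in> borel_measurable (borel \<Otimes>\<^sub>M borel)"
    unfolding W_def case_prod_beta
  proof (intro borel_measurable_sum)
    fix i assume "i \<in> I"
    note [measurable] = gm[OF this] \<phi>m[OF this]
    show "(\<lambda>p. \<phi> i (snd p) * cnj (g i (snd p - fst p))) \<in> borel_measurable (borel \<Otimes>\<^sub>M borel)" by measurable
  qed
  have int: "integrable lborel (\<lambda>s. \<phi> i s * cnj (g i (s - x)))" if "i \<in> I" for i x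
    using sq_int_shift[OF g[OF that], of "- x"] by (intro sq_int_integrable_mult \<phi> that sq_int_cnj) simp
  have W1: "integrable lborel (W x)" for x unfolding W_def by (intro Bochner_Integration.integrable_sum int)
  have W2: "sq_int (W x)" for x unfolding W_def
  proof (intro sq_int_sum)
    fix i assume i: "i \<in> I"
    note [measurable] = gm[OF i]
    from b[OF i] obtain B where "\<And>y. cmod (g i y) \<le> B" by (auto simp: bounded_iff)
    then show "sq_int (\<lambda>s. \<phi> i s * cnj (g i (s - x)))"
      by (intro sq_int_mult_bounded[where B=B] \<phi> i) auto
  qed
  have V: "stft I \<phi> g x \<xi> = fourier (W x) \<xi>" for x \<xi>
  proof -
    have "integrable lborel (\<lambda>s. \<phi> i s * cnj (g i (s - x)) * cis (- 2 * pi * \<xi> * s))" if "i \<in> I" for i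
    proof (rule Bochner_Integration.integrable_bound[OF int[OF that, of x]])
      note [measurable] = gm[OF that] \<phi>m[OF that]
      show "(\<lambda>s. \<phi> i s * cnj (g i (s - x)) * cis (- 2 * pi * \<xi> * s)) \<in> borel_measurable lborel" by measurable
    qed (simp add: norm_mult)
    then show ?thesis unfolding stft_def fourier_def W_def sum_distrib_right
      by (subst Bochner_Integration.integral_sum) auto
  qed
  have "(\<integral>\<^sup>+x. \<integral>\<^sup>+\<xi>. ennreal ((cmod (stft I \<phi> g x \<xi>))\<^sup>2) \<partial>lborel \<partial>lborel) = (\<integral>\<^sup>+x. \<integral>\<^sup>+s. ennreal ((cmod (W x s))\<^sup>2) \<partial>lborel \<partial>lborel)"
    unfolding V using plancherel[OF W2 W1] by simp
  also have "\<dots> = (\<integral>\<^sup>+s. \<integral>\<^sup>+x. ennreal ((cmod (W x s))\<^sup>2) \<partial>lborel \<partial>lborel)"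
    by (rule lborel_pair.Fubini'[symmetric]) measurable
  also have "\<dots> = (\<integral>\<^sup>+s. (\<Sum>i\<in>I. ennreal ((cmod (\<phi> i s))\<^sup>2)) \<partial>lborel)"
  proof (intro nn_integral_cong)
    fix s
    define Y where "Y = (\<lambda>x. ennreal ((cmod (\<Sum>i\<in>I. \<phi> i s * cnj (g i x)))\<^sup>2))"
    have "(\<lambda>x. \<Sum>i\<in>I. \<phi> i s * cnj (g i x)) \<in> borel_measurable borel"
    proof (intro borel_measurable_sum)
      fix i assume "i \<in> I"
      note [measurable] = gm[OF this]
      show "(\<lambda>x. \<phi> i s * cnj (g i x)) \<in> borel_measurable borel" by measurable
    qed
    then have [measurable]: "Y \<in> borel_measurable borel" unfolding Y_def by measurable
    have "(\<integral>\<^sup>+x. ennreal ((cmod (W x s))\<^sup>2) \<partial>lborel) = (\<integral>\<^sup>+x. Y (s + (- 1) * x) \<partial>lborel)"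
      by (simp add: W_def Y_def)
    also have "\<dots> = (\<integral>\<^sup>+x. Y x \<partial>lborel)" using nn_integral_real_affine[of Y "- 1" s] by simp
    also have "\<dots> = (\<Sum>i\<in>I. ennreal ((cmod (\<phi> i s))\<^sup>2))"
      unfolding Y_def by (rule nn_integral_orthonormal_sum[OF I g o])
    finally show "(\<integral>\<^sup>+x. ennreal ((cmod (W x s))\<^sup>2) \<partial>lborel) = \<dots>" .
  qed
  also have "\<dots> = (\<Sum>i\<in>I. \<integral>\<^sup>+s. ennreal ((cmod (\<phi> i s))\<^sup>2) \<partial>lborel)"
    using \<phi>m by (intro nn_integral_sum) auto
  finally show ?thesis .
qed

section \<open>Windows of the form polynomial times Gaussian\<close>

definition gauss_poly :: "complex poly \<Rightarrow> real \<Rightarrow> complex" where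
  "gauss_poly p x = poly p (of_real x) * of_real (exp (- x\<^sup>2 / 2))"

lemma continuous_on_gauss_poly: "continuous_on S (gauss_poly p)"
  unfolding gauss_poly_def by (intro continuous_intros) auto

lemma gauss_poly_measurable [measurable]: "gauss_poly p \<in> borel_measurable borel"
  by (intro borel_measurable_continuous_onI continuous_on_gauss_poly)

text \<open>Each factor x costs half of the exponent: |x| is at most a multiple of exp(e x^2 / 2),
  and the induction hypothesis is used at e / 2, which is why it is kept general in e.\<close>

lemma poly_bound_exp_sq:
  assumes "e > 0"
  shows "\<exists>C\<ge>0. \<forall>x. cmod (poly p (of_real x)) \<le> C * exp (e * x\<^sup>2)"
  using assms
proof (induction p arbitrary: e)
  case 0
  show ?case by (intro exI[of _ 0]) auto
next
  case (pCons a p)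
  from pCons.IH[of "e/2"] pCons.prems obtain C where C: "C \<ge> 0" "\<And>x. cmod (poly p (of_real x)) \<le> C * exp (e/2 * x\<^sup>2)" by auto
  define D where "D = 1 + 2 / e"
  have D: "\<bar>x\<bar> \<le> D * exp (e/2 * x\<^sup>2)" for x :: real
  proof -
    have "\<bar>x\<bar> \<le> 1 + x\<^sup>2" using sum_squares_bound[of 1 "\<bar>x\<bar>"] by (simp add: power2_eq_square)
    also have "1 + x\<^sup>2 \<le> D * exp (e/2 * x\<^sup>2)"
    proof -
      have "1 \<le> exp (e/2 * x\<^sup>2)" using pCons.prems by simp
      moreover have "x\<^sup>2 \<le> 2 / e * exp (e/2 * x\<^sup>2)"
      proof -
        have "e/2 * x\<^sup>2 \<le> exp (e/2 * x\<^sup>2)" using exp_ge_add_one_self[of "e/2 * x\<^sup>2"] by linarith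
        then show ?thesis using pCons.prems by (simp add: field_simps)
      qed
      ultimately show ?thesis unfolding D_def ring_distribs mult_1_left by (rule add_mono)
    qed
    finally show ?thesis .
  qed
  have D0: "D \<ge> 0" using pCons.prems by (simp add: D_def)
  show ?case
  proof (intro exI[of _ "cmod a + D * C"] conjI allI)
    show "0 \<le> cmod a + D * C" using D0 C by simp
    fix x :: real
    have "cmod (poly (pCons a p) (of_real x)) \<le> cmod a + \<bar>x\<bar> * cmod (poly p (of_real x))"
      using norm_triangle_ineq[of a "of_real x * poly p (of_real x)"] by (simp add: norm_mult)
    also have "\<dots> \<le> cmod a * exp (e * x\<^sup>2) + (D * exp (e/2 * x\<^sup>2)) * (C * exp (e/2 * x\<^sup>2))"
    proof (intro add_mono mult_mono D C)
      show "cmod a \<le> cmod a * exp (e * x\<^sup>2)" using pCons.prems by (simp add: mult_le_cancel_left1)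
    qed (use D0 in auto)
    also have "\<dots> = (cmod a + D * C) * exp (e * x\<^sup>2)"
      by (simp add: ring_distribs flip: exp_add mult.assoc)
    finally show "cmod (poly (pCons a p) (of_real x)) \<le> (cmod a + D * C) * exp (e * x\<^sup>2)" .
  qed
qed

lemma gauss_poly_bound: "\<exists>C\<ge>0. \<forall>x. cmod (gauss_poly p x) \<le> C * exp (- x\<^sup>2 / 4)"
proof -
  from poly_bound_exp_sq[of "1/4" p] obtain C where C: "C \<ge> 0" "\<And>x. cmod (poly p (of_real x)) \<le> C * exp (1/4 * x\<^sup>2)" by auto
  have "cmod (gauss_poly p x) \<le> C * exp (- x\<^sup>2 / 4)" for x
  proof -
    have "cmod (gauss_poly p x) \<le> (C * exp (1/4 * x\<^sup>2)) * exp (- x\<^sup>2 / 2)"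
      unfolding gauss_poly_def norm_mult using C(2)[of x] by (simp add: mult_right_mono)
    also have "\<dots> = C * exp (- x\<^sup>2 / 4)" by (simp add: mult.assoc flip: exp_add)
    finally show ?thesis .
  qed
  then show ?thesis using C by blast
qed

lemma bounded_gauss_poly: "bounded (range (gauss_poly p))"
proof -
  obtain C where C: "C \<ge> 0" "\<And>x. cmod (gauss_poly p x) \<le> C * exp (- x\<^sup>2 / 4)" using gauss_poly_bound by blast
  have "cmod (gauss_poly p x) \<le> C" for x
    using C(2)[of x] mult_left_le[of "exp (- x\<^sup>2 / 4)" C] C(1) by simp
  then show ?thesis by (auto simp: bounded_iff)
qed

lemma integrable_exp_neg_sq: "integrable lborel (\<lambda>x::real. exp (- x\<^sup>2 / 2))"
proof -
  have "integrable lborel (\<lambda>x. sqrt (2 * pi) * std_normal_density x)"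
    using integrable_std_normal_moment[of 0] by simp
  then show ?thesis by (simp add: std_normal_density_def)
qed

lemma sq_int_gauss_poly: "sq_int (gauss_poly p)"
  unfolding sq_int_def
proof
  obtain C where C: "C \<ge> 0" "\<And>x. cmod (gauss_poly p x) \<le> C * exp (- x\<^sup>2 / 4)" using gauss_poly_bound by blast
  have "integrable lborel (\<lambda>x::real. C\<^sup>2 * exp (- x\<^sup>2 / 2))" using integrable_exp_neg_sq by simp
  then show "integrable lborel (\<lambda>x. (cmod (gauss_poly p x))\<^sup>2)"
  proof (rule Bochner_Integration.integrable_bound)
    show "AE x in lborel. norm ((cmod (gauss_poly p x))\<^sup>2) \<le> norm (C\<^sup>2 * exp (- x\<^sup>2 / 2))"
    proof (intro AE_I2)
      fix x :: real
      have "(cmod (gauss_poly p x))\<^sup>2 \<le> (C * exp (- x\<^sup>2 / 4))\<^sup>2" using C by (intro power_mono) auto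
      also have "\<dots> = C\<^sup>2 * exp (- x\<^sup>2 / 2)" by (simp add: power_mult_distrib flip: exp_double)
      finally show "norm ((cmod (gauss_poly p x))\<^sup>2) \<le> norm (C\<^sup>2 * exp (- x\<^sup>2 / 2))" by simp
    qed
  qed measurable
qed measurable

text \<open>On the polynomial factor, differentiation is p \<mapsto> p' - x p. Together with
  multiplication by x this keeps every window of the argument in one class, on which the operators
  act algebraically.\<close>

lemma gauss_poly_has_vector_derivative:
  "(gauss_poly p has_vector_derivative gauss_poly (pderiv p - pCons 0 p) x) (at x)"
proof -
  have "((\<lambda>z. poly p z * exp (- z\<^sup>2 / 2)) has_field_derivative
     poly (pderiv p - pCons 0 p) (of_real x) * exp (- (of_real x)\<^sup>2 / 2)) (at (of_real x))"
    by (auto intro!: derivative_eq_intros simp: algebra_simps)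
  from has_vector_derivative_real_field[OF this]
  show ?thesis unfolding gauss_poly_def[abs_def] by (simp add: exp_of_real[symmetric])
qed

lemma gauss_poly_add: "gauss_poly (p + q) x = gauss_poly p x + gauss_poly q x"
  and gauss_poly_diff: "gauss_poly (p - q) x = gauss_poly p x - gauss_poly q x"
  and gauss_poly_smult: "gauss_poly (smult c p) x = c * gauss_poly p x"
  and gauss_poly_pCons: "gauss_poly (pCons 0 p) x = of_real x * gauss_poly p x"
  by (simp_all add: gauss_poly_def algebra_simps)

text \<open>The action on \<open>p\<close> of \<open>A g(x) = 2\<pi>ivx g(x) - u g'(x)\<close>, where \<open>g(x) = p(x) exp(-x\<^sup>2/2)\<close>.\<close>

definition shift_gen :: "real \<Rightarrow> real \<Rightarrow> complex poly \<Rightarrow> complex poly" where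
  "shift_gen u v p = smult (2 * pi * v * \<i>) (pCons 0 p) - smult (of_real u) (pderiv p - pCons 0 p)"

text \<open>
  The time-frequency shift of \<open>g\<close> by \<open>(a + ru, b + rv)\<close>.  The phase is chosen so that \<open>r \<mapsto> tf_path a b u v g r\<close>
  is the orbit of a one-parameter group; only then is the derivative the same path with window \<open>A g\<close>.
\<close>

definition tf_path :: "real \<Rightarrow> real \<Rightarrow> real \<Rightarrow> real \<Rightarrow> (real \<Rightarrow> complex) \<Rightarrow> real \<Rightarrow> real \<Rightarrow> complex" where
  "tf_path a b u v g r s = cis (2 * pi * b * s + 2 * pi * r * v * (s - a) - pi * r\<^sup>2 * u * v) * g (s - a - r * u)"

lemma tf_path_measurable [measurable]:
  assumes [measurable]: "g \<in> borel_measurable borel"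
  shows "(\<lambda>(r, s). tf_path a b u v g r s) \<in> borel_measurable (borel \<Otimes>\<^sub>M borel)"
  unfolding tf_path_def by measurable

text \<open>The parameter r is extended to a complex z; the path is then a product of holomorphic
  functions, and the real derivative follows by restriction.\<close>

lemma tf_path_has_vector_derivative:
  "((\<lambda>r. tf_path a b u v (gauss_poly p) r s) has_vector_derivative tf_path a b u v (gauss_poly (shift_gen u v p)) r s) (at r)"
proof -
  define E where "E = (\<lambda>z::complex. exp (\<i> * (2 * pi * b * s + 2 * pi * z * v * (s - a) - pi * z\<^sup>2 * u * v)))"
  define Y where "Y = (\<lambda>z::complex. of_real (s - a) - z * of_real u)"
  define G where "G = (\<lambda>p z::complex. poly p (Y z) * exp (- (Y z)\<^sup>2 / 2))"
  have tf: "tf_path a b u v (gauss_poly q) r s = E (of_real r) * G q (of_real r)" for q r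
    unfolding tf_path_def gauss_poly_def E_def G_def Y_def cis_conv_exp by (simp add: exp_of_real[symmetric])
  have dY: "(Y has_field_derivative - of_real u) (at z)" for z
    unfolding Y_def by (auto intro!: derivative_eq_intros)
  have dE: "(E has_field_derivative (\<i> * (2 * pi * v * (s - a) - 2 * pi * z * u * v)) * E z) (at z)" for z :: complex
    unfolding E_def by (auto intro!: derivative_eq_intros simp: algebra_simps)
  have dG: "((\<lambda>z. G p z) has_field_derivative - of_real u * G (pderiv p - pCons 0 p) z) (at z)" for z
    unfolding G_def
    by (auto intro!: derivative_eq_intros DERIV_chain2[OF poly_DERIV dY] dY simp: algebra_simps)
  have "((\<lambda>z. E z * G p z) has_field_derivative E z * G (shift_gen u v p) z) (at z)" for z
  proof -
    have e1: "G (shift_gen u v p) z = 2 * pi * v * \<i> * (Y z * G p z) - of_real u * G (pderiv p - pCons 0 p) z"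
      unfolding G_def shift_gen_def by (simp add: algebra_simps)
    \<comment> \<open>The quadratic term of the phase pays off here: its derivative turns s - a into
      Y z = s - a - z u, the argument of the window, so the phase contributes exactly the
      multiplication part of \<open>shift_gen\<close>.\<close>
    have e2: "\<i> * (2 * pi * v * (s - a) - 2 * pi * z * u * v) = 2 * pi * v * \<i> * Y z"
      by (simp add: Y_def algebra_simps)
    have eq: "(\<i> * (2 * pi * v * (s - a) - 2 * pi * z * u * v)) * E z * G p z + - of_real u * G (pderiv p - pCons 0 p) z * E z = E z * G (shift_gen u v p) z"
      unfolding e1 e2 by (simp add: algebra_simps)
    show ?thesis by (rule DERIV_cong[OF DERIV_mult[OF dE dG] eq])
  qed
  from has_vector_derivative_real_field[OF this] show ?thesis unfolding tf .
qed

lemma continuous_on_tf_path: "continuous_on S (\<lambda>r. tf_path a b u v (gauss_poly p) r s)"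
  by (rule continuous_on_vector_derivative[OF has_vector_derivative_at_within[OF tf_path_has_vector_derivative]])

section \<open>Variation of the transform along a line segment\<close>

lemma FTC_segment:
  fixes F :: "real \<Rightarrow> complex"
  assumes F: "\<And>x. (F has_vector_derivative f x) (at x)" and f: "continuous_on UNIV f"
  shows "F t - F 0 = sgn t *\<^sub>R (LINT r|lborel. indicator (closed_segment 0 t) r *\<^sub>R f r)"
proof (cases "t \<ge> 0")
  case True
  have "(LINT r|lborel. indicator {0..t} r *\<^sub>R f r) = F t - F 0"
    using True by (intro integral_FTC_Icc has_vector_derivative_at_within[OF F] continuous_on_subset[OF f]) auto
  then show ?thesis using True by (cases "t = 0") (auto simp: closed_segment_eq_real_ivl)
next
  case False
  have "(LINT r|lborel. indicator {t..0} r *\<^sub>R f r) = F 0 - F t"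
    using False by (intro integral_FTC_Icc has_vector_derivative_at_within[OF F] continuous_on_subset[OF f]) auto
  then show ?thesis using False by (auto simp: closed_segment_eq_real_ivl)
qed

lemma nn_integral_tf_path_sq:
  "(\<integral>\<^sup>+s. ennreal ((cmod (tf_path a b u v (gauss_poly p) r s))\<^sup>2) \<partial>lborel) = (\<integral>\<^sup>+s. ennreal ((cmod (gauss_poly p s))\<^sup>2) \<partial>lborel)"
  using nn_integral_lborel_shift[of "\<lambda>s. ennreal ((cmod (gauss_poly p s))\<^sup>2)" "- a - r * u"]
  by (simp add: tf_path_def norm_mult algebra_simps)

lemma sq_int_tf_path: "sq_int (tf_path a b u v (gauss_poly p) r)"
proof (rule sq_intI)
  show "tf_path a b u v (gauss_poly p) r \<in> borel_measurable borel"
    unfolding tf_path_def[abs_def] by measurable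
qed (use sq_int_finite[OF sq_int_gauss_poly[of p]] nn_integral_tf_path_sq in simp)

lemma nn_integral_mult_le:
  assumes [measurable]: "f \<in> borel_measurable M" "g \<in> borel_measurable M"
  shows "(\<integral>\<^sup>+x. ennreal (cmod (f x * g x)) \<partial>M) \<le> (\<integral>\<^sup>+x. ennreal ((cmod (f x))\<^sup>2) \<partial>M) + (\<integral>\<^sup>+x. ennreal ((cmod (g x))\<^sup>2) \<partial>M)"
proof -
  have "(\<integral>\<^sup>+x. ennreal (cmod (f x * g x)) \<partial>M) \<le> (\<integral>\<^sup>+x. ennreal ((cmod (f x))\<^sup>2) + ennreal ((cmod (g x))\<^sup>2) \<partial>M)"
  proof (intro nn_integral_mono)
    fix x
    have "2 * (cmod (f x) * cmod (g x)) \<le> (cmod (f x))\<^sup>2 + (cmod (g x))\<^sup>2"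
      using sum_squares_bound[of "cmod (f x)" "cmod (g x)"] by simp
    moreover have "cmod (f x) * cmod (g x) \<ge> 0" by simp
    ultimately have "cmod (f x * g x) \<le> (cmod (f x))\<^sup>2 + (cmod (g x))\<^sup>2" unfolding norm_mult by linarith
    then show "ennreal (cmod (f x * g x)) \<le> ennreal ((cmod (f x))\<^sup>2) + ennreal ((cmod (g x))\<^sup>2)"
      by (simp add: ennreal_leI flip: ennreal_plus)
  qed
  also have "\<dots> = (\<integral>\<^sup>+x. ennreal ((cmod (f x))\<^sup>2) \<partial>M) + (\<integral>\<^sup>+x. ennreal ((cmod (g x))\<^sup>2) \<partial>M)"
    by (intro nn_integral_add) auto
  finally show ?thesis .
qed

text \<open>Unlike \<open>stft\<close>, whose phase changes along the segment, this pairing has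
  increments that are integrals of a pairing of the same form, with p replaced by
  \<open>shift_gen u v p\<close>.\<close>

definition coef_path :: "(real \<Rightarrow> complex) \<Rightarrow> real \<Rightarrow> real \<Rightarrow> real \<Rightarrow> real \<Rightarrow> complex poly \<Rightarrow> real \<Rightarrow> complex" where
  "coef_path \<phi> a b u v p r = (LINT s|lborel. \<phi> s * cnj (tf_path a b u v (gauss_poly p) r s))"

lemma coef_path_measurable [measurable]:
  assumes [measurable]: "\<phi> \<in> borel_measurable borel"
  shows "coef_path \<phi> a b u v p \<in> borel_measurable borel"
  unfolding coef_path_def[abs_def] by measurable

text \<open>The bound is uniform in r because time-frequency shifts preserve the norm of the window;
  it yields integrability over a segment.\<close>

lemma coef_path_bounded:
  assumes \<phi>: "sq_int \<phi>"
  obtains B where "\<And>r. cmod (coef_path \<phi> a b u v p r) \<le> B"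
proof -
  have [measurable]: "\<phi> \<in> borel_measurable borel" using \<phi> by measurable
  define C where "C = (\<integral>\<^sup>+s. ennreal ((cmod (\<phi> s))\<^sup>2) \<partial>lborel) + (\<integral>\<^sup>+s. ennreal ((cmod (gauss_poly p s))\<^sup>2) \<partial>lborel)"
  have C: "C < \<infinity>" unfolding C_def using sq_int_finite[OF \<phi>] sq_int_finite[OF sq_int_gauss_poly] by simp
  have "cmod (coef_path \<phi> a b u v p r) \<le> enn2real C" for r
  proof -
    have [measurable]: "tf_path a b u v (gauss_poly p) r \<in> borel_measurable borel" using sq_int_tf_path by measurable
    have "ennreal (cmod (coef_path \<phi> a b u v p r)) \<le> (\<integral>\<^sup>+s. ennreal (cmod (\<phi> s * cnj (tf_path a b u v (gauss_poly p) r s))) \<partial>lborel)"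
      unfolding coef_path_def
      by (intro integral_norm_bound_ennreal sq_int_integrable_mult \<phi> sq_int_cnj sq_int_tf_path)
    also have "\<dots> \<le> (\<integral>\<^sup>+s. ennreal ((cmod (\<phi> s))\<^sup>2) \<partial>lborel) + (\<integral>\<^sup>+s. ennreal ((cmod (cnj (tf_path a b u v (gauss_poly p) r s)))\<^sup>2) \<partial>lborel)"
      by (rule nn_integral_mult_le) measurable
    also have "\<dots> = C" unfolding C_def complex_mod_cnj nn_integral_tf_path_sq ..
    finally show ?thesis using C by (metis enn2real_ennreal enn2real_mono infinity_ennreal_def norm_ge_zero)
  qed
  then show ?thesis by (rule that)
qed

text \<open>The fundamental theorem is applied pointwise in s and the two integrals are then
  exchanged, which avoids differentiating under the integral. The exchange is justified because the
  norm of the path is constant in r and the segment has finite length; the sign of t accounts for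
  the orientation.\<close>

lemma coef_path_FTC:
  assumes \<phi>: "sq_int \<phi>"
  shows "coef_path \<phi> a b u v p t - coef_path \<phi> a b u v p 0 =
    sgn t *\<^sub>R (LINT r|lborel. indicator (closed_segment 0 t) r *\<^sub>R coef_path \<phi> a b u v (shift_gen u v p) r)"
proof -
  have [measurable]: "\<phi> \<in> borel_measurable borel" using \<phi> by measurable
  define J where "J = closed_segment 0 t"
  have [measurable]: "J \<in> sets borel" unfolding J_def by simp
  define k where "k = tf_path a b u v (gauss_poly p)"
  define k' where "k' = tf_path a b u v (gauss_poly (shift_gen u v p))"
  have k'm[measurable]: "(\<lambda>(r, s). k' r s) \<in> borel_measurable (borel \<Otimes>\<^sub>M borel)"
    unfolding k'_def by measurable
  have "coef_path \<phi> a b u v p t - coef_path \<phi> a b u v p 0 = (LINT s|lborel. \<phi> s * cnj (k t s) - \<phi> s * cnj (k 0 s))"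
    unfolding coef_path_def k_def
    by (intro Bochner_Integration.integral_diff[symmetric] sq_int_integrable_mult \<phi> sq_int_cnj sq_int_tf_path)
  also have "\<dots> = (LINT s|lborel. sgn t *\<^sub>R (LINT r|lborel. indicator J r *\<^sub>R (\<phi> s * cnj (k' r s))))"
  proof (intro Bochner_Integration.integral_cong refl)
    fix s
    have "k t s - k 0 s = sgn t *\<^sub>R (LINT r|lborel. indicator J r *\<^sub>R k' r s)"
      unfolding k_def k'_def J_def by (intro FTC_segment tf_path_has_vector_derivative continuous_on_tf_path)
    then have "\<phi> s * cnj (k t s) - \<phi> s * cnj (k 0 s) = \<phi> s * cnj (sgn t *\<^sub>R (LINT r|lborel. indicator J r *\<^sub>R k' r s))"
      by (metis complex_cnj_diff right_diff_distrib)
    also have "\<dots> = sgn t *\<^sub>R (\<phi> s * cnj (LINT r|lborel. indicator J r *\<^sub>R k' r s))"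
      by (simp add: scaleR_conv_of_real)
    also have "cnj (LINT r|lborel. indicator J r *\<^sub>R k' r s) = (LINT r|lborel. cnj (indicator J r *\<^sub>R k' r s))"
      by (rule Bochner_Integration.integral_cnj[symmetric])
    also have "\<phi> s * \<dots> = (LINT r|lborel. \<phi> s * cnj (indicator J r *\<^sub>R k' r s))"
      by (rule integral_mult_right_zero[symmetric])
    also have "\<dots> = (LINT r|lborel. indicator J r *\<^sub>R (\<phi> s * cnj (k' r s)))"
      by (intro Bochner_Integration.integral_cong refl) (simp add: scaleR_conv_of_real)
    finally show "\<phi> s * cnj (k t s) - \<phi> s * cnj (k 0 s) = sgn t *\<^sub>R (LINT r|lborel. indicator J r *\<^sub>R (\<phi> s * cnj (k' r s)))" .
  qed
  also have "\<dots> = sgn t *\<^sub>R (LINT s|lborel. LINT r|lborel. indicator J r *\<^sub>R (\<phi> s * cnj (k' r s)))"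
    by (rule integral_scaleR_right)
  also have "(LINT s|lborel. LINT r|lborel. indicator J r *\<^sub>R (\<phi> s * cnj (k' r s))) = (LINT r|lborel. LINT s|lborel. indicator J r *\<^sub>R (\<phi> s * cnj (k' r s)))"
  proof (rule Fubini_swap[OF sigma_finite_lborel sigma_finite_lborel, symmetric])
    define C where "C = (\<integral>\<^sup>+s. ennreal ((cmod (\<phi> s))\<^sup>2) \<partial>lborel) + (\<integral>\<^sup>+s. ennreal ((cmod (gauss_poly (shift_gen u v p) s))\<^sup>2) \<partial>lborel)"
    have C: "C < \<infinity>" unfolding C_def using sq_int_finite[OF \<phi>] sq_int_finite[OF sq_int_gauss_poly] by simp
    have "(\<integral>\<^sup>+r. \<integral>\<^sup>+s. ennreal (cmod (indicator J r *\<^sub>R (\<phi> s * cnj (k' r s)))) \<partial>lborel \<partial>lborel) \<le> (\<integral>\<^sup>+r. C * indicator J r \<partial>lborel)"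
    proof (intro nn_integral_mono)
      fix r
      have [measurable]: "k' r \<in> borel_measurable borel" unfolding k'_def using sq_int_tf_path by measurable
      have "(\<integral>\<^sup>+s. ennreal (cmod (\<phi> s * cnj (k' r s))) \<partial>lborel) \<le> (\<integral>\<^sup>+s. ennreal ((cmod (\<phi> s))\<^sup>2) \<partial>lborel) + (\<integral>\<^sup>+s. ennreal ((cmod (cnj (k' r s)))\<^sup>2) \<partial>lborel)"
        by (rule nn_integral_mult_le) measurable
      also have "\<dots> = C" unfolding C_def complex_mod_cnj k'_def nn_integral_tf_path_sq ..
      finally show "(\<integral>\<^sup>+s. ennreal (cmod (indicator J r *\<^sub>R (\<phi> s * cnj (k' r s)))) \<partial>lborel) \<le> C * indicator J r"
        by (auto simp: indicator_def)
    qed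
    also have "\<dots> = C * emeasure lborel J" by (simp add: nn_integral_cmult)
    also have "\<dots> < \<infinity>" using C by (auto simp: J_def closed_segment_eq_real_ivl ennreal_mult_less_top)
    finally show "(\<integral>\<^sup>+r. \<integral>\<^sup>+s. ennreal (cmod (indicator J r *\<^sub>R (\<phi> s * cnj (k' r s)))) \<partial>lborel \<partial>lborel) < \<infinity>" .
  qed measurable
  also have "\<dots> = (LINT r|lborel. indicator J r *\<^sub>R coef_path \<phi> a b u v (shift_gen u v p) r)"
    unfolding coef_path_def k'_def by (simp only: integral_scaleR_right)
  finally show ?thesis unfolding J_def .
qed

definition gvec :: "(nat \<Rightarrow> complex poly) \<Rightarrow> vfun" where
  "gvec p = (\<lambda>i. gauss_poly (p i))"

text \<open>The phases of path and transform differ by the factor c, which depends neither on s nor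
  on the component, and hence leaves both the integral and the sum.\<close>

lemma cmod_stft_path:
  "cmod (stft I \<phi> (gvec p) (a + r * u) (b + r * v)) = cmod (\<Sum>i\<in>I. coef_path (\<phi> i) a b u v (p i) r)"
proof -
  define c where "c = cis (2 * pi * r * v * a + pi * r\<^sup>2 * u * v)"
  have "coef_path (\<phi> i) a b u v (p i) r = c * (LINT s|lborel. \<phi> i s * cnj (gvec p i (s - (a + r * u))) * cis (- 2 * pi * (b + r * v) * s))" for i
  proof -
    have "coef_path (\<phi> i) a b u v (p i) r = (LINT s|lborel. c * (\<phi> i s * cnj (gvec p i (s - (a + r * u))) * cis (- 2 * pi * (b + r * v) * s)))"
      unfolding coef_path_def
    proof (intro Bochner_Integration.integral_cong refl)
      fix s
      have "cnj (cis (2 * pi * b * s + 2 * pi * r * v * (s - a) - pi * r\<^sup>2 * u * v)) = c * cis (- 2 * pi * (b + r * v) * s)"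
        unfolding c_def cis_cnj cis_mult by (rule arg_cong[of _ _ cis]) (simp add: algebra_simps)
      then show "\<phi> i s * cnj (tf_path a b u v (gauss_poly (p i)) r s) = c * (\<phi> i s * cnj (gvec p i (s - (a + r * u))) * cis (- 2 * pi * (b + r * v) * s))"
        by (simp add: tf_path_def gvec_def diff_diff_eq)
    qed
    also have "\<dots> = c * (LINT s|lborel. \<phi> i s * cnj (gvec p i (s - (a + r * u))) * cis (- 2 * pi * (b + r * v) * s))"
      by (rule integral_mult_right_zero)
    finally show ?thesis .
  qed
  then have "(\<Sum>i\<in>I. coef_path (\<phi> i) a b u v (p i) r) = c * stft I \<phi> (gvec p) (a + r * u) (b + r * v)"
    by (simp add: stft_def sum_distrib_left)
  then show ?thesis by (simp add: norm_mult c_def)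
qed

text \<open>Passing to moduli removes the phases, by the reverse triangle inequality. Cauchy-Schwarz
  on the segment from 0 to t produces its length, at most 1/2; enlarging the segment to the whole
  cell then makes the bound independent of t.\<close>

lemma stft_variation:
  assumes \<phi>: "\<And>i. i \<in> I \<Longrightarrow> sq_int (\<phi> i)" and t: "\<bar>t\<bar> \<le> 1 / 2"
  shows "ennreal ((cmod (stft I \<phi> (gvec p) (a + t * u) (b + t * v)) - cmod (stft I \<phi> (gvec p) a b))\<^sup>2)
    \<le> ennreal (1 / 2) * (\<integral>\<^sup>+r. indicator {-1/2..1/2} r *
        ennreal ((cmod (stft I \<phi> (gvec (\<lambda>i. shift_gen u v (p i))) (a + r * u) (b + r * v)))\<^sup>2) \<partial>lborel)"
proof -
  define J where "J = closed_segment 0 t"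
  have [measurable]: "J \<in> sets borel" unfolding J_def by simp
  have JI: "J \<subseteq> {-1/2..1/2}" using t by (auto simp: J_def closed_segment_eq_real_ivl split: if_splits)
  have "emeasure lborel J = ennreal \<bar>t\<bar>" by (auto simp: J_def closed_segment_eq_real_ivl)
  then have Jm: "emeasure lborel J \<le> ennreal (1/2)" using ennreal_leI[OF t] by simp
  have Jfin: "emeasure lborel J < \<infinity>" by (auto simp: J_def closed_segment_eq_real_ivl)
  define S where "S = (\<lambda>r. \<Sum>i\<in>I. coef_path (\<phi> i) a b u v (shift_gen u v (p i)) r)"
  have Sm[measurable]: "S \<in> borel_measurable borel" unfolding S_def
  proof (intro borel_measurable_sum)
    fix i assume "i \<in> I"
    from \<phi>[OF this] have [measurable]: "\<phi> i \<in> borel_measurable borel" by measurable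
    show "coef_path (\<phi> i) a b u v (shift_gen u v (p i)) \<in> borel_measurable borel" by measurable
  qed
  have int: "integrable lborel (\<lambda>r. indicator J r *\<^sub>R coef_path (\<phi> i) a b u v (shift_gen u v (p i)) r)" if i: "i \<in> I" for i
  proof -
    from \<phi>[OF i] have [measurable]: "\<phi> i \<in> borel_measurable borel" by measurable
    obtain B where "\<And>r. cmod (coef_path (\<phi> i) a b u v (shift_gen u v (p i)) r) \<le> B"
      using coef_path_bounded[OF \<phi>[OF i]] by blast
    then show ?thesis using Jfin
      by (intro integrableI_bounded_set_indicator[where B=B]) auto
  qed
  have "cmod ((\<Sum>i\<in>I. coef_path (\<phi> i) a b u v (p i) t) - (\<Sum>i\<in>I. coef_path (\<phi> i) a b u v (p i) 0))
     = cmod (\<Sum>i\<in>I. sgn t *\<^sub>R (LINT r|lborel. indicator J r *\<^sub>R coef_path (\<phi> i) a b u v (shift_gen u v (p i)) r))"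
    unfolding sum_subtractf[symmetric] J_def using coef_path_FTC[OF \<phi>] by (intro arg_cong[of _ _ cmod] sum.cong) auto
  also have "\<dots> = cmod (sgn t *\<^sub>R (LINT r|lborel. indicator J r *\<^sub>R S r))"
    unfolding S_def scaleR_sum_right using int by (subst Bochner_Integration.integral_sum) (auto simp: scaleR_sum_right)
  also have "\<dots> \<le> cmod (LINT r|lborel. indicator J r *\<^sub>R S r)"
    by (simp add: sgn_if)
  \<comment> \<open>The indicator is duplicated: in Cauchy-Schwarz one copy gives the length of J,
    the other confines the energy to J.\<close>
  also have "\<dots> = cmod (LINT r|lborel. indicator J r * (indicator J r * S r))"
    by (intro arg_cong[of _ _ cmod] Bochner_Integration.integral_cong) (auto simp: indicator_def)
  finally have le: "cmod ((\<Sum>i\<in>I. coef_path (\<phi> i) a b u v (p i) t) - (\<Sum>i\<in>I. coef_path (\<phi> i) a b u v (p i) 0))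
     \<le> cmod (LINT r|lborel. indicator J r * (indicator J r * S r))" .
  have "\<bar>cmod (stft I \<phi> (gvec p) (a + t * u) (b + t * v)) - cmod (stft I \<phi> (gvec p) a b)\<bar>
    \<le> cmod ((\<Sum>i\<in>I. coef_path (\<phi> i) a b u v (p i) t) - (\<Sum>i\<in>I. coef_path (\<phi> i) a b u v (p i) 0))"
    using cmod_stft_path[of I \<phi> p a t u b v] cmod_stft_path[of I \<phi> p a 0 u b v] norm_triangle_ineq3 by auto
  from order_trans[OF this le]
  have "(cmod (stft I \<phi> (gvec p) (a + t * u) (b + t * v)) - cmod (stft I \<phi> (gvec p) a b))\<^sup>2 \<le> (cmod (LINT r|lborel. indicator J r * (indicator J r * S r)))\<^sup>2"
    by (metis abs_ge_zero power2_abs power_mono)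
  then have "ennreal ((cmod (stft I \<phi> (gvec p) (a + t * u) (b + t * v)) - cmod (stft I \<phi> (gvec p) a b))\<^sup>2)
    \<le> ennreal ((cmod (LINT r|lborel. indicator J r * (indicator J r * S r)))\<^sup>2)" by (rule ennreal_leI)
  also have "\<dots> \<le> (\<integral>\<^sup>+r. ennreal ((cmod (indicator J r))\<^sup>2) \<partial>lborel) * (\<integral>\<^sup>+r. ennreal ((cmod (indicator J r * S r))\<^sup>2) \<partial>lborel)"
    by (rule Cauchy_Schwarz_integral) measurable
  also have "(\<integral>\<^sup>+r. ennreal ((cmod (indicator J r))\<^sup>2) \<partial>lborel) = (\<integral>\<^sup>+r. indicator J r \<partial>lborel)"
    by (intro nn_integral_cong) (auto simp: indicator_def)
  also have "\<dots> = emeasure lborel J" by simp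
  also have "emeasure lborel J * (\<integral>\<^sup>+r. ennreal ((cmod (indicator J r * S r))\<^sup>2) \<partial>lborel)
     \<le> ennreal (1/2) * (\<integral>\<^sup>+r. indicator {-1/2..1/2} r * ennreal ((cmod (S r))\<^sup>2) \<partial>lborel)"
    using JI by (intro mult_mono Jm nn_integral_mono) (auto simp: indicator_def)
  finally show ?thesis unfolding S_def cmod_stft_path .
qed

section \<open>Sampling on a lattice\<close>

text \<open>Of length 1, so that integrals over it are averages, and centred, so that each
  coordinate moves by at most 1/2. Neighbouring closed cells share an endpoint, which is harmless
  for integrals.\<close>

definition unit_cell :: "real set" where "unit_cell = {-1/2..1/2}"

lemma unit_cell_measurable [measurable]: "unit_cell \<in> sets borel"
  by (simp add: unit_cell_def)

lemma nn_integral_unit_cell_const: "(\<integral>\<^sup>+r. indicator unit_cell r * c \<partial>lborel) = c"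
  by (simp add: nn_integral_multc unit_cell_def)

definition stft_sq :: "nat set \<Rightarrow> vfun \<Rightarrow> (nat \<Rightarrow> complex poly) \<Rightarrow> real \<Rightarrow> real \<Rightarrow> ennreal" where
  "stft_sq I \<phi> p a b = ennreal ((cmod (stft I \<phi> (gvec p) a b))\<^sup>2)"

lemma stft_sq_measurable [measurable]:
  assumes "\<And>i. i \<in> I \<Longrightarrow> sq_int (\<phi> i)"
  shows "(\<lambda>(a, b). stft_sq I \<phi> p a b) \<in> borel_measurable (borel \<Otimes>\<^sub>M borel)"
proof -
  have [measurable]: "(\<lambda>(x, \<xi>). stft I \<phi> (gvec p) x \<xi>) \<in> borel_measurable (borel \<Otimes>\<^sub>M borel)"
    by (rule stft_measurable) (auto simp: gvec_def intro: sq_int_measurable assms)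
  show ?thesis unfolding stft_sq_def by measurable
qed

lemma stft_variation_cell:
  assumes \<phi>: "\<And>i. i \<in> I \<Longrightarrow> sq_int (\<phi> i)" and t: "t \<in> unit_cell"
  shows "ennreal ((cmod (stft I \<phi> (gvec p) (a + t * u) (b + t * v)) - cmod (stft I \<phi> (gvec p) a b))\<^sup>2)
    \<le> ennreal (1 / 2) * (\<integral>\<^sup>+r. indicator unit_cell r * stft_sq I \<phi> (\<lambda>i. shift_gen u v (p i)) (a + r * u) (b + r * v) \<partial>lborel)"
  using stft_variation[OF \<phi>, where I=I and t=t and p=p and a=a and b=b and u=u and v=v] t unfolding stft_sq_def unit_cell_def by auto

lemma ennreal_sq_le_two:
  "ennreal ((x - z)\<^sup>2) \<le> 2 * ennreal ((x - y)\<^sup>2) + 2 * ennreal ((y - z)\<^sup>2)"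
proof -
  have "(x - z)\<^sup>2 \<le> 2 * (x - y)\<^sup>2 + 2 * (y - z)\<^sup>2"
    using sum_squares_bound[of "x - y" "y - z"] by (simp add: power2_eq_square algebra_simps)
  then have "ennreal ((x - z)\<^sup>2) \<le> ennreal (2 * (x - y)\<^sup>2 + 2 * (y - z)\<^sup>2)" by (rule ennreal_leI)
  also have "\<dots> = 2 * ennreal ((x - y)\<^sup>2) + 2 * ennreal ((y - z)\<^sup>2)"
    by (simp add: ennreal_mult)
  finally show ?thesis .
qed

lemma ennreal_two_half: "2 * (ennreal (1 / 2) * x) = x"
proof -
  have "2 * (ennreal (1 / 2) * x) = ennreal (2 * (1 / 2)) * x"
    by (simp only: ennreal_mult mult.assoc zero_le_numeral zero_le_divide_1_iff ennreal_numeral)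
  then show ?thesis by simp
qed

text \<open>
  Move first along \<open>(u, v)\<close> and then along \<open>(u', v')\<close>.  The first leg only involves the energy on the segment \<open>t = 0\<close>;
  averaging over parallel segments, at the cost of a mixed second derivative, makes it an integral over the cell.
\<close>

lemma stft_variation_square:
  assumes \<phi>: "\<And>i. i \<in> I \<Longrightarrow> sq_int (\<phi> i)" and s: "s \<in> unit_cell" and t: "t \<in> unit_cell"
  shows "ennreal ((cmod (stft I \<phi> (gvec p) (a + s * u + t * u') (b + s * v + t * v')) - cmod (stft I \<phi> (gvec p) a b))\<^sup>2)
    \<le> (\<integral>\<^sup>+r. indicator unit_cell r * stft_sq I \<phi> (\<lambda>i. shift_gen u' v' (p i)) (a + s * u + r * u') (b + s * v + r * v') \<partial>lborel)
    + (\<integral>\<^sup>+q. indicator unit_cell q * (\<integral>\<^sup>+r. indicator unit_cell r *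
        (2 * stft_sq I \<phi> (\<lambda>i. shift_gen u v (p i)) (a + q * u + r * u') (b + q * v + r * v')
         + stft_sq I \<phi> (\<lambda>i. shift_gen u' v' (shift_gen u v (p i))) (a + q * u + r * u') (b + q * v + r * v')) \<partial>lborel) \<partial>lborel)"
proof -
  note [measurable] = stft_sq_measurable[OF \<phi>]
  let ?V = "\<lambda>a b. cmod (stft I \<phi> (gvec p) a b)"
  let ?B = "stft_sq I \<phi> (\<lambda>i. shift_gen u' v' (p i))"
  let ?C = "stft_sq I \<phi> (\<lambda>i. shift_gen u v (p i))"
  let ?D = "stft_sq I \<phi> (\<lambda>i. shift_gen u' v' (shift_gen u v (p i)))"
  \<comment> \<open>The square of a value is at most twice the square of the moved value plus twice
    the squared difference. The difference carries the factor 1/2 of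
    \<open>stft_variation_cell\<close>, hence the weights 2 for the first-order energy and 1 for the
    mixed one.\<close>
  have C: "?C x y \<le> (\<integral>\<^sup>+r. indicator unit_cell r * (2 * ?C (x + r * u') (y + r * v') + ?D (x + r * u') (y + r * v')) \<partial>lborel)" for x y
  proof -
    define M where "M = (\<integral>\<^sup>+r. indicator unit_cell r * ?D (x + r * u') (y + r * v') \<partial>lborel)"
    have "?C x y = (\<integral>\<^sup>+r. indicator unit_cell r * ?C x y \<partial>lborel)" by (simp only: nn_integral_unit_cell_const)
    also have "\<dots> \<le> (\<integral>\<^sup>+r. indicator unit_cell r * (2 * ?C (x + r * u') (y + r * v')) + indicator unit_cell r * M \<partial>lborel)"
    proof (intro nn_integral_mono)
      fix r
      show "indicator unit_cell r * ?C x y \<le> indicator unit_cell r * (2 * ?C (x + r * u') (y + r * v')) + indicator unit_cell r * M"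
      proof (cases "r \<in> unit_cell")
        case True
        let ?W = "\<lambda>a b. cmod (stft I \<phi> (gvec (\<lambda>i. shift_gen u v (p i))) a b)"
        have "?C x y \<le> 2 * ennreal ((0 - ?W (x + r * u') (y + r * v'))\<^sup>2) + 2 * ennreal ((?W (x + r * u') (y + r * v') - ?W x y)\<^sup>2)"
          using ennreal_sq_le_two[of 0 "?W x y" "?W (x + r * u') (y + r * v')"] by (simp add: stft_sq_def)
        also have "\<dots> \<le> 2 * ?C (x + r * u') (y + r * v') + 2 * (ennreal (1/2) * M)"
          using stft_variation_cell[OF \<phi> True, where I=I and p="\<lambda>i. shift_gen u v (p i)" and a=x and b=y and u=u' and v=v']
          by (intro add_mono mult_left_mono) (auto simp: stft_sq_def M_def)
        finally show ?thesis unfolding ennreal_two_half using True by simp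
      qed simp
    qed
    also have "\<dots> = (\<integral>\<^sup>+r. indicator unit_cell r * (2 * ?C (x + r * u') (y + r * v')) \<partial>lborel) + M"
      by (subst nn_integral_add) (auto simp: nn_integral_unit_cell_const)
    also have "\<dots> = (\<integral>\<^sup>+r. indicator unit_cell r * (2 * ?C (x + r * u') (y + r * v') + ?D (x + r * u') (y + r * v')) \<partial>lborel)"
      unfolding M_def by (subst nn_integral_add[symmetric]) (auto simp: distrib_left)
    finally show ?thesis .
  qed
  have "ennreal ((?V (a + s * u + t * u') (b + s * v + t * v') - ?V a b)\<^sup>2) \<le>
     2 * ennreal ((?V (a + s * u + t * u') (b + s * v + t * v') - ?V (a + s * u) (b + s * v))\<^sup>2)
     + 2 * ennreal ((?V (a + s * u) (b + s * v) - ?V a b)\<^sup>2)"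
    by (rule ennreal_sq_le_two)
  also have "\<dots> \<le> 2 * (ennreal (1/2) * (\<integral>\<^sup>+r. indicator unit_cell r * ?B (a + s * u + r * u') (b + s * v + r * v') \<partial>lborel))
     + 2 * (ennreal (1/2) * (\<integral>\<^sup>+q. indicator unit_cell q * ?C (a + q * u) (b + q * v) \<partial>lborel))"
    by (intro add_mono mult_left_mono stft_variation_cell \<phi> s t) auto
  also have "\<dots> = (\<integral>\<^sup>+r. indicator unit_cell r * ?B (a + s * u + r * u') (b + s * v + r * v') \<partial>lborel)
     + (\<integral>\<^sup>+q. indicator unit_cell q * ?C (a + q * u) (b + q * v) \<partial>lborel)"
    by (simp only: ennreal_two_half)
  also have "\<dots> \<le> (\<integral>\<^sup>+r. indicator unit_cell r * ?B (a + s * u + r * u') (b + s * v + r * v') \<partial>lborel)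
     + (\<integral>\<^sup>+q. indicator unit_cell q * (\<integral>\<^sup>+r. indicator unit_cell r *
        (2 * ?C (a + q * u + r * u') (b + q * v + r * v') + ?D (a + q * u + r * u') (b + q * v + r * v')) \<partial>lborel) \<partial>lborel)"
    by (intro add_mono nn_integral_mono mult_left_mono C order_refl) auto
  finally show ?thesis .
qed

section \<open>Sums over the integers, tilings and linear substitutions\<close>

lemma nn_integral_count_space_swap:
  fixes f :: "int \<Rightarrow> real \<Rightarrow> ennreal"
  assumes "\<And>k. f k \<in> borel_measurable borel"
  shows "(\<integral>\<^sup>+k. \<integral>\<^sup>+s. f k s \<partial>lborel \<partial>count_space UNIV) = (\<integral>\<^sup>+s. \<integral>\<^sup>+k. f k s \<partial>count_space UNIV \<partial>lborel)"
proof -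
  interpret A: sigma_finite_measure "count_space (UNIV :: int set)" by (rule sigma_finite_measure_count_space)
  interpret pair_sigma_finite "count_space (UNIV :: int set)" "lborel :: real measure" ..
  show ?thesis
    by (rule Fubini'[symmetric]) (use assms in \<open>auto intro!: measurable_pair_measure_countable1\<close>)
qed

lemma borel_measurable_count_space_nn_integral [measurable (raw)]:
  fixes f :: "'a \<Rightarrow> int \<Rightarrow> ennreal"
  assumes "\<And>k. (\<lambda>s. f s k) \<in> borel_measurable M"
  shows "(\<lambda>s. \<integral>\<^sup>+k. f s k \<partial>count_space UNIV) \<in> borel_measurable M"
proof -
  interpret A: sigma_finite_measure "count_space (UNIV :: int set)" by (rule sigma_finite_measure_count_space)
  have "(\<lambda>p. f (fst p) (snd p)) \<in> borel_measurable (M \<Otimes>\<^sub>M count_space UNIV)"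
    using assms by (intro measurable_compose_countable[of "\<lambda>k p. f (fst p) k" _ _ snd]) auto
  then show ?thesis by (intro A.borel_measurable_nn_integral) (simp add: case_prod_beta')
qed

text \<open>The integer translates of the cell cover the line, and every point not of the form k +
  1/2 lies in exactly one of them, that of its nearest integer. The exceptional points are
  countable, hence null.\<close>

lemma nn_integral_tiling:
  assumes [measurable]: "f \<in> borel_measurable borel"
  shows "(\<integral>\<^sup>+k. \<integral>\<^sup>+s. indicator unit_cell s * f (of_int k + s) \<partial>lborel \<partial>count_space (UNIV :: int set)) = (\<integral>\<^sup>+x. f x \<partial>lborel)"
proof -
  have "(\<integral>\<^sup>+s. indicator unit_cell s * f (of_int k + s) \<partial>lborel) = (\<integral>\<^sup>+x. indicator unit_cell (x - of_int k) * f x \<partial>lborel)" for k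
    using nn_integral_lborel_shift[of "\<lambda>x. indicator unit_cell (x - of_int k) * f x" "of_int k"] by (simp add: add.commute)
  then have "(\<integral>\<^sup>+k. \<integral>\<^sup>+s. indicator unit_cell s * f (of_int k + s) \<partial>lborel \<partial>count_space (UNIV :: int set))
    = (\<integral>\<^sup>+x. \<integral>\<^sup>+k. indicator unit_cell (x - of_int k) * f x \<partial>count_space (UNIV :: int set) \<partial>lborel)"
    by (simp add: nn_integral_count_space_swap)
  also have "\<dots> = (\<integral>\<^sup>+x. f x \<partial>lborel)"
  proof (rule nn_integral_cong_AE)
    have "AE x in lborel. x \<notin> range (\<lambda>k::int. of_int k + 1/2 :: real)"
      by (intro AE_not_in countable_imp_null_set_lborel) auto
    then show "AE x in lborel. (\<integral>\<^sup>+k. indicator unit_cell (x - of_int k) * f x \<partial>count_space (UNIV :: int set)) = f x"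
    proof eventually_elim
      case (elim x)
      define m where "m = \<lfloor>x + 1/2\<rfloor>"
      have m: "of_int m \<le> x + 1/2" "x + 1/2 < of_int m + 1" unfolding m_def by linarith+
      have "x - of_int k \<in> unit_cell \<longleftrightarrow> k = m" for k :: int
      proof
        assume k: "x - of_int k \<in> unit_cell"
        then have "of_int k \<le> x + 1/2" "x + 1/2 \<le> of_int k + 1" by (auto simp: unit_cell_def)
        moreover have "x \<noteq> of_int k + 1/2" using elim by blast
        ultimately have "of_int k \<le> x + 1/2" "x + 1/2 < of_int k + 1" by linarith+
        then show "k = m" unfolding m_def by linarith
      qed (use m in \<open>auto simp: unit_cell_def\<close>)
      then have "(\<lambda>k. indicator unit_cell (x - of_int k) * f x) = (\<lambda>k::int. f x * indicator {m} k)"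
        by (auto simp: fun_eq_iff indicator_def)
      then show ?case by (simp add: nn_integral_cmult_indicator)
    qed
  qed
  finally show ?thesis .
qed

lemma nn_integral_tiling2:
  assumes G[measurable]: "(\<lambda>(x, y). G x y) \<in> borel_measurable (borel \<Otimes>\<^sub>M borel)"
  shows "(\<integral>\<^sup>+k. \<integral>\<^sup>+l. \<integral>\<^sup>+s. \<integral>\<^sup>+t. indicator unit_cell s * (indicator unit_cell t * G (of_int k + s) (of_int l + t)) \<partial>lborel \<partial>lborel
       \<partial>count_space (UNIV :: int set) \<partial>count_space (UNIV :: int set)) = (\<integral>\<^sup>+x. \<integral>\<^sup>+y. G x y \<partial>lborel \<partial>lborel)"
proof -
  have "(\<integral>\<^sup>+l. \<integral>\<^sup>+s. \<integral>\<^sup>+t. indicator unit_cell s * (indicator unit_cell t * G (of_int k + s) (of_int l + t)) \<partial>lborel \<partial>lborel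
       \<partial>count_space (UNIV :: int set)) = (\<integral>\<^sup>+s. indicator unit_cell s * (\<integral>\<^sup>+y. G (of_int k + s) y \<partial>lborel) \<partial>lborel)" for k :: int
    by (subst nn_integral_count_space_swap) (auto simp: nn_integral_cmult nn_integral_tiling)
  then show ?thesis using nn_integral_tiling[of "\<lambda>x. \<integral>\<^sup>+y. G x y \<partial>lborel"] by simp
qed

text \<open>The substitution is factored into affine ones in a single variable. For u \<noteq> 0 the
  second coordinate is sheared and scaled by the determinant over u, and then the first is scaled by
  u. For u = 0 the roles of the axes are exchanged, and the scalings are by u' and v.\<close>

lemma nn_integral_linear_change:
  assumes H[measurable]: "(\<lambda>(x, y). H x y) \<in> borel_measurable (borel \<Otimes>\<^sub>M borel)"
    and det: "u * v' - v * u' \<noteq> 0"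
  shows "ennreal \<bar>u * v' - v * u'\<bar> * (\<integral>\<^sup>+x. \<integral>\<^sup>+y. H (x * u + y * u') (x * v + y * v') \<partial>lborel \<partial>lborel)
    = (\<integral>\<^sup>+x. \<integral>\<^sup>+y. H x y \<partial>lborel \<partial>lborel)"
proof -
  have swap: "(\<integral>\<^sup>+x. \<integral>\<^sup>+y. F x y \<partial>lborel \<partial>lborel) = (\<integral>\<^sup>+y. \<integral>\<^sup>+x. F x y \<partial>lborel \<partial>lborel)"
    if "(\<lambda>(x, y). F x y) \<in> borel_measurable (borel \<Otimes>\<^sub>M borel)" for F :: "real \<Rightarrow> real \<Rightarrow> ennreal"
    using that by (intro lborel_pair.Fubini'[symmetric]) simp
  show ?thesis
  proof (cases "u = 0")
    case False
    have "(\<integral>\<^sup>+x. \<integral>\<^sup>+y. H x y \<partial>lborel \<partial>lborel) =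
       (\<integral>\<^sup>+w. ennreal \<bar>(u * v' - v * u') / u\<bar> * (\<integral>\<^sup>+y. H w (w * v / u + (u * v' - v * u') / u * y) \<partial>lborel) \<partial>lborel)"
      using False det by (intro nn_integral_cong nn_integral_real_affine) auto
    also have "\<dots> = ennreal \<bar>(u * v' - v * u') / u\<bar> * (\<integral>\<^sup>+y. \<integral>\<^sup>+w. H w (w * v / u + (u * v' - v * u') / u * y) \<partial>lborel \<partial>lborel)"
      by (subst swap[symmetric]) (auto simp: nn_integral_cmult)
    also have "(\<integral>\<^sup>+y. \<integral>\<^sup>+w. H w (w * v / u + (u * v' - v * u') / u * y) \<partial>lborel \<partial>lborel) =
       (\<integral>\<^sup>+y. ennreal \<bar>u\<bar> * (\<integral>\<^sup>+x. H (x * u + y * u') (x * v + y * v') \<partial>lborel) \<partial>lborel)"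
    proof (intro nn_integral_cong)
      fix y
      have "(y * u' + u * x) * v / u + (u * v' - v * u') / u * y = x * v + y * v'" for x
        using False by (simp add: field_simps)
      then show "(\<integral>\<^sup>+w. H w (w * v / u + (u * v' - v * u') / u * y) \<partial>lborel) = ennreal \<bar>u\<bar> * (\<integral>\<^sup>+x. H (x * u + y * u') (x * v + y * v') \<partial>lborel)"
        using nn_integral_real_affine[of "\<lambda>w. H w (w * v / u + (u * v' - v * u') / u * y)" u "y * u'"] False
        by (simp add: add.commute mult.commute)
    qed
    also have "\<dots> = ennreal \<bar>u\<bar> * (\<integral>\<^sup>+x. \<integral>\<^sup>+y. H (x * u + y * u') (x * v + y * v') \<partial>lborel \<partial>lborel)"
      using swap[of "\<lambda>x y. H (x * u + y * u') (x * v + y * v')"] by (simp add: nn_integral_cmult)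
    finally have "(\<integral>\<^sup>+x. \<integral>\<^sup>+y. H x y \<partial>lborel \<partial>lborel) = ennreal \<bar>(u * v' - v * u') / u\<bar> * (ennreal \<bar>u\<bar> * (\<integral>\<^sup>+x. \<integral>\<^sup>+y. H (x * u + y * u') (x * v + y * v') \<partial>lborel \<partial>lborel))" .
    moreover have "ennreal \<bar>(u * v' - v * u') / u\<bar> * ennreal \<bar>u\<bar> = ennreal \<bar>u * v' - v * u'\<bar>"
      using False by (subst ennreal_mult[symmetric]) (auto simp: abs_mult)
    ultimately show ?thesis by (simp add: mult.assoc[symmetric])
  next
    case True
    then have nz: "v \<noteq> 0" "u' \<noteq> 0" using det by auto
    have "(\<integral>\<^sup>+x. \<integral>\<^sup>+y. H x y \<partial>lborel \<partial>lborel) = ennreal \<bar>u'\<bar> * (\<integral>\<^sup>+x. \<integral>\<^sup>+y. H (0 + u' * x) y \<partial>lborel \<partial>lborel)"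
      using nz by (intro nn_integral_real_affine[of "\<lambda>x. \<integral>\<^sup>+y. H x y \<partial>lborel"]) auto
    also have "(\<integral>\<^sup>+x. \<integral>\<^sup>+y. H (0 + u' * x) y \<partial>lborel \<partial>lborel) = (\<integral>\<^sup>+x. ennreal \<bar>v\<bar> * (\<integral>\<^sup>+y. H (0 + u' * x) (x * v' + v * y) \<partial>lborel) \<partial>lborel)"
      using nz by (intro nn_integral_cong nn_integral_real_affine) auto
    also have "\<dots> = ennreal \<bar>v\<bar> * (\<integral>\<^sup>+y. \<integral>\<^sup>+x. H (0 + u' * x) (x * v' + v * y) \<partial>lborel \<partial>lborel)"
      by (subst swap[symmetric]) (auto simp: nn_integral_cmult)
    finally have "(\<integral>\<^sup>+x. \<integral>\<^sup>+y. H x y \<partial>lborel \<partial>lborel) = ennreal \<bar>u'\<bar> * (ennreal \<bar>v\<bar> * (\<integral>\<^sup>+x. \<integral>\<^sup>+y. H (x * u + y * u') (x * v + y * v') \<partial>lborel \<partial>lborel))"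
      using True by (simp add: ac_simps)
    then show ?thesis using True
      by (simp add: ennreal_mult abs_mult mult.assoc[symmetric] mult.commute)
  qed
qed

section \<open>Cell averages and the sampling inequality\<close>

definition stft_energy :: "nat set \<Rightarrow> vfun \<Rightarrow> (nat \<Rightarrow> complex poly) \<Rightarrow> ennreal" where
  "stft_energy I \<phi> p = (\<integral>\<^sup>+x. \<integral>\<^sup>+\<xi>. stft_sq I \<phi> p x \<xi> \<partial>lborel \<partial>lborel)"

text \<open>Lattice sums are integrals against counting measure: in \<open>ennreal\<close> they are
  monotone, additive and exchangeable with integrals. They are turned into \<open>has_sum\<close>
  statements only once finiteness is proved.\<close>

abbreviation int_sum2 :: "(int \<Rightarrow> int \<Rightarrow> ennreal) \<Rightarrow> ennreal" where
  "int_sum2 F \<equiv> (\<integral>\<^sup>+k. \<integral>\<^sup>+l. F k l \<partial>count_space UNIV \<partial>count_space UNIV)"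

lemma int_sum2_mono: "(\<And>k l. F k l \<le> G k l) \<Longrightarrow> int_sum2 F \<le> int_sum2 G"
  by (intro nn_integral_mono) auto

lemma int_sum2_add: "int_sum2 (\<lambda>k l. F k l + G k l) = int_sum2 F + int_sum2 G"
  by (simp add: nn_integral_add)

lemma int_sum2_cmult: "int_sum2 (\<lambda>k l. c * F k l) = c * int_sum2 F"
  by (simp add: nn_integral_cmult)

definition cell_int :: "(real \<Rightarrow> real \<Rightarrow> ennreal) \<Rightarrow> ennreal" where
  "cell_int F = (\<integral>\<^sup>+s. \<integral>\<^sup>+t. indicator unit_cell s * (indicator unit_cell t * F s t) \<partial>lborel \<partial>lborel)"

lemma cell_int_mono: "(\<And>s t. s \<in> unit_cell \<Longrightarrow> t \<in> unit_cell \<Longrightarrow> F s t \<le> G s t) \<Longrightarrow> cell_int F \<le> cell_int G"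
  unfolding cell_int_def by (intro nn_integral_mono) (auto simp: indicator_def)

lemma cell_int_const: "cell_int (\<lambda>s t. c) = c"
  unfolding cell_int_def by (simp add: nn_integral_cmult nn_integral_unit_cell_const)

lemma cell_int_add:
  assumes [measurable]: "(\<lambda>(s, t). F s t) \<in> borel_measurable (borel \<Otimes>\<^sub>M borel)" "(\<lambda>(s, t). G s t) \<in> borel_measurable (borel \<Otimes>\<^sub>M borel)"
  shows "cell_int (\<lambda>s t. F s t + G s t) = cell_int F + cell_int G"
  unfolding cell_int_def by (simp add: distrib_left nn_integral_add)

lemma cell_int_cmult:
  assumes [measurable]: "(\<lambda>(s, t). F s t) \<in> borel_measurable (borel \<Otimes>\<^sub>M borel)"
  shows "cell_int (\<lambda>s t. c * F s t) = c * cell_int F"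
proof -
  have "cell_int (\<lambda>s t. c * F s t) = (\<integral>\<^sup>+s. c * (\<integral>\<^sup>+t. indicator unit_cell s * (indicator unit_cell t * F s t) \<partial>lborel) \<partial>lborel)"
    unfolding cell_int_def by (subst nn_integral_cmult[symmetric]) (auto simp: ac_simps)
  also have "\<dots> = c * cell_int F" unfolding cell_int_def by (rule nn_integral_cmult) measurable
  finally show ?thesis .
qed

lemma cell_int_iterated:
  assumes [measurable]: "(\<lambda>(s, t). F s t) \<in> borel_measurable (borel \<Otimes>\<^sub>M borel)"
  shows "(\<integral>\<^sup>+s. indicator unit_cell s * (\<integral>\<^sup>+t. indicator unit_cell t * F s t \<partial>lborel) \<partial>lborel) = cell_int F"
  unfolding cell_int_def by (simp add: nn_integral_cmult)

text \<open>Obtained by expanding the square of sqrt \<tau> y - (x - y) / sqrt \<tau>. Being linear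
  in the squares, the estimate can be averaged over a cell and summed over cells; the best \<tau>
  then loses nothing against the triangle inequality in L^2.\<close>

lemma ennreal_sq_young:
  fixes \<tau> :: real assumes "\<tau> > 0"
  shows "ennreal (x\<^sup>2) \<le> ennreal (1 + \<tau>) * ennreal (y\<^sup>2) + ennreal (1 + 1 / \<tau>) * ennreal ((x - y)\<^sup>2)"
proof -
  have "0 \<le> (sqrt \<tau> * y - (x - y) / sqrt \<tau>)\<^sup>2" by simp
  also have "\<dots> = \<tau> * y\<^sup>2 + (x - y)\<^sup>2 / \<tau> - 2 * y * (x - y)"
    using assms by (simp add: power2_diff power_mult_distrib power_divide)
  finally have "2 * y * (x - y) \<le> \<tau> * y\<^sup>2 + (x - y)\<^sup>2 / \<tau>" by simp
  then have "x\<^sup>2 \<le> (1 + \<tau>) * y\<^sup>2 + (1 + 1 / \<tau>) * (x - y)\<^sup>2"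
  proof -
    have "x\<^sup>2 = y\<^sup>2 + 2 * y * (x - y) + (x - y)\<^sup>2" by (simp add: power2_eq_square algebra_simps)
    have "(1 + \<tau>) * y\<^sup>2 + (1 + 1 / \<tau>) * w = y\<^sup>2 + \<tau> * y\<^sup>2 + w + w / \<tau>" for w
      by (simp add: ring_distribs)
    from this[of "(x - y)\<^sup>2"] show ?thesis
      using \<open>2 * y * (x - y) \<le> _\<close> \<open>x\<^sup>2 = _\<close> by linarith
  qed
  then have "ennreal (x\<^sup>2) \<le> ennreal ((1 + \<tau>) * y\<^sup>2 + (1 + 1 / \<tau>) * (x - y)\<^sup>2)" by (rule ennreal_leI)
  also have "\<dots> = ennreal (1 + \<tau>) * ennreal (y\<^sup>2) + ennreal (1 + 1 / \<tau>) * ennreal ((x - y)\<^sup>2)"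
    using assms by (subst ennreal_plus) (auto simp: ennreal_mult simp del: ennreal_plus)
  finally show ?thesis .
qed

text \<open>For each cell, \<open>q\<close> is the value at the lattice point, \<open>E\<close> the
  average over the cell and \<open>d\<close> the mean square oscillation. The weights 1, 2, 1 in the
  hypothesis are those of \<open>stft_variation_square\<close>, so the hypothesis bounds the summed
  oscillation, times the determinant, by \<epsilon>^2 N.\<close>

theorem stft_sampling:
  fixes u v u' v' :: real
  assumes \<phi>: "\<And>i. i \<in> I \<Longrightarrow> sq_int (\<phi> i)" and det: "u * v' - v * u' \<noteq> 0"
    and \<epsilon>: "0 < \<epsilon>" "\<epsilon> < 1" and N: "N \<ge> 0" "stft_energy I \<phi> p = ennreal N"
    and le: "stft_energy I \<phi> (\<lambda>i. shift_gen u' v' (p i)) + 2 * stft_energy I \<phi> (\<lambda>i. shift_gen u v (p i))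
      + stft_energy I \<phi> (\<lambda>i. shift_gen u' v' (shift_gen u v (p i))) \<le> ennreal (\<epsilon>\<^sup>2 * N)"
  obtains S where "S \<ge> 0"
    "int_sum2 (\<lambda>k l. stft_sq I \<phi> p (of_int k * u + of_int l * u') (of_int k * v + of_int l * v')) = ennreal S"
    "(1 - \<epsilon>)\<^sup>2 * N \<le> \<bar>u * v' - v * u'\<bar> * S" "\<bar>u * v' - v * u'\<bar> * S \<le> (1 + \<epsilon>)\<^sup>2 * N"
proof -
  note [measurable] = stft_sq_measurable[OF \<phi>]
  define \<Delta> where "\<Delta> = \<bar>u * v' - v * u'\<bar>"
  have \<Delta>: "\<Delta> > 0" using det by (simp add: \<Delta>_def)
  define X where "X = (\<lambda>k l :: int. of_int k * u + of_int l * u')"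
  define Y where "Y = (\<lambda>k l :: int. of_int k * v + of_int l * v')"
  define E where "E = (\<lambda>p k l. cell_int (\<lambda>s t. stft_sq I \<phi> p (X k l + s * u + t * u') (Y k l + s * v + t * v')))"
  \<comment> \<open>In the coordinates given by the two columns the cells become integer translates
    of a unit square; \<Delta> is the Jacobian.\<close>
  have energy: "ennreal \<Delta> * int_sum2 (E p) = stft_energy I \<phi> p" for p
  proof -
    have "int_sum2 (E p) = (\<integral>\<^sup>+x. \<integral>\<^sup>+y. stft_sq I \<phi> p (x * u + y * u') (x * v + y * v') \<partial>lborel \<partial>lborel)"
      using nn_integral_tiling2[of "\<lambda>x y. stft_sq I \<phi> p (x * u + y * u') (x * v + y * v')"]
      unfolding E_def X_def Y_def cell_int_def by (simp add: algebra_simps)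
    then show ?thesis unfolding stft_energy_def \<Delta>_def
      using nn_integral_linear_change[OF _ det, of "stft_sq I \<phi> p"] by simp
  qed
  define V where "V = (\<lambda>a b. cmod (stft I \<phi> (gvec p) a b))"
  have [measurable]: "(\<lambda>(a, b). V a b) \<in> borel_measurable (borel \<Otimes>\<^sub>M borel)"
  proof -
    have [measurable]: "(\<lambda>(x, \<xi>). stft I \<phi> (gvec p) x \<xi>) \<in> borel_measurable (borel \<Otimes>\<^sub>M borel)"
      by (rule stft_measurable) (auto simp: gvec_def intro: sq_int_measurable \<phi>)
    show ?thesis unfolding V_def by measurable
  qed
  have sqV: "stft_sq I \<phi> p a b = ennreal ((V a b)\<^sup>2)" for a b by (simp add: stft_sq_def V_def)
  define d where "d = (\<lambda>k l. cell_int (\<lambda>s t. ennreal ((V (X k l + s * u + t * u') (Y k l + s * v + t * v') - V (X k l) (Y k l))\<^sup>2)))"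
  define q where "q = (\<lambda>k l. stft_sq I \<phi> p (X k l) (Y k l))"
  have d_le: "d k l \<le> E (\<lambda>i. shift_gen u' v' (p i)) k l + (2 * E (\<lambda>i. shift_gen u v (p i)) k l + E (\<lambda>i. shift_gen u' v' (shift_gen u v (p i))) k l)" for k l
  proof -
    define B where "B = (\<lambda>s. \<integral>\<^sup>+r. indicator unit_cell r * stft_sq I \<phi> (\<lambda>i. shift_gen u' v' (p i)) (X k l + s * u + r * u') (Y k l + s * v + r * v') \<partial>lborel)"
    have [measurable]: "B \<in> borel_measurable borel" unfolding B_def by measurable
    define C where "C = (\<integral>\<^sup>+q. indicator unit_cell q * (\<integral>\<^sup>+r. indicator unit_cell r *
        (2 * stft_sq I \<phi> (\<lambda>i. shift_gen u v (p i)) (X k l + q * u + r * u') (Y k l + q * v + r * v')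
         + stft_sq I \<phi> (\<lambda>i. shift_gen u' v' (shift_gen u v (p i))) (X k l + q * u + r * u') (Y k l + q * v + r * v')) \<partial>lborel) \<partial>lborel)"
    \<comment> \<open>The first part of the bound still depends on s, the second is constant on the
      cell; averaging over s completes the first to a cell average.\<close>
    have "d k l \<le> cell_int (\<lambda>s t. B s + C)"
      unfolding d_def B_def C_def V_def by (intro cell_int_mono stft_variation_square \<phi>)
    also have "\<dots> = cell_int (\<lambda>s t. B s) + C"
      by (subst cell_int_add) (auto simp: cell_int_const)
    also have "cell_int (\<lambda>s t. B s) = (\<integral>\<^sup>+s. indicator unit_cell s * B s \<partial>lborel)"
      unfolding cell_int_def by (simp add: nn_integral_cmult nn_integral_unit_cell_const)
    also have "\<dots> = E (\<lambda>i. shift_gen u' v' (p i)) k l"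
      unfolding B_def E_def by (rule cell_int_iterated) measurable
    also have "C = 2 * E (\<lambda>i. shift_gen u v (p i)) k l + E (\<lambda>i. shift_gen u' v' (shift_gen u v (p i))) k l"
      unfolding C_def E_def by (simp add: cell_int_iterated cell_int_add cell_int_cmult)
    finally show ?thesis .
  qed
  have D: "ennreal \<Delta> * int_sum2 d \<le> ennreal (\<epsilon>\<^sup>2 * N)"
  proof -
    have "ennreal \<Delta> * int_sum2 d \<le> ennreal \<Delta> * int_sum2 (\<lambda>k l. E (\<lambda>i. shift_gen u' v' (p i)) k l + (2 * E (\<lambda>i. shift_gen u v (p i)) k l + E (\<lambda>i. shift_gen u' v' (shift_gen u v (p i))) k l))"
      by (intro mult_left_mono int_sum2_mono d_le) auto
    also have "\<dots> = ennreal \<Delta> * int_sum2 (E (\<lambda>i. shift_gen u' v' (p i))) + (2 * (ennreal \<Delta> * int_sum2 (E (\<lambda>i. shift_gen u v (p i)))) + ennreal \<Delta> * int_sum2 (E (\<lambda>i. shift_gen u' v' (shift_gen u v (p i)))))"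
      by (simp only: int_sum2_add int_sum2_cmult distrib_left mult.left_commute)
    also have "\<dots> \<le> ennreal (\<epsilon>\<^sup>2 * N)" unfolding energy using le by (simp only: add.assoc)
    finally show ?thesis .
  qed
  have meas_d: "(\<lambda>(s, t). ennreal ((V (X k l + s * u + t * u') (Y k l + s * v + t * v') - V (X k l) (Y k l))\<^sup>2)) \<in> borel_measurable (borel \<Otimes>\<^sub>M borel)" for k l
    by measurable
  \<comment> \<open>Young's inequality with weight \<tau> = \<epsilon>, because (1 + \<epsilon>) N +
    (1 + 1/\<epsilon>) \<epsilon>^2 N = (1 + \<epsilon>)^2 N.\<close>
  have upper: "ennreal \<Delta> * int_sum2 q \<le> ennreal ((1 + \<epsilon>)\<^sup>2 * N)"
  proof -
    have "q k l \<le> ennreal (1 + \<epsilon>) * E p k l + ennreal (1 + 1 / \<epsilon>) * d k l" for k l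
    proof -
      have "q k l = cell_int (\<lambda>s t. q k l)" by (simp only: cell_int_const)
      also have "\<dots> \<le> cell_int (\<lambda>s t. ennreal (1 + \<epsilon>) * stft_sq I \<phi> p (X k l + s * u + t * u') (Y k l + s * v + t * v')
          + ennreal (1 + 1 / \<epsilon>) * ennreal ((V (X k l + s * u + t * u') (Y k l + s * v + t * v') - V (X k l) (Y k l))\<^sup>2))"
        unfolding q_def sqV by (subst power2_commute) (intro cell_int_mono ennreal_sq_young \<epsilon>)
      also have "\<dots> = ennreal (1 + \<epsilon>) * E p k l + ennreal (1 + 1 / \<epsilon>) * d k l"
        unfolding E_def d_def by (subst cell_int_add, measurable) (subst (1 2) cell_int_cmult; measurable)
      finally show ?thesis .
    qed
    then have "ennreal \<Delta> * int_sum2 q \<le> ennreal \<Delta> * int_sum2 (\<lambda>k l. ennreal (1 + \<epsilon>) * E p k l + ennreal (1 + 1 / \<epsilon>) * d k l)"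
      by (intro mult_left_mono int_sum2_mono) auto
    also have "\<dots> = ennreal (1 + \<epsilon>) * (ennreal \<Delta> * int_sum2 (E p)) + ennreal (1 + 1 / \<epsilon>) * (ennreal \<Delta> * int_sum2 d)"
      by (simp only: int_sum2_add int_sum2_cmult distrib_left mult.left_commute)
    also have "\<dots> \<le> ennreal (1 + \<epsilon>) * ennreal N + ennreal (1 + 1 / \<epsilon>) * ennreal (\<epsilon>\<^sup>2 * N)"
      unfolding energy N by (intro add_mono mult_left_mono D) auto
    also have "\<dots> = ennreal ((1 + \<epsilon>) * N + (1 + 1 / \<epsilon>) * (\<epsilon>\<^sup>2 * N))"
      using \<epsilon> N by (simp only: ennreal_mult ennreal_plus add_nonneg_nonneg mult_nonneg_nonneg zero_le_power2 less_imp_le zero_le_divide_1_iff zero_le_one)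
    also have "(1 + \<epsilon>) * N + (1 + 1 / \<epsilon>) * (\<epsilon>\<^sup>2 * N) = (1 + \<epsilon>)\<^sup>2 * N"
      using \<epsilon> by (simp add: power2_eq_square field_simps)
    finally show ?thesis .
  qed
  have lower: "ennreal N \<le> ennreal (1 / (1 - \<epsilon>)) * (ennreal \<Delta> * int_sum2 q) + ennreal (\<epsilon> * N)"
  proof -
    \<comment> \<open>Chosen so that the oscillation term becomes \<epsilon> N. Moving it to the
      left leaves (1 - \<epsilon>) N, and the other weight 1/(1 - \<epsilon>) supplies the second
      factor 1 - \<epsilon>.\<close>
    define \<tau> where "\<tau> = \<epsilon> / (1 - \<epsilon>)"
    have \<tau>: "\<tau> > 0" "1 + \<tau> = 1 / (1 - \<epsilon>)" "1 + 1 / \<tau> = 1 / \<epsilon>" using \<epsilon> by (auto simp: \<tau>_def field_simps)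
    have "E p k l \<le> ennreal (1 + \<tau>) * q k l + ennreal (1 + 1 / \<tau>) * d k l" for k l
    proof -
      have "E p k l \<le> cell_int (\<lambda>s t. ennreal (1 + \<tau>) * q k l
          + ennreal (1 + 1 / \<tau>) * ennreal ((V (X k l + s * u + t * u') (Y k l + s * v + t * v') - V (X k l) (Y k l))\<^sup>2))"
        unfolding q_def sqV E_def by (intro cell_int_mono ennreal_sq_young \<tau>)
      also have "\<dots> = ennreal (1 + \<tau>) * q k l + ennreal (1 + 1 / \<tau>) * d k l"
        unfolding d_def by (subst cell_int_add, measurable) (subst cell_int_cmult, measurable, simp only: cell_int_const)
      finally show ?thesis .
    qed
    then have "ennreal \<Delta> * int_sum2 (E p) \<le> ennreal \<Delta> * int_sum2 (\<lambda>k l. ennreal (1 + \<tau>) * q k l + ennreal (1 + 1 / \<tau>) * d k l)"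
      by (intro mult_left_mono int_sum2_mono) auto
    also have "\<dots> = ennreal (1 + \<tau>) * (ennreal \<Delta> * int_sum2 q) + ennreal (1 + 1 / \<tau>) * (ennreal \<Delta> * int_sum2 d)"
      by (simp only: int_sum2_add int_sum2_cmult distrib_left mult.left_commute)
    also have "\<dots> \<le> ennreal (1 / (1 - \<epsilon>)) * (ennreal \<Delta> * int_sum2 q) + ennreal (1 / \<epsilon>) * ennreal (\<epsilon>\<^sup>2 * N)"
      unfolding \<tau> by (intro add_mono mult_left_mono D) auto
    also have "ennreal (1 / \<epsilon>) * ennreal (\<epsilon>\<^sup>2 * N) = ennreal (\<epsilon> * N)"
      using \<epsilon> N by (subst ennreal_mult[symmetric]) (auto simp: power2_eq_square)
    finally show ?thesis unfolding energy N .
  qed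
  \<comment> \<open>The upper bound already contains the finiteness of the lattice sum; only now can
    it be replaced by a real number.\<close>
  have "ennreal \<Delta> * int_sum2 q < \<infinity>" using upper by (auto simp: order_le_less_trans)
  then have "int_sum2 q \<noteq> \<infinity>" using \<Delta> by (auto simp: ennreal_mult_top)
  then obtain S where S: "S \<ge> 0" "int_sum2 q = ennreal S" by (cases "int_sum2 q") auto
  have U: "\<Delta> * S \<le> (1 + \<epsilon>)\<^sup>2 * N"
    using upper S \<Delta> N by (simp add: ennreal_mult[symmetric] ennreal_le_iff)
  have "ennreal N \<le> ennreal (1 / (1 - \<epsilon>) * (\<Delta> * S) + \<epsilon> * N)"
  proof -
    have "ennreal (1 / (1 - \<epsilon>)) * (ennreal \<Delta> * ennreal S) + ennreal (\<epsilon> * N) = ennreal (1 / (1 - \<epsilon>) * (\<Delta> * S) + \<epsilon> * N)"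
      using \<epsilon> \<Delta> S N by (simp only: ennreal_mult ennreal_plus mult_nonneg_nonneg less_imp_le zero_le_divide_1_iff diff_ge_0_iff_ge)
    then show ?thesis using lower S by simp
  qed
  then have "N \<le> 1 / (1 - \<epsilon>) * (\<Delta> * S) + \<epsilon> * N"
    using \<epsilon> \<Delta> S N by (subst (asm) ennreal_le_iff) auto
  then have "(1 - \<epsilon>) * N \<le> (\<Delta> * S) / (1 - \<epsilon>)" by (simp add: algebra_simps)
  then have L: "(1 - \<epsilon>)\<^sup>2 * N \<le> \<Delta> * S" using \<epsilon> by (simp add: pos_le_divide_eq power2_eq_square ac_simps)
  show ?thesis
    by (rule that[OF S(1)]) (use S(2) L U in \<open>auto simp: q_def X_def Y_def \<Delta>_def\<close>)
qed

section \<open>Hermite functions\<close>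

definition gauss_deriv :: "complex poly \<Rightarrow> complex poly" where
  "gauss_deriv p = pderiv p - pCons 0 p"

lemma shift_gen_eq: "shift_gen u v p = smult (2 * pi * v * \<i>) (pCons 0 p) - smult (of_real u) (gauss_deriv p)"
  by (simp add: shift_gen_def gauss_deriv_def)

text \<open>The physicists' Hermite polynomials, generated by the effect of the raising operator on
  the polynomial factor.\<close>

fun herm_poly :: "nat \<Rightarrow> complex poly" where
  "herm_poly 0 = 1"
| "herm_poly (Suc n) = smult 2 (pCons 0 (herm_poly n)) - pderiv (herm_poly n)"

lemma poly_ext: "(\<And>z. poly p z = poly q z) \<Longrightarrow> p = (q :: complex poly)"
  by (metis poly_eq_poly_eq_iff ext)

text \<open>Differentiating the recursion and inserting the induction hypothesis twice reassembles
  the recursion one degree lower. The identity is what makes the lowering operator act within the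
  sequence.\<close>

lemma pderiv_herm_poly: "pderiv (herm_poly (Suc n)) = smult (2 * of_nat (Suc n)) (herm_poly n)"
proof (induction n)
  case 0
  show ?case by (simp add: pderiv_pCons pderiv_diff pderiv_smult)
next
  case (Suc n)
  have "pderiv (herm_poly (Suc (Suc n))) = smult 2 (herm_poly (Suc n)) + smult 2 (pCons 0 (pderiv (herm_poly (Suc n)))) - pderiv (pderiv (herm_poly (Suc n)))"
    by (simp only: herm_poly.simps(2)[of "Suc n"] pderiv_diff pderiv_smult pderiv_pCons smult_add_right)
  also have "pderiv (pderiv (herm_poly (Suc n))) = smult (2 * of_nat (Suc n)) (pderiv (herm_poly n))"
    unfolding Suc.IH pderiv_smult ..
  also have "smult 2 (pCons 0 (pderiv (herm_poly (Suc n)))) = smult (2 * of_nat (Suc n)) (smult 2 (pCons 0 (herm_poly n)))"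
    unfolding Suc.IH by (simp add: ac_simps)
  also have "smult 2 (herm_poly (Suc n)) + smult (2 * of_nat (Suc n)) (smult 2 (pCons 0 (herm_poly n))) - smult (2 * of_nat (Suc n)) (pderiv (herm_poly n))
     = smult 2 (herm_poly (Suc n)) + smult (2 * of_nat (Suc n)) (herm_poly (Suc n))"
    by (simp only: herm_poly.simps smult_diff_right add_diff_eq)
  also have "\<dots> = smult (2 * of_nat (Suc (Suc n))) (herm_poly (Suc n))"
    by (rule poly_eqI) (simp add: algebra_simps)
  finally show ?case .
qed

definition herm_const :: "nat \<Rightarrow> real" where
  "herm_const n = 1 / sqrt (2 ^ n * fact n * sqrt pi)"

text \<open>The normalisation distributes the factors evenly: on \<open>herm_poly\<close> raising
  has coefficient 1 and lowering 2 (n + 1), while between the normalised functions both directions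
  carry sqrt (2 (n + 1)).\<close>

lemma herm_const_Suc: "herm_const n = sqrt (2 * real (Suc n)) * herm_const (Suc n)"
proof -
  have "sqrt (2 ^ Suc n * fact (Suc n) * sqrt pi) = sqrt (2 * real (Suc n)) * sqrt (2 ^ n * fact n * sqrt pi)"
    by (simp add: real_sqrt_mult[symmetric] algebra_simps)
  then show ?thesis by (simp add: herm_const_def)
qed

definition hpoly :: "nat \<Rightarrow> complex poly" where
  "hpoly n = smult (of_real (herm_const n)) (herm_poly n)"

text \<open>The raising operator x - d/dx. The Gaussian contributes a second x p, so p becomes 2 x p
  - p', which is the recursion.\<close>

lemma raise_hpoly: "pCons 0 (hpoly n) - gauss_deriv (hpoly n) = smult (of_real (sqrt (2 * real (Suc n)))) (hpoly (Suc n))"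
proof -
  have "pCons 0 (hpoly n) - gauss_deriv (hpoly n) = smult (of_real (herm_const n)) (herm_poly (Suc n))"
    by (rule poly_ext) (simp add: gauss_deriv_def hpoly_def pderiv_smult algebra_simps)
  then show ?thesis unfolding hpoly_def herm_const_Suc[of n] by simp
qed

lemma lower_hpoly_0: "pCons 0 (hpoly 0) + gauss_deriv (hpoly 0) = 0"
  by (simp add: gauss_deriv_def hpoly_def pderiv_smult)

text \<open>The lowering operator x + d/dx. The Gaussian cancels x p and only p' remains. At n = 0
  the index n - 1 is truncated to 0, but the coefficient vanishes.\<close>

lemma lower_hpoly: "pCons 0 (hpoly n) + gauss_deriv (hpoly n) = smult (of_real (sqrt (2 * real n))) (hpoly (n - 1))"
proof (cases n)
  case 0
  then show ?thesis using lower_hpoly_0 by simp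
next
  case (Suc k)
  have "2 * real (Suc k) * herm_const (Suc k) = sqrt (2 * real (Suc k)) * herm_const k"
    using herm_const_Suc[of k] by (simp add: mult.assoc[symmetric])
  then have "complex_of_real (herm_const (Suc k)) * (2 * of_nat (Suc k)) = of_real (sqrt (2 * real (Suc k))) * of_real (herm_const k)"
    by (metis mult.commute of_real_mult of_real_of_nat_eq of_real_numeral)
  then show ?thesis
    using Suc by (simp only: gauss_deriv_def hpoly_def pderiv_smult pderiv_herm_poly smult_smult diff_Suc_1 add_diff_eq add_diff_cancel_left')
qed

text \<open>Multiplication by x is half the sum of lowering and raising, differentiation half of
  lowering minus raising; the resulting sqrt (2 n) / 2 is written as sqrt n / sqrt 2.\<close>

lemma shift_gen_hpoly:
  "shift_gen u v (hpoly n) =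
    smult ((2 * pi * v * \<i> - u) / sqrt 2 * sqrt (real n)) (hpoly (n - 1)) +
    smult ((2 * pi * v * \<i> + u) / sqrt 2 * sqrt (real (Suc n))) (hpoly (Suc n))"
proof (rule poly_ext)
  fix z
  define R where "R = complex_of_real (sqrt (2 * real (Suc n)))"
  define L where "L = complex_of_real (sqrt (2 * real n))"
  define h where "h = poly (hpoly n) z"
  define d where "d = poly (gauss_deriv (hpoly n)) z"
  define h1 where "h1 = poly (hpoly (Suc n)) z"
  define h0 where "h0 = poly (hpoly (n - 1)) z"
  have r: "1 / sqrt 2 * sqrt x = sqrt (2 * x) / 2" for x
    by (simp add: real_sqrt_mult real_div_sqrt field_simps)
  have R: "complex_of_real (1 / sqrt 2) * complex_of_real (sqrt (real (Suc n))) = R / 2"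
    using arg_cong[OF r[of "real (Suc n)"], of complex_of_real] unfolding R_def by (simp only: of_real_mult of_real_divide of_real_numeral)
  have L: "complex_of_real (1 / sqrt 2) * complex_of_real (sqrt (real n)) = L / 2"
    using arg_cong[OF r[of "real n"], of complex_of_real] unfolding L_def by (simp only: of_real_mult of_real_divide of_real_numeral)
  have e1: "R * h1 = z * h - d"
    using arg_cong[OF raise_hpoly[of n], of "\<lambda>p. poly p z"] by (simp add: R_def h1_def h_def d_def)
  have e2: "L * h0 = z * h + d"
    using arg_cong[OF lower_hpoly[of n], of "\<lambda>p. poly p z"] by (simp add: L_def h0_def h_def d_def)
  define a where "a = complex_of_real (2 * pi * v) * \<i>"
  have "poly (smult ((2 * pi * v * \<i> - u) / sqrt 2 * sqrt (real n)) (hpoly (n - 1)) +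
    smult ((2 * pi * v * \<i> + u) / sqrt 2 * sqrt (real (Suc n))) (hpoly (Suc n))) z
    = (a - u) * (complex_of_real (1 / sqrt 2) * complex_of_real (sqrt (real n))) * h0
      + (a + u) * (complex_of_real (1 / sqrt 2) * complex_of_real (sqrt (real (Suc n)))) * h1"
    by (simp add: h0_def h1_def a_def)
  also have "\<dots> = (a - u) * (L * h0) / 2 + (a + u) * (R * h1) / 2"
    unfolding R L by (simp add: mult.assoc)
  also have "\<dots> = a * (z * h) - u * d"
    unfolding e1 e2 by (simp add: field_simps)
  also have "\<dots> = poly (shift_gen u v (hpoly n)) z"
    by (simp add: shift_gen_eq a_def h_def d_def)
  finally show "poly (shift_gen u v (hpoly n)) z = poly (smult ((2 * pi * v * \<i> - u) / sqrt 2 * sqrt (real n)) (hpoly (n - 1)) +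
    smult ((2 * pi * v * \<i> + u) / sqrt 2 * sqrt (real (Suc n))) (hpoly (Suc n))) z" by (rule sym)
qed

section \<open>Orthonormality of the Hermite functions\<close>

definition ginner :: "complex poly \<Rightarrow> complex poly \<Rightarrow> complex" where
  "ginner p q = (LINT x|lborel. cnj (gauss_poly p x) * gauss_poly q x)"

lemma ginner_integrable: "integrable lborel (\<lambda>x. cnj (gauss_poly p x) * gauss_poly q x)"
  by (intro sq_int_integrable_mult sq_int_cnj sq_int_gauss_poly)

lemma ginner_add_left: "ginner (p + q) r = ginner p r + ginner q r"
  and ginner_diff_left: "ginner (p - q) r = ginner p r - ginner q r"
  and ginner_add_right: "ginner r (p + q) = ginner r p + ginner r q"
  and ginner_diff_right: "ginner r (p - q) = ginner r p - ginner r q"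
  unfolding ginner_def gauss_poly_add gauss_poly_diff complex_cnj_add complex_cnj_diff ring_distribs
  by (simp_all add: ginner_integrable)

lemma ginner_smult_left: "ginner (smult c p) r = cnj c * ginner p r"
  unfolding ginner_def gauss_poly_smult complex_cnj_mult mult.assoc by (rule integral_mult_right_zero)

lemma ginner_smult_right: "ginner r (smult c p) = c * ginner r p"
  unfolding ginner_def gauss_poly_smult by (subst mult.left_commute) (rule integral_mult_right_zero)

lemma ginner_pCons: "ginner (pCons 0 p) q = ginner p (pCons 0 q)"
  unfolding ginner_def gauss_poly_pCons by (simp add: ac_simps)

text \<open>Integration by parts: the derivative of the product is integrated over [-n, n], and the
  boundary values vanish in the limit by the Gaussian decay of both factors.\<close>

lemma ginner_gauss_deriv: "ginner (gauss_deriv p) q = - ginner p (gauss_deriv q)"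
proof -
  define F where "F = (\<lambda>x. cnj (gauss_poly p x) * gauss_poly q x)"
  define f where "f = (\<lambda>x. cnj (gauss_poly p x) * gauss_poly (gauss_deriv q) x + cnj (gauss_poly (gauss_deriv p) x) * gauss_poly q x)"
  have F: "(F has_vector_derivative f x) (at x)" for x
    unfolding F_def f_def gauss_deriv_def
    by (intro has_vector_derivative_mult has_vector_derivative_cnj gauss_poly_has_vector_derivative)
  have f: "continuous_on UNIV f" unfolding f_def by (intro continuous_intros continuous_on_gauss_poly)
  have [measurable]: "f \<in> borel_measurable borel" using f by (rule borel_measurable_continuous_onI)
  have fi: "integrable lborel f" unfolding f_def by (intro Bochner_Integration.integrable_add ginner_integrable)
  have I: "(LINT x|lborel. indicator {- real n..real n} x *\<^sub>R f x) = F (real n) - F (- real n)" for n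
    by (intro integral_FTC_Icc has_vector_derivative_at_within[OF F] continuous_on_subset[OF f]) auto
  have "(\<lambda>n. LINT x|lborel. indicator {- real n..real n} x *\<^sub>R f x) \<longlonglongrightarrow> (LINT x|lborel. f x)"
  proof (rule integral_dominated_convergence[where w="\<lambda>x. norm (f x)"])
    show "AE x in lborel. (\<lambda>n. indicator {- real n..real n} x *\<^sub>R f x) \<longlonglongrightarrow> f x"
    proof (intro AE_I2 tendsto_eventually)
      fix x :: real
      obtain N where "\<bar>x\<bar> \<le> real N" using real_arch_simple by blast
      then show "\<forall>\<^sub>F n in sequentially. indicator {- real n..real n} x *\<^sub>R f x = f x"
        unfolding eventually_sequentially by (intro exI[of _ N]) (auto simp: indicator_def abs_le_iff)
    qed
  qed (use fi in \<open>auto simp: indicator_def\<close>)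
  then have lim1: "(\<lambda>n. F (real n) - F (- real n)) \<longlonglongrightarrow> (LINT x|lborel. f x)" unfolding I .
  have lim2: "(\<lambda>n. F (real n) - F (- real n)) \<longlonglongrightarrow> 0 - 0"
  proof -
    obtain C where C: "C \<ge> 0" "\<And>x. cmod (gauss_poly p x) \<le> C * exp (- x\<^sup>2 / 4)" using gauss_poly_bound by blast
    obtain C' where C': "C' \<ge> 0" "\<And>x. cmod (gauss_poly q x) \<le> C' * exp (- x\<^sup>2 / 4)" using gauss_poly_bound by blast
    have b: "cmod (F x) \<le> (C * exp (- x\<^sup>2 / 4)) * (C' * exp (- x\<^sup>2 / 4))" for x
      unfolding F_def norm_mult complex_mod_cnj by (intro mult_mono C C') (use C in auto)
    have l: "(\<lambda>n. (C * exp (- (real n)\<^sup>2 / 4)) * (C' * exp (- (real n)\<^sup>2 / 4))) \<longlonglongrightarrow> 0"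
      by real_asymp
    have "(\<lambda>n. F (real n)) \<longlonglongrightarrow> 0"
      by (rule Lim_null_comparison[OF _ l]) (use b in auto)
    moreover have "(\<lambda>n. F (- real n)) \<longlonglongrightarrow> 0"
      by (rule Lim_null_comparison[OF _ l]) (use b[of "- real _"] in auto)
    ultimately show ?thesis by (intro tendsto_diff)
  qed
  from LIMSEQ_unique[OF lim1 lim2] have "(LINT x|lborel. f x) = 0" by simp
  moreover have "(LINT x|lborel. f x) = ginner p (gauss_deriv q) + ginner (gauss_deriv p) q"
    unfolding f_def ginner_def by (intro Bochner_Integration.integral_add ginner_integrable)
  ultimately show ?thesis by (simp add: add_eq_0_iff)
qed

text \<open>Raising and lowering are adjoint, since multiplication by x is symmetric and
  differentiation antisymmetric.\<close>

lemma ginner_raise_left: "ginner (pCons 0 p - gauss_deriv p) q = ginner p (pCons 0 q + gauss_deriv q)"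
  and ginner_raise_right: "ginner p (pCons 0 q - gauss_deriv q) = ginner (pCons 0 p + gauss_deriv p) q"
  by (simp_all add: ginner_diff_left ginner_diff_right ginner_add_left ginner_add_right ginner_pCons ginner_gauss_deriv)

text \<open>|h_0|^2 is the normal density with mean 0 and variance 1/2.\<close>

lemma ginner_hpoly_0: "ginner (hpoly 0) (hpoly 0) = 1"
proof -
  have "cnj (gauss_poly (hpoly 0) x) * gauss_poly (hpoly 0) x = of_real (normal_density 0 (1 / sqrt 2) x)" for x
  proof -
    have e: "exp (- x\<^sup>2 / 2) * exp (- x\<^sup>2 / 2) = exp (- x\<^sup>2)" by (simp flip: exp_add)
    have "cnj (gauss_poly (hpoly 0) x) * gauss_poly (hpoly 0) x = of_real ((herm_const 0 * herm_const 0) * (exp (- x\<^sup>2 / 2) * exp (- x\<^sup>2 / 2)))"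
      by (simp add: gauss_poly_def hpoly_def)
    also have "herm_const 0 * herm_const 0 = 1 / sqrt pi" by (simp add: herm_const_def)
    finally show ?thesis unfolding e by (simp add: normal_density_def power_divide)
  qed
  then have "ginner (hpoly 0) (hpoly 0) = of_real (LINT x|lborel. normal_density 0 (1 / sqrt 2) x)"
    unfolding ginner_def by (simp only: integral_complex_of_real)
  then show ?thesis by simp
qed

lemma ginner_zero_left: "ginner 0 p = 0"
  by (simp add: ginner_def gauss_poly_def)

text \<open>By adjointness the pair (n + 1, m) reduces to (n, m - 1), up to square roots that agree
  when the indices do. A raised function is orthogonal to h_0 because lowering annihilates
  h_0.\<close>

lemma ginner_hpoly: "ginner (hpoly n) (hpoly m) = of_bool (n = m)"
proof (induction n arbitrary: m)
  case 0
  show ?case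
  proof (cases m)
    case (Suc k)
    have "of_real (sqrt (2 * real (Suc k))) * ginner (hpoly 0) (hpoly (Suc k)) = 0"
      unfolding ginner_smult_right[symmetric] raise_hpoly[symmetric] ginner_raise_right lower_hpoly_0
      by (rule ginner_zero_left)
    then show ?thesis using Suc by simp
  qed (simp add: ginner_hpoly_0)
next
  case (Suc n)
  have "of_real (sqrt (2 * real (Suc n))) * ginner (hpoly (Suc n)) (hpoly m) = ginner (pCons 0 (hpoly n) - gauss_deriv (hpoly n)) (hpoly m)"
    unfolding raise_hpoly ginner_smult_left by simp
  \<comment> \<open>For m = 0 the truncated m - 1 may equal n, but then the square root is
    zero.\<close>
  also have "\<dots> = of_real (sqrt (2 * real m)) * of_bool (n = m - 1)"
    unfolding ginner_raise_left lower_hpoly ginner_smult_right Suc.IH ..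
  finally show ?case by (cases m) auto
qed

lemma orthonormal_hpoly:
  assumes "inj_on \<sigma> I"
  shows "orthonormal I (gvec (\<lambda>i. hpoly (\<sigma> i)))"
  unfolding orthonormal_def gvec_def using ginner_hpoly assms
  by (auto simp: ginner_def inj_on_def)

text \<open>Rodrigues' formula. The right-hand side extends to a holomorphic function, which is
  differentiated in the complex plane; the result is then transferred to the iterated real
  derivative of the definition.\<close>

lemma deriv_power_gauss:
  "complex_of_real ((deriv ^^ n) (\<lambda>t. exp (- t\<^sup>2)) x) = (- 1) ^ n * poly (herm_poly n) (of_real x) * of_real (exp (- x\<^sup>2))"
proof (induction n arbitrary: x)
  case (Suc n)
  let ?g = "(deriv ^^ n) (\<lambda>t::real. exp (- t\<^sup>2))"
  define D where "D = (- 1) ^ Suc n * poly (herm_poly (Suc n)) (of_real x) * complex_of_real (exp (- x\<^sup>2))"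
  have "((\<lambda>z. (- 1) ^ n * poly (herm_poly n) z * exp (- z\<^sup>2)) has_field_derivative
     (- 1) ^ Suc n * poly (herm_poly (Suc n)) (of_real x) * exp (- (complex_of_real x)\<^sup>2)) (at (of_real x))"
    by (auto intro!: derivative_eq_intros simp: algebra_simps)
  from has_vector_derivative_real_field[OF this]
  have K: "((\<lambda>x. complex_of_real (?g x)) has_vector_derivative D) (at x)"
    unfolding Suc.IH D_def by (simp add: exp_of_real[symmetric])
  \<comment> \<open>Taking real parts gives a real derivative; uniqueness of derivatives then shows
    that D itself is real.\<close>
  from bounded_linear.has_vector_derivative[OF bounded_linear_Re this]
  have g: "(?g has_real_derivative Re D) (at x)"
    by (simp add: has_real_derivative_iff_has_vector_derivative)
  then have "((\<lambda>x. complex_of_real (?g x)) has_vector_derivative of_real (Re D)) (at x)"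
    by (intro has_vector_derivative_of_real) 
  then have "D = of_real (Re D)" using K vector_derivative_unique_at by blast
  then show ?case using DERIV_imp_deriv[OF g] by (simp add: D_def)
qed simp

lemma gauss_poly_hpoly: "gauss_poly (hpoly n) x = complex_of_real (hermite n x)"
proof -
  have "complex_of_real (hermite n x) = of_real ((- 1) ^ n * herm_const n * exp (x\<^sup>2 / 2)) * ((- 1) ^ n * poly (herm_poly n) (of_real x) * of_real (exp (- x\<^sup>2)))"
    unfolding hermite_def deriv_power_gauss[symmetric] herm_const_def by simp
  also have "\<dots> = ((- 1) ^ n * (- 1) ^ n) * (of_real (herm_const n) * poly (herm_poly n) (of_real x) * of_real (exp (x\<^sup>2 / 2) * exp (- x\<^sup>2)))"
    by (simp only: of_real_mult of_real_power of_real_minus of_real_1 ac_simps)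
  also have "(- 1) ^ n * (- 1) ^ n = (1 :: complex)" by (simp flip: power_mult_distrib)
  also have "exp (x\<^sup>2 / 2) * exp (- x\<^sup>2) = exp (- x\<^sup>2 / 2)" by (simp flip: exp_add)
  finally show ?thesis by (simp only: gauss_poly_def hpoly_def poly_smult mult_1_left)
qed

lemma hermite_vec_gvec: "hermite_vec = gvec hpoly"
  by (simp add: hermite_vec_def gvec_def gauss_poly_hpoly fun_eq_iff)

section \<open>Energies of the windows produced by the ladder operators\<close>

lemma shift_gen_add: "shift_gen u v (p + q) = shift_gen u v p + shift_gen u v q"
  by (rule poly_ext) (simp add: shift_gen_def pderiv_add algebra_simps)

lemma shift_gen_smult: "shift_gen u v (smult c p) = smult c (shift_gen u v p)"
  by (rule poly_ext) (simp add: shift_gen_def pderiv_smult algebra_simps)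

lemma stft_coef_integrable:
  assumes "sq_int \<phi>"
  shows "integrable lborel (\<lambda>s. \<phi> s * cnj (gauss_poly p (s - a)) * cis (- 2 * pi * b * s))"
proof -
  have "sq_int (\<lambda>s. gauss_poly p (s + - a))" by (rule sq_int_shift[OF sq_int_gauss_poly])
  then have "integrable lborel (\<lambda>s. (\<phi> s * cis (- 2 * pi * b * s)) * cnj (gauss_poly p (s + - a)))"
    by (intro sq_int_integrable_mult sq_int_cnj sq_int_mult_bounded[where B=1] assms) auto
  then show ?thesis by (simp add: ac_simps)
qed

lemma stft_gvec_add:
  assumes "\<And>i. i \<in> I \<Longrightarrow> sq_int (\<phi> i)"
  shows "stft I \<phi> (gvec (\<lambda>i. p i + q i)) a b = stft I \<phi> (gvec p) a b + stft I \<phi> (gvec q) a b"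
  unfolding stft_def gvec_def gauss_poly_add complex_cnj_add ring_distribs
  by (simp only: Bochner_Integration.integral_add stft_coef_integrable assms sum.distrib cong: sum.cong)

text \<open>The lowered and raised parts of the windows share Hermite functions, so their sums need
  not be orthogonal; the factor 2 pays for treating the parts separately.\<close>

lemma stft_energy_add:
  assumes \<phi>: "\<And>i. i \<in> I \<Longrightarrow> sq_int (\<phi> i)"
  shows "stft_energy I \<phi> (\<lambda>i. p i + q i) \<le> 2 * stft_energy I \<phi> p + 2 * stft_energy I \<phi> q"
proof -
  note [measurable] = stft_sq_measurable[OF \<phi>]
  have "stft_sq I \<phi> (\<lambda>i. p i + q i) a b \<le> 2 * stft_sq I \<phi> p a b + 2 * stft_sq I \<phi> q a b" for a b
  proof -
    let ?x = "cmod (stft I \<phi> (gvec p) a b)" and ?y = "cmod (stft I \<phi> (gvec q) a b)"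
    have "stft_sq I \<phi> (\<lambda>i. p i + q i) a b \<le> ennreal ((?x - - ?y)\<^sup>2)"
    proof -
      have "stft I \<phi> (gvec (\<lambda>i. p i + q i)) a b = stft I \<phi> (gvec p) a b + stft I \<phi> (gvec q) a b"
        by (rule stft_gvec_add) (rule \<phi>)
      then show ?thesis unfolding stft_sq_def
        by (intro ennreal_leI power_mono) (auto intro: norm_triangle_ineq)
    qed
    also have "\<dots> \<le> 2 * stft_sq I \<phi> p a b + 2 * stft_sq I \<phi> q a b"
      using ennreal_sq_le_two[of ?x "- ?y" 0] by (simp add: stft_sq_def)
    finally show ?thesis .
  qed
  then have "stft_energy I \<phi> (\<lambda>i. p i + q i) \<le> (\<integral>\<^sup>+x. \<integral>\<^sup>+y. 2 * stft_sq I \<phi> p x y + 2 * stft_sq I \<phi> q x y \<partial>lborel \<partial>lborel)"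
    unfolding stft_energy_def by (intro nn_integral_mono)
  also have "\<dots> = 2 * stft_energy I \<phi> p + 2 * stft_energy I \<phi> q"
    unfolding stft_energy_def by (simp add: nn_integral_add nn_integral_cmult)
  finally show ?thesis .
qed

text \<open>The coefficients are moved from the windows to the signal, which leaves distinct
  normalised Hermite functions and makes \<open>stft_isometry\<close> applicable. Indices with zero
  coefficient are dropped, because a map such as i \<mapsto> i - 1 on the naturals is injective only
  away from them.\<close>

lemma stft_energy_hpoly:
  assumes I: "finite I" and \<phi>: "\<And>i. i \<in> I \<Longrightarrow> sq_int (\<phi> i)" and \<sigma>: "inj_on \<sigma> {i\<in>I. c i \<noteq> 0}"
  shows "stft_energy I \<phi> (\<lambda>i. smult (c i) (hpoly (\<sigma> i))) = ennreal (\<Sum>i\<in>I. (cmod (c i))\<^sup>2 * (LINT s|lborel. (cmod (\<phi> i s))\<^sup>2))"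
proof -
  define J where "J = {i\<in>I. c i \<noteq> 0}"
  have J: "J \<subseteq> I" "finite J" using I by (auto simp: J_def)
  define \<psi> where "\<psi> = (\<lambda>i s. cnj (c i) * \<phi> i s)"
  have \<psi>: "sq_int (\<psi> i)" if "i \<in> J" for i using that \<phi> J unfolding \<psi>_def by (intro sq_int_scale) auto
  have "stft I \<phi> (gvec (\<lambda>i. smult (c i) (hpoly (\<sigma> i)))) a b = stft J \<psi> (gvec (\<lambda>i. hpoly (\<sigma> i))) a b" for a b
  proof -
    have "stft I \<phi> (gvec (\<lambda>i. smult (c i) (hpoly (\<sigma> i)))) a b = stft I \<psi> (gvec (\<lambda>i. hpoly (\<sigma> i))) a b"
      unfolding stft_def gvec_def gauss_poly_smult \<psi>_def by (simp add: ac_simps)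
    also have "\<dots> = stft J \<psi> (gvec (\<lambda>i. hpoly (\<sigma> i))) a b"
      unfolding stft_def using I by (intro sum.mono_neutral_right) (auto simp: J_def \<psi>_def)
    finally show ?thesis .
  qed
  then have "stft_energy I \<phi> (\<lambda>i. smult (c i) (hpoly (\<sigma> i))) = (\<integral>\<^sup>+x. \<integral>\<^sup>+\<xi>. ennreal ((cmod (stft J \<psi> (gvec (\<lambda>i. hpoly (\<sigma> i))) x \<xi>))\<^sup>2) \<partial>lborel \<partial>lborel)"
    unfolding stft_energy_def stft_sq_def by simp
  also have "\<dots> = (\<Sum>i\<in>J. \<integral>\<^sup>+s. ennreal ((cmod (\<psi> i s))\<^sup>2) \<partial>lborel)"
    using \<sigma> by (intro stft_isometry J \<psi> orthonormal_hpoly) (auto simp: gvec_def J_def sq_int_gauss_poly bounded_gauss_poly)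
  also have "\<dots> = (\<Sum>i\<in>J. ennreal ((cmod (c i))\<^sup>2 * (LINT s|lborel. (cmod (\<phi> i s))\<^sup>2)))"
    using sq_int_nn_integral[OF \<psi>] by (intro sum.cong refl) (simp add: \<psi>_def norm_mult power_mult_distrib)
  also have "\<dots> = (\<Sum>i\<in>I. ennreal ((cmod (c i))\<^sup>2 * (LINT s|lborel. (cmod (\<phi> i s))\<^sup>2)))"
    using I by (intro sum.mono_neutral_left) (auto simp: J_def)
  also have "\<dots> = ennreal (\<Sum>i\<in>I. (cmod (c i))\<^sup>2 * (LINT s|lborel. (cmod (\<phi> i s))\<^sup>2))"
    by (intro sum_ennreal) auto
  finally show ?thesis .
qed

definition sq_norm :: "nat set \<Rightarrow> vfun \<Rightarrow> real" where
  "sq_norm I \<phi> = (\<Sum>i\<in>I. LINT s|lborel. (cmod (\<phi> i s))\<^sup>2)"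

lemma sq_norm_nonneg: "sq_norm I \<phi> \<ge> 0"
  unfolding sq_norm_def by (intro sum_nonneg) auto

text \<open>Only the largest coefficient enters, not the number of components; this keeps the
  dependence on d to one factor of order 2 d + 1 per application of the operator.\<close>

lemma stft_energy_hpoly_le:
  assumes I: "finite I" and \<phi>: "\<And>i. i \<in> I \<Longrightarrow> sq_int (\<phi> i)" and \<sigma>: "inj_on \<sigma> {i\<in>I. c i \<noteq> 0}"
    and c: "\<And>i. i \<in> I \<Longrightarrow> (cmod (c i))\<^sup>2 \<le> K"
  shows "stft_energy I \<phi> (\<lambda>i. smult (c i) (hpoly (\<sigma> i))) \<le> ennreal (K * sq_norm I \<phi>)"
proof -
  have "stft_energy I \<phi> (\<lambda>i. smult (c i) (hpoly (\<sigma> i))) = ennreal (\<Sum>i\<in>I. (cmod (c i))\<^sup>2 * (LINT s|lborel. (cmod (\<phi> i s))\<^sup>2))"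
    by (rule stft_energy_hpoly[OF I _ \<sigma>]) (rule \<phi>)
  also have "\<dots> \<le> ennreal (K * sq_norm I \<phi>)"
    unfolding sq_norm_def sum_distrib_left by (intro ennreal_leI sum_mono mult_right_mono c) auto
  finally show ?thesis .
qed

text \<open>The common squared modulus of both coefficients in \<open>shift_gen_hpoly\<close>, apart
  from the square roots of the index.\<close>

definition shift_size :: "real \<Rightarrow> real \<Rightarrow> real" where
  "shift_size u v = ((2 * pi * v)\<^sup>2 + u\<^sup>2) / 2"

lemma shift_size_nonneg: "shift_size u v \<ge> 0"
  by (simp add: shift_size_def)

lemma cmod_shift_coef:
  "(cmod ((2 * pi * v * \<i> - u) / sqrt 2))\<^sup>2 = shift_size u v"
  "(cmod ((2 * pi * v * \<i> + u) / sqrt 2))\<^sup>2 = shift_size u v"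
  by (simp_all add: shift_size_def norm_divide power_divide cmod_power2)

text \<open>The squared coefficients of lowering and raising are at most
  \<open>shift_size u v\<close> times d and d + 1, both at most 2 d + 1; the split into two parts
  contributes 2 + 2.\<close>

lemma stft_energy_shift_gen:
  assumes \<phi>: "\<And>i. i \<le> d \<Longrightarrow> sq_int (\<phi> i)"
  shows "stft_energy {..d} \<phi> (\<lambda>i. shift_gen u v (hpoly i))
    \<le> ennreal (4 * shift_size u v * (2 * real d + 1) * sq_norm {..d} \<phi>)"
proof -
  let ?N = "sq_norm {..d} \<phi>" and ?\<kappa> = "shift_size u v"
  let ?\<alpha> = "(2 * pi * v * \<i> - u) / sqrt 2" and ?\<beta> = "(2 * pi * v * \<i> + u) / sqrt 2"
  have \<phi>': "\<And>i. i \<in> {..d} \<Longrightarrow> sq_int (\<phi> i)" using \<phi> by simp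
  have "stft_energy {..d} \<phi> (\<lambda>i. shift_gen u v (hpoly i))
    \<le> 2 * stft_energy {..d} \<phi> (\<lambda>i. smult (?\<alpha> * sqrt (real i)) (hpoly (i - 1)))
      + 2 * stft_energy {..d} \<phi> (\<lambda>i. smult (?\<beta> * sqrt (real (Suc i))) (hpoly (Suc i)))"
    unfolding shift_gen_hpoly by (rule stft_energy_add[OF \<phi>'])
  also have "\<dots> \<le> 2 * ennreal ((?\<kappa> * (2 * real d + 1)) * ?N) + 2 * ennreal ((?\<kappa> * (2 * real d + 1)) * ?N)"
  proof (intro add_mono mult_left_mono stft_energy_hpoly_le \<phi>')
    \<comment> \<open>Truncated subtraction identifies 0 and 1, but the coefficient at 0
      vanishes.\<close>
    show "inj_on (\<lambda>i. i - 1) {i \<in> {..d}. ?\<alpha> * sqrt (real i) \<noteq> 0}"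
    proof (rule inj_onI)
      fix x y assume "x \<in> {i \<in> {..d}. ?\<alpha> * sqrt (real i) \<noteq> 0}" "y \<in> {i \<in> {..d}. ?\<alpha> * sqrt (real i) \<noteq> 0}" "x - 1 = y - 1"
      then have "x \<noteq> 0" "y \<noteq> 0" "x - 1 = y - 1" by auto
      then show "x = y" by linarith
    qed
    fix i assume "i \<in> {..d}"
    then show "(cmod (?\<alpha> * sqrt (real i)))\<^sup>2 \<le> ?\<kappa> * (2 * real d + 1)"
       "(cmod (?\<beta> * sqrt (real (Suc i))))\<^sup>2 \<le> ?\<kappa> * (2 * real d + 1)"
      unfolding norm_mult power_mult_distrib cmod_shift_coef
      using shift_size_nonneg[of u v] by (auto intro!: mult_left_mono)
  qed auto
  also have "\<dots> = ennreal (4 * ?\<kappa> * (2 * real d + 1) * ?N)"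
    using shift_size_nonneg[of u v] sq_norm_nonneg[of "{..d}" \<phi>]
    by (simp add: mult.assoc ennreal_mult' flip: mult_2)
  finally show ?thesis .
qed

lemma ennreal_double_add_double: "2 * (2 * x + 2 * x) + 2 * (2 * x + 2 * x) = ennreal 16 * x"
proof -
  have "ennreal 16 = 2 * (2 * 2) + 2 * (2 * 2)" by simp
  then show ?thesis by (simp only: distrib_left distrib_right mult.assoc mult_2 mult_1_left add.assoc)
qed

text \<open>Two ladder steps send h_i to multiples of h_(i-2), h_i, h_i and h_(i+2). Two rounds of
  splitting give each of the four energies the weight 4, hence 16 in total; the remaining 2 comes
  from (d + 1) (d + 2) \<le> 2 (2 d + 1)^2.\<close>

lemma stft_energy_shift_gen2:
  assumes \<phi>: "\<And>i. i \<le> d \<Longrightarrow> sq_int (\<phi> i)"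
  shows "stft_energy {..d} \<phi> (\<lambda>i. shift_gen u' v' (shift_gen u v (hpoly i)))
    \<le> ennreal (32 * shift_size u v * shift_size u' v' * (2 * real d + 1)\<^sup>2 * sq_norm {..d} \<phi>)"
proof -
  let ?N = "sq_norm {..d} \<phi>"
  define K where "K = 2 * (shift_size u v * shift_size u' v') * (2 * real d + 1)\<^sup>2"
  define \<alpha> where "\<alpha> = (2 * pi * v * \<i> - u) / sqrt 2"
  define \<beta> where "\<beta> = (2 * pi * v * \<i> + u) / sqrt 2"
  define \<alpha>' where "\<alpha>' = (2 * pi * v' * \<i> - u') / sqrt 2"
  define \<beta>' where "\<beta>' = (2 * pi * v' * \<i> + u') / sqrt 2"
  have \<phi>': "\<And>i. i \<in> {..d} \<Longrightarrow> sq_int (\<phi> i)" using \<phi> by simp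
  define p1 where "p1 = (\<lambda>i. smult (\<alpha> * sqrt (real i) * (\<alpha>' * sqrt (real (i - 1)))) (hpoly (i - 2)))"
  define p2 where "p2 = (\<lambda>i. smult (\<alpha> * sqrt (real i) * (\<beta>' * sqrt (real i))) (hpoly i))"
  define p3 where "p3 = (\<lambda>i. smult (\<beta> * sqrt (real (Suc i)) * (\<alpha>' * sqrt (real (Suc i)))) (hpoly i))"
  define p4 where "p4 = (\<lambda>i. smult (\<beta> * sqrt (real (Suc i)) * (\<beta>' * sqrt (real (Suc (Suc i))))) (hpoly (Suc (Suc i))))"
  have eq: "shift_gen u' v' (shift_gen u v (hpoly i)) = (p1 i + p2 i) + (p3 i + p4 i)" for i
  proof -
    have "smult (\<alpha> * sqrt (real i)) (shift_gen u' v' (hpoly (i - 1))) = p1 i + p2 i"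
    proof (cases i)
      case (Suc k)
      then show ?thesis unfolding shift_gen_hpoly p1_def p2_def \<alpha>'_def \<beta>'_def
        by (simp add: smult_add_right numeral_2_eq_2)
    qed (simp add: p1_def p2_def)
    moreover have "smult (\<beta> * sqrt (real (Suc i))) (shift_gen u' v' (hpoly (Suc i))) = p3 i + p4 i"
      unfolding shift_gen_hpoly p3_def p4_def \<alpha>'_def \<beta>'_def by (simp add: smult_add_right)
    ultimately show ?thesis
      unfolding shift_gen_hpoly[of u v] shift_gen_add shift_gen_smult \<alpha>_def \<beta>_def by simp
  qed
  have bound: "(cmod (z * sqrt x * (w * sqrt y)))\<^sup>2 \<le> K"
    if "(cmod z)\<^sup>2 = shift_size u v" "(cmod w)\<^sup>2 = shift_size u' v'" "0 \<le> x" "0 \<le> y" "x \<le> real d + 1" "y \<le> real d + 2" for z w x y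
  proof -
    have "(cmod (z * sqrt x * (w * sqrt y)))\<^sup>2 = (cmod z)\<^sup>2 * (cmod w)\<^sup>2 * (x * y)"
      using that by (simp add: norm_mult power_mult_distrib)
    also have "\<dots> = shift_size u v * shift_size u' v' * (x * y)" using that by simp
    also have "\<dots> \<le> shift_size u v * shift_size u' v' * ((real d + 1) * (real d + 2))"
      using that by (intro mult_left_mono mult_mono mult_nonneg_nonneg shift_size_nonneg) auto
    also have "\<dots> \<le> shift_size u v * shift_size u' v' * (2 * (2 * real d + 1)\<^sup>2)"
      by (intro mult_left_mono mult_nonneg_nonneg shift_size_nonneg) (auto simp: power2_eq_square algebra_simps)
    finally show ?thesis by (simp add: K_def)
  qed
  note sz = cmod_shift_coef[of v u, folded \<alpha>_def \<beta>_def] cmod_shift_coef[of v' u', folded \<alpha>'_def \<beta>'_def]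
  have E: "stft_energy {..d} \<phi> p \<le> ennreal (K * ?N)" if "p = p1 \<or> p = p2 \<or> p = p3 \<or> p = p4" for p
  proof -
    have "stft_energy {..d} \<phi> p1 \<le> ennreal (K * ?N)" unfolding p1_def
    proof (intro stft_energy_hpoly_le \<phi>' bound sz)
      \<comment> \<open>Truncation sends 0 and 1 to the same index as 2, but for these two a square
        root in the coefficient is zero.\<close>
      show "inj_on (\<lambda>i. i - 2) {i \<in> {..d}. \<alpha> * sqrt (real i) * (\<alpha>' * sqrt (real (i - 1))) \<noteq> 0}"
      proof (rule inj_onI)
        fix x y assume "x \<in> {i \<in> {..d}. \<alpha> * sqrt (real i) * (\<alpha>' * sqrt (real (i - 1))) \<noteq> 0}"
          "y \<in> {i \<in> {..d}. \<alpha> * sqrt (real i) * (\<alpha>' * sqrt (real (i - 1))) \<noteq> 0}" "x - 2 = y - 2"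
        then have "x - 1 \<noteq> 0" "y - 1 \<noteq> 0" "x - 2 = y - 2" by auto
        then show "x = y" by linarith
      qed
    qed auto
    moreover have "stft_energy {..d} \<phi> p2 \<le> ennreal (K * ?N)" unfolding p2_def
      by (intro stft_energy_hpoly_le \<phi>' bound sz) (auto intro: inj_onI)
    moreover have "stft_energy {..d} \<phi> p3 \<le> ennreal (K * ?N)" unfolding p3_def
      by (intro stft_energy_hpoly_le \<phi>' bound sz) (auto intro: inj_onI)
    moreover have "stft_energy {..d} \<phi> p4 \<le> ennreal (K * ?N)" unfolding p4_def
      by (intro stft_energy_hpoly_le \<phi>' bound sz) (auto intro: inj_onI)
    ultimately show ?thesis using that by auto
  qed
  have "stft_energy {..d} \<phi> (\<lambda>i. shift_gen u' v' (shift_gen u v (hpoly i)))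
    \<le> 2 * stft_energy {..d} \<phi> (\<lambda>i. p1 i + p2 i) + 2 * stft_energy {..d} \<phi> (\<lambda>i. p3 i + p4 i)"
    unfolding eq by (rule stft_energy_add[OF \<phi>'])
  also have "\<dots> \<le> 2 * (2 * stft_energy {..d} \<phi> p1 + 2 * stft_energy {..d} \<phi> p2) + 2 * (2 * stft_energy {..d} \<phi> p3 + 2 * stft_energy {..d} \<phi> p4)"
    by (intro add_mono mult_left_mono stft_energy_add \<phi>') auto
  also have "\<dots> \<le> 2 * (2 * ennreal (K * ?N) + 2 * ennreal (K * ?N)) + 2 * (2 * ennreal (K * ?N) + 2 * ennreal (K * ?N))"
    by (intro add_mono mult_left_mono E) auto
  also have "\<dots> = ennreal 16 * ennreal (K * ?N)" by (rule ennreal_double_add_double)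
  also have "\<dots> = ennreal (16 * (K * ?N))" by (rule ennreal_mult'[symmetric]) simp
  also have "16 * (K * ?N) = 32 * shift_size u v * shift_size u' v' * (2 * real d + 1)\<^sup>2 * ?N"
    by (simp add: K_def)
  finally show ?thesis .
qed

section \<open>Passage to the lattice and the frame bounds\<close>

lemma nn_integral_count_space_has_sum:
  fixes f :: "'a \<Rightarrow> real"
  assumes "\<And>x. f x \<ge> 0" "S \<ge> 0" "(\<integral>\<^sup>+x. ennreal (f x) \<partial>count_space UNIV) = ennreal S"
  shows "(f has_sum S) UNIV"
proof -
  have int: "integrable (count_space UNIV) f"
    using assms by (intro integrableI_nonneg) auto
  then have abs: "Infinite_Set_Sum.abs_summable_on f UNIV" by (simp add: Infinite_Set_Sum.abs_summable_on_def)
  have "ennreal (infsetsum f UNIV) = ennreal S"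
    using nn_integral_conv_infsetsum[OF abs] assms by simp
  then have "infsetsum f UNIV = S" using assms by (simp add: infsetsum_nonneg)
  then have "infsum f UNIV = S" using infsetsum_infsum[OF abs] by simp
  moreover have "f summable_on UNIV"
    using abs assms(1) by (simp flip: abs_summable_equivalent)
  ultimately show ?thesis by (metis has_sum_infsum)
qed

text \<open>A supremum in the reals is an upper bound only if the set is bounded. The cube of the
  definition lies in the Euclidean unit ball, so this follows from boundedness of the linear
  map.\<close>

lemma norm_le_mat_norm:
  fixes M :: "real^2^2"
  assumes "infnorm w \<le> 1 / 2"
  shows "norm (M *v w) \<le> mat_norm M"
proof -
  define S where "S = (\<lambda>z. norm (M *v z)) ` {z :: real^2. infnorm z \<le> 1 / 2}"
  have "bdd_above S"
  proof -
    obtain K where K: "K > 0" "\<And>z. norm (M *v z) \<le> norm z * K"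
      using bounded_linear.pos_bounded[OF matrix_vector_mul_bounded_linear[of M]] by blast
    have "norm (M *v z) \<le> 2 * K" if "infnorm z \<le> 1/2" for z :: "real^2"
    proof -
      have "sqrt 2 \<le> 2" by (simp add: real_le_lsqrt)
      then have "sqrt 2 * infnorm z \<le> 2 * (1/2)" using that by (intro mult_mono) (auto simp: infnorm_pos_le)
      then have "norm z \<le> 1" using norm_le_infnorm[of z] by simp
      then have "norm z * K \<le> 1 * K" using K by (intro mult_right_mono) auto
      then show ?thesis using K(2)[of z] K(1) by linarith
    qed
    then show ?thesis unfolding S_def by (intro bdd_aboveI[of _ "2 * K"]) auto
  qed
  then show ?thesis
    unfolding mat_norm_def S_def using assms by (intro cSUP_upper) auto
qed

text \<open>Half a unit vector lies in the cube of the definition, so each column has length at most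
  2 \<parallel>M\<parallel>.\<close>

lemma mat_norm_column:
  fixes M :: "real^2^2"
  shows "(M $ 1 $ j)\<^sup>2 + (M $ 2 $ j)\<^sup>2 \<le> 4 * (mat_norm M)\<^sup>2"
proof -
  define z where "z = (1/2) *\<^sub>R (axis j 1 :: real^2)"
  have "infnorm z \<le> 1/2"
    using infnorm_le_norm[of z] by (simp add: z_def)
  then have "norm (M *v z) \<le> mat_norm M" by (rule norm_le_mat_norm)
  then have "(norm (M *v z))\<^sup>2 \<le> (mat_norm M)\<^sup>2" by (intro power_mono) auto
  moreover have "(norm (M *v z))\<^sup>2 = ((M $ 1 $ j)\<^sup>2 + (M $ 2 $ j)\<^sup>2) / 4"
    by (simp add: z_def matrix_vector_mult_scaleR matrix_vector_mult_basis column_def norm_vec_def L2_set_def sum_2 power_mult_distrib power_divide)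
  ultimately show ?thesis by simp
qed

text \<open>The numerical constant is fixed here. Since \<epsilon> < 1, the quantity X = \<mu>^2 (2
  d + 1) is at most 1, so the mixed energy, of order X^2, is also of order X.\<close>

lemma hermite_sampling:
  assumes \<phi>: "\<And>i. i \<le> d \<Longrightarrow> sq_int (\<phi> i)" and det: "u * v' - v * u' \<noteq> 0"
    and c1: "u\<^sup>2 + v\<^sup>2 \<le> 4 * \<mu>\<^sup>2" and c2: "u'\<^sup>2 + v'\<^sup>2 \<le> 4 * \<mu>\<^sup>2" and \<mu>: "\<mu> > 0"
    and \<epsilon>: "\<epsilon> = 1000 * sqrt (2 * real d + 1) * \<mu>" "\<epsilon> < 1"
  obtains S where "S \<ge> 0"
    "int_sum2 (\<lambda>k l. stft_sq {..d} \<phi> hpoly (of_int k * u + of_int l * u') (of_int k * v + of_int l * v')) = ennreal S"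
    "(1 - \<epsilon>)\<^sup>2 * sq_norm {..d} \<phi> \<le> \<bar>u * v' - v * u'\<bar> * S" "\<bar>u * v' - v * u'\<bar> * S \<le> (1 + \<epsilon>)\<^sup>2 * sq_norm {..d} \<phi>"
proof -
  let ?N = "sq_norm {..d} \<phi>"
  have \<phi>': "\<And>i. i \<in> {..d} \<Longrightarrow> sq_int (\<phi> i)" using \<phi> by simp
  define X where "X = \<mu>\<^sup>2 * (2 * real d + 1)"
  have \<epsilon>X: "\<epsilon>\<^sup>2 = 1000000 * X" by (simp add: \<epsilon> X_def power_mult_distrib)
  have \<epsilon>0: "\<epsilon> > 0" using \<mu> by (simp add: \<epsilon>)
  have "\<epsilon>\<^sup>2 \<le> 1" using \<epsilon> \<epsilon>0 by (simp add: power_le_one)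
  then have X1: "X \<le> 1" using \<epsilon>X by simp
  have X0: "X \<ge> 0" by (simp add: X_def)
  \<comment> \<open>From pi < 4 one gets 4 pi^2 \<le> 64, so the size is at most 32 (a^2 +
    b^2).\<close>
  have size: "shift_size a b \<le> 128 * \<mu>\<^sup>2" if "a\<^sup>2 + b\<^sup>2 \<le> 4 * \<mu>\<^sup>2" for a b
  proof -
    have "(2 * pi * b)\<^sup>2 \<le> 64 * b\<^sup>2"
    proof -
      have "pi\<^sup>2 \<le> 4\<^sup>2" using pi_less_4 by (intro power_mono) auto
      then have "4 * pi\<^sup>2 * b\<^sup>2 \<le> 64 * b\<^sup>2" by (intro mult_right_mono) auto
      then show ?thesis by (simp add: power_mult_distrib)
    qed
    then have "shift_size a b \<le> (64 * b\<^sup>2 + 64 * a\<^sup>2) / 2"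
      unfolding shift_size_def by (intro divide_right_mono add_mono) auto
    then show ?thesis using that by simp
  qed
  define s where "s = shift_size u v"
  define s' where "s' = shift_size u' v'"
  have s: "0 \<le> s" "s \<le> 128 * \<mu>\<^sup>2" "0 \<le> s'" "s' \<le> 128 * \<mu>\<^sup>2"
    using size c1 c2 shift_size_nonneg by (auto simp: s_def s'_def)
  have E1: "4 * t * (2 * real d + 1) * ?N \<le> 512 * X * ?N" if "t \<le> 128 * \<mu>\<^sup>2" for t
  proof -
    have "4 * t * (2 * real d + 1) \<le> 4 * (128 * \<mu>\<^sup>2) * (2 * real d + 1)"
      using that by (intro mult_right_mono mult_left_mono) auto
    then show ?thesis unfolding X_def by (intro mult_right_mono sq_norm_nonneg) (simp add: ac_simps)
  qed
  have E2: "32 * s * s' * (2 * real d + 1)\<^sup>2 * ?N \<le> 524288 * X * ?N"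
  proof -
    have "32 * s * s' * (2 * real d + 1)\<^sup>2 \<le> 32 * (128 * \<mu>\<^sup>2) * (128 * \<mu>\<^sup>2) * (2 * real d + 1)\<^sup>2"
      using s by (intro mult_right_mono mult_mono) auto
    also have "\<dots> = 524288 * (X * X)" by (simp add: X_def power2_eq_square)
    also have "\<dots> \<le> 524288 * (X * 1)" using X0 X1 by (intro mult_left_mono) auto
    finally show ?thesis by (intro mult_right_mono sq_norm_nonneg) simp
  qed
  have NX: "0 \<le> X * ?N" using X0 sq_norm_nonneg by simp
  have energy: "stft_energy {..d} \<phi> hpoly = ennreal ?N"
    using stft_energy_hpoly[of "{..d}" \<phi> "\<lambda>i. i" "\<lambda>i. 1"] \<phi>' by (simp add: sq_norm_def)
  have "stft_energy {..d} \<phi> (\<lambda>i. shift_gen u' v' (hpoly i)) + 2 * stft_energy {..d} \<phi> (\<lambda>i. shift_gen u v (hpoly i))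
      + stft_energy {..d} \<phi> (\<lambda>i. shift_gen u' v' (shift_gen u v (hpoly i)))
     \<le> ennreal (512 * X * ?N) + 2 * ennreal (512 * X * ?N) + ennreal (524288 * X * ?N)"
  proof (intro add_mono mult_left_mono)
    show "stft_energy {..d} \<phi> (\<lambda>i. shift_gen u' v' (hpoly i)) \<le> ennreal (512 * X * ?N)"
      by (rule order_trans[OF stft_energy_shift_gen ennreal_leI[OF E1[OF s(4)[unfolded s'_def]]]]) (rule \<phi>)
    show "stft_energy {..d} \<phi> (\<lambda>i. shift_gen u v (hpoly i)) \<le> ennreal (512 * X * ?N)"
      by (rule order_trans[OF stft_energy_shift_gen ennreal_leI[OF E1[OF s(2)[unfolded s_def]]]]) (rule \<phi>)
    show "stft_energy {..d} \<phi> (\<lambda>i. shift_gen u' v' (shift_gen u v (hpoly i))) \<le> ennreal (524288 * X * ?N)"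
      by (rule order_trans[OF stft_energy_shift_gen2 ennreal_leI[OF E2[unfolded s_def s'_def]]]) (rule \<phi>)
  qed simp
  also have "\<dots> = ennreal (512 * X * ?N + 2 * (512 * X * ?N) + 524288 * X * ?N)"
  proof -
    have "2 * ennreal (512 * X * ?N) = ennreal (2 * (512 * X * ?N))"
      using NX by (subst ennreal_mult') auto
    then show ?thesis using NX by (simp add: ennreal_plus[symmetric] del: ennreal_plus)
  qed
  \<comment> \<open>512 + 2 * 512 + 524288 = 525824, below the 10^6 contained in \<epsilon>^2; here
    512 = 4 * 128 and 524288 = 32 * 128^2.\<close>
  also have "\<dots> \<le> ennreal (\<epsilon>\<^sup>2 * ?N)"
    unfolding \<epsilon>X using NX by (intro ennreal_leI) simp
  finally have le: "stft_energy {..d} \<phi> (\<lambda>i. shift_gen u' v' (hpoly i)) + 2 * stft_energy {..d} \<phi> (\<lambda>i. shift_gen u v (hpoly i))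
      + stft_energy {..d} \<phi> (\<lambda>i. shift_gen u' v' (shift_gen u v (hpoly i))) \<le> ennreal (\<epsilon>\<^sup>2 * ?N)" .
  show ?thesis
    by (rule stft_sampling[where I="{..d}" and \<phi>=\<phi>, OF \<phi>' det \<epsilon>0 \<epsilon>(2) sq_norm_nonneg energy le]) (auto intro: that)
qed

lemma L2_sq_int: "\<phi> \<in> L2 m \<longleftrightarrow> (\<forall>i<m. sq_int (\<phi> i))"
  by (simp add: L2_def sq_int_def)

lemma L2_norm_sq: "(L2_norm (d + 1) \<phi>)\<^sup>2 = sq_norm {..d} \<phi>"
proof -
  have "{..<d + 1} = {..d}" by auto
  moreover have "sq_norm {..d} \<phi> \<ge> 0" by (rule sq_norm_nonneg)
  ultimately show ?thesis unfolding L2_norm_def sq_norm_def by simp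
qed

text \<open>In \<open>tf_shift\<close> modulation precedes translation, so the modulating factor is
  evaluated at x - \<gamma> $ 1; extracting the resulting constant phase leaves
  \<open>stft\<close>.\<close>

lemma cmod_L2_inner_tf_shift:
  "cmod (L2_inner (d + 1) \<phi> (tf_shift g \<gamma>)) = cmod (stft {..d} \<phi> g (\<gamma> $ 1) (\<gamma> $ 2))"
proof -
  have "{..<d + 1} = {..d}" by auto
  then have "L2_inner (d + 1) \<phi> (tf_shift g \<gamma>) = (\<Sum>i\<le>d. LINT x|lborel. cis (2 * pi * \<gamma> $ 2 * \<gamma> $ 1) * (\<phi> i x * cnj (g i (x - \<gamma> $ 1)) * cis (- 2 * pi * \<gamma> $ 2 * x)))"
    unfolding L2_inner_def
  proof (intro sum.cong Bochner_Integration.integral_cong refl)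
    fix i x
    have "cnj (cis (2 * pi * \<gamma> $ 2 * (x - \<gamma> $ 1))) = cis (2 * pi * \<gamma> $ 2 * \<gamma> $ 1) * cis (- 2 * pi * \<gamma> $ 2 * x)"
      unfolding cis_cnj cis_mult by (rule arg_cong[of _ _ cis]) (simp add: algebra_simps)
    then show "\<phi> i x * cnj (tf_shift g \<gamma> i x) = cis (2 * pi * \<gamma> $ 2 * \<gamma> $ 1) * (\<phi> i x * cnj (g i (x - \<gamma> $ 1)) * cis (- 2 * pi * \<gamma> $ 2 * x))"
      by (simp add: tf_shift_def translate_def modulate_def)
  qed simp
  also have "\<dots> = cis (2 * pi * \<gamma> $ 2 * \<gamma> $ 1) * stft {..d} \<phi> g (\<gamma> $ 1) (\<gamma> $ 2)"
    unfolding stft_def sum_distrib_left by (intro sum.cong integral_mult_right_zero refl)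
  finally show ?thesis by (simp add: norm_mult)
qed

lemma tf_shift_hermite_L2: "tf_shift hermite_vec \<gamma> \<in> L2 m"
  unfolding L2_sq_int
proof (intro allI impI)
  fix i
  have "sq_int (\<lambda>x. gauss_poly (hpoly i) (x + - \<gamma> $ 1) * cis (2 * pi * \<gamma> $ 2 * (x - \<gamma> $ 1)))"
    by (intro sq_int_mult_bounded[where B=1] sq_int_shift sq_int_gauss_poly) auto
  then show "sq_int (tf_shift hermite_vec \<gamma> i)"
    by (simp add: tf_shift_def translate_def modulate_def hermite_vec_gvec gvec_def mult.commute)
qed

definition lattice_point :: "real^2^2 \<Rightarrow> int \<times> int \<Rightarrow> real^2" where
  "lattice_point M kl = M *v (\<chi> i. if i = 1 then of_int (fst kl) else of_int (snd kl))"

lemma lattice_point_nth: "lattice_point M (k, l) $ i = of_int k * M $ i $ 1 + of_int l * M $ i $ 2"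
  by (simp add: lattice_point_def matrix_vector_mult_def sum_2 mult.commute)

lemma lattice_of_eq: "lattice_of M = range (lattice_point M)"
proof -
  have "{z :: real^2. \<forall>i. z $ i \<in> \<int>} = range (\<lambda>kl. \<chi> i. if i = 1 then of_int (fst kl) else of_int (snd kl))"
  proof (intro set_eqI iffI)
    fix z :: "real^2" assume "z \<in> {z. \<forall>i. z $ i \<in> \<int>}"
    then have "z $ 1 \<in> \<int>" "z $ 2 \<in> \<int>" by auto
    then obtain k l where "z $ 1 = of_int k" "z $ 2 = of_int l" unfolding Ints_def by blast
    then have "z = (\<chi> i. if i = 1 then of_int (fst (k, l)) else of_int (snd (k, l)))"
      by (simp add: vec_eq_iff forall_2)
    then show "z \<in> range (\<lambda>kl. \<chi> i. if i = 1 then of_int (fst kl) else of_int (snd kl))" by blast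
  qed auto
  then show ?thesis unfolding lattice_of_def lattice_point_def by (simp only: image_image)
qed

text \<open>The frame sum runs over the lattice as a set; injectivity identifies it with the sum
  over pairs of integers.\<close>

lemma inj_lattice_point:
  assumes "invertible M"
  shows "inj (lattice_point M)"
proof (rule injI)
  fix x y assume "lattice_point M x = lattice_point M y"
  then have eq: "(\<chi> i. if i = 1 then of_int (fst x) else of_int (snd x)) = ((\<chi> i. if i = 1 then of_int (fst y) else of_int (snd y)) :: real^2)"
    unfolding lattice_point_def by (rule injD[OF inj_matrix_vector_mult[OF assms]])
  show "x = y" using arg_cong[OF eq, of "\<lambda>z. z $ 1"] arg_cong[OF eq, of "\<lambda>z. z $ 2"] by (simp add: prod_eq_iff)
qed

lemma admissible_hermite:
  "admissible (d + 1) hermite_vec (1 / 1000 / sqrt (2 * real d + 1))"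
  unfolding admissible_def
proof (intro conjI allI impI)
  define C where "C = 1 / 1000 / sqrt (2 * real d + 1)"
  have C: "C > 0" by (simp add: C_def)
  show "0 < 1 / 1000 / sqrt (2 * real d + 1)" using C by (simp add: C_def)
  have "1 \<le> sqrt (2 * real d + 1)" by simp
  then show "1 / 1000 / sqrt (2 * real d + 1) \<le> 1" by (subst divide_le_eq_1_pos) (simp, linarith)
  fix M :: "real^2^2" assume "invertible M \<and> mat_norm M < 1 / 1000 / sqrt (2 * real d + 1)"
  then have inv: "invertible M" and less: "mat_norm M < C" by (auto simp: C_def)
  define \<mu> where "\<mu> = mat_norm M"
  define u where "u = M $ 1 $ 1"
  define u' where "u' = M $ 1 $ 2"
  define v where "v = M $ 2 $ 1"
  define v' where "v' = M $ 2 $ 2"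
  define \<epsilon> where "\<epsilon> = \<mu> / C"
  have det: "det M = u * v' - v * u'" by (simp add: det_2 u_def v_def u'_def v'_def)
  have det0: "u * v' - v * u' \<noteq> 0" using inv invertible_det_nz[of M] by (simp add: det)
  have col: "u\<^sup>2 + v\<^sup>2 \<le> 4 * \<mu>\<^sup>2" "u'\<^sup>2 + v'\<^sup>2 \<le> 4 * \<mu>\<^sup>2"
    using mat_norm_column[of M] by (auto simp: u_def v_def u'_def v'_def \<mu>_def)
  \<comment> \<open>If \<mu> were 0, the first column would vanish, contradicting the nonzero
    determinant.\<close>
  have "\<mu> \<noteq> 0" using col(1) det0 by (auto simp: sum_power2_le_zero_iff)
  moreover have "\<mu> \<ge> 0"
    using norm_le_mat_norm[of 0 M] by (simp add: \<mu>_def infnorm_0)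
  ultimately have \<mu>0: "\<mu> > 0" by simp
  have \<epsilon>: "\<epsilon> = 1000 * sqrt (2 * real d + 1) * \<mu>" by (simp add: \<epsilon>_def C_def)
  have \<epsilon>1: "\<epsilon> < 1" "\<epsilon> > 0" using less C \<mu>0 by (auto simp: \<epsilon>_def \<mu>_def)
  let ?A = "1 / \<bar>det M\<bar> * (1 - mat_norm M / C)\<^sup>2" and ?B = "1 / \<bar>det M\<bar> * (1 + mat_norm M / C)\<^sup>2"
  have "frame_with_bounds (d + 1) (lattice_of M) (tf_shift hermite_vec) ?A ?B"
    unfolding frame_with_bounds_def
  proof (intro conjI ballI)
    have "(1 - \<epsilon>)\<^sup>2 > 0" using \<epsilon>1 by simp
    then show "0 < ?A" using det0 unfolding \<mu>_def[symmetric] \<epsilon>_def[symmetric] det by (intro mult_pos_pos) auto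
    show "?A \<le> ?B"
      using \<epsilon>1 unfolding \<mu>_def[symmetric] \<epsilon>_def[symmetric] by (intro mult_left_mono power_mono) auto
    show "tf_shift hermite_vec \<gamma> \<in> L2 (d + 1)" for \<gamma> by (rule tf_shift_hermite_L2)
    fix \<phi> assume "\<phi> \<in> L2 (d + 1)"
    then have \<phi>: "\<And>i. i \<le> d \<Longrightarrow> sq_int (\<phi> i)" by (auto simp: L2_sq_int)
    define F where "F = (\<lambda>\<gamma>. (cmod (L2_inner (d + 1) \<phi> (tf_shift hermite_vec \<gamma>)))\<^sup>2)"
    obtain S where S: "S \<ge> 0"
      "int_sum2 (\<lambda>k l. stft_sq {..d} \<phi> hpoly (of_int k * u + of_int l * u') (of_int k * v + of_int l * v')) = ennreal S"
      "(1 - \<epsilon>)\<^sup>2 * sq_norm {..d} \<phi> \<le> \<bar>u * v' - v * u'\<bar> * S" "\<bar>u * v' - v * u'\<bar> * S \<le> (1 + \<epsilon>)\<^sup>2 * sq_norm {..d} \<phi>"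
      using hermite_sampling[where \<phi>=\<phi> and d=d, OF \<phi> det0 col \<mu>0 \<epsilon> \<epsilon>1(1)] by blast
    have "stft_sq {..d} \<phi> hpoly (of_int k * u + of_int l * u') (of_int k * v + of_int l * v') = ennreal (F (lattice_point M (k, l)))" for k l
      unfolding F_def cmod_L2_inner_tf_shift stft_sq_def hermite_vec_gvec lattice_point_nth u_def v_def u'_def v'_def ..
    then have "(\<integral>\<^sup>+kl. ennreal (F (lattice_point M kl)) \<partial>count_space UNIV) = ennreal S"
      using S(2) nn_integral_fst_count_space[of "\<lambda>kl. ennreal (F (lattice_point M kl))"] by simp
    then have "((\<lambda>kl. F (lattice_point M kl)) has_sum S) UNIV"
      using S(1) by (intro nn_integral_count_space_has_sum) (auto simp: F_def)
    then have sum: "(F has_sum S) (lattice_of M)"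
      unfolding lattice_of_eq by (subst has_sum_reindex[OF inj_lattice_point[OF inv]]) (simp add: o_def)
    show "F summable_on lattice_of M" using sum by (auto simp: summable_on_def)
    have infs: "infsum F (lattice_of M) = S" using sum by (rule infsumI)
    have D: "\<bar>det M\<bar> > 0" using det0 by (simp add: det)
    show "?A * (L2_norm (d + 1) \<phi>)\<^sup>2 \<le> infsum F (lattice_of M)"
      using S(3) D unfolding infs L2_norm_sq \<mu>_def[symmetric] \<epsilon>_def[symmetric] det[symmetric]
      by (simp add: pos_divide_le_eq mult.commute)
    show "infsum F (lattice_of M) \<le> ?B * (L2_norm (d + 1) \<phi>)\<^sup>2"
      using S(4) D unfolding infs L2_norm_sq \<mu>_def[symmetric] \<epsilon>_def[symmetric] det[symmetric]
      by (simp add: pos_le_divide_eq mult.commute)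
  qed
  then show "frame_with_bounds (d + 1) (lattice_of M) (tf_shift hermite_vec)
     (1 / \<bar>det M\<bar> * (1 - mat_norm M / (1 / 1000 / sqrt (2 * real d + 1)))\<^sup>2)
     (1 / \<bar>det M\<bar> * (1 + mat_norm M / (1 / 1000 / sqrt (2 * real d + 1)))\<^sup>2)"
    unfolding C_def .
qed

theorem theorem1p2:
  shows "\<exists>C_H :: real. 0 < C_H \<and> C_H \<le> 1 \<and>
    (\<forall>d :: nat. optimal_const (d + 1) hermite_vec \<ge> ereal (C_H / sqrt (2 * real d + 1)))"
proof (intro exI[of _ "1 / 1000"] conjI allI)
  fix d :: nat
  show "optimal_const (d + 1) hermite_vec \<ge> ereal (1 / 1000 / sqrt (2 * real d + 1))"
    unfolding optimal_const_def by (rule SUP_upper) (use admissible_hermite in simp)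
qed auto

end
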